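(* Let $N\ge 1$ and let $a\in\Phi_r(K_2^{1/2})\cap\Phi_l(K_2^{1/2})$ be an $N\times N$ matrix function, with right canonical Wiener-Hopf factorization $a=u_-u_+$ in $K_2^{1/2}$ and left canonical Wiener-Hopf factorization $a=v_+v_-$ in $K_2^{1/2}$. Put $b=v_-u_+^{-1}$ and $c=u_-^{-1}v_+$. Then for all integers $n\ge 1$, $$\det T_n(a)=G(a)^n\,E(a)\,\det\bigl(I-Q_nH(b)H(\tilde c)Q_n\bigr),$$ where $G(a)=(\det v_+)_0(\det v_-)_0$, $E(a)=1/\det\bigl(I-H(b)H(\tilde c)\bigr)$, and the operators inside the determinants of the form $\det(I-\cdot)$ act on $\ell^2(\mathbf Z_+,\mathbf C^N)$.
   Context: $\mathbf T$ is the complex unit circle, $\mathbf Z_+=\{0,1,2,\dots\}$, and $L^\infty=L^\infty_{N\times N}$ is the algebra of all $N\times N$ matrix functions with entries in $L^\infty(\mathbf T)$. For a (matrix or scalar) function $a$ on $\mathbf T$, $a_k=(a)_k=\frac1{2\pi}\int_0^{2\pi}a(e^{i\theta})e^{-ik\theta}\,d\theta$ ($k\in\mathbf Z$) denotes its $k$th Fourier coefficient. Fix any matrix norm $\|\cdot\|$ on $\mathbf C^{N\times N}$. Put $K_2^{1/2}=\{a\in L^\infty:\sum_{n\in\mathbf Z}(|n|+1)\|a_n\|^2<\infty\}$ and $H^\infty_\pm=\{a\in L^\infty: a_{\mp n}=0\text{ for } n>0\}$. For a subset $E\subset L^\infty$, $a\in\Phi_r(E)$ means that $a$ has a right canonical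 Wiener-Hopf factorization in $E$, i.e. $a=u_-u_+$ with $u_-,u_-^{-1}\in E\cap H^\infty_-$ and $u_+,u_+^{-1}\in E\cap H^\infty_+$; $a\in\Phi_l(E)$ means that $a$ has a left canonical Wiener-Hopf factorization in $E$, i.e. $a=v_+v_-$ with $v_-,v_-^{-1}\in E\cap H^\infty_-$ and $v_+,v_+^{-1}\in E\cap H^\infty_+$. Block matrices: $T_n(a)=(a_{j-k})_{j,k=0}^{n-1}$ (finite block Toeplitz); $H(a)=(a_{j+k+1})_{j,k=0}^\infty$ and $H(\tilde a)=(a_{-j-k-1})_{j,k=0}^\infty$ (block Hankel), regarded as bounded operators on $\ell^2(\mathbf Z_+,\mathbf C^N)$. For $n\ge 0$, $Q_n$ is the projection on $\ell^2(\mathbf Z_+,\mathbf C^N)$ with $(Q_nx)_k=x_k$ for $k\ge n$ and $(Q_nx)_k=0$ for $k<n$. For the $b,c$ in the claim, $bc=I$, the operator $H(b)H(\tilde c)$ is trace class (a product of two Hilbert-Schmidt operators), and $I-H(b)H(\tilde c)$ is invertible, so $E(a)$ is well defined. Determinants of the form $\det(I-K)$ with $K$ trace class are Fredholm determinants. *)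

theory Defs
  imports "HOL-Analysis.Analysis"
begin

text \<open>
  Throughout, the matrix size N is the cardinality of the finite index type \<open>'n\<close>, and a matrix
  function on the unit circle is a function \<open>complex \<Rightarrow> complex^'n^'n\<close> of which only the values at
  the points \<open>cis t\<close>, for almost all \<open>t\<close> in \<open>{0..2*pi}\<close>, matter.  Elements of \<open>L\<^sup>\<infinity>\<close> are classes
  modulo almost everywhere equality; accordingly identities between functions are required almost
  everywhere.
\<close>

abbreviation circle_param :: "real measure" where
  "circle_param \<equiv> lebesgue_on {0..2*pi}"

definition Linf :: "(complex \<Rightarrow> complex^'n^'n) set" where
  "Linf = {a. (\<lambda>t. a (cis t)) \<in> borel_measurable circle_param \<and>
              (\<exists>C. AE t in circle_param. norm (a (cis t)) \<le> C)}"

definition fourier :: "(complex \<Rightarrow> complex) \<Rightarrow> int \<Rightarrow> complex" where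
  "fourier f k =
     1 / (2 * pi) * (LINT t|circle_param. f (cis t) * exp (- (\<i> * of_int k * of_real t)))"

definition mfourier :: "(complex \<Rightarrow> complex^'n^'n) \<Rightarrow> int \<Rightarrow> complex^'n^'n" where
  "mfourier a k = (\<chi> p q. fourier (\<lambda>z. a z $ p $ q) k)"

text \<open>The norm on \<open>complex^'n^'n\<close> is the Frobenius norm.\<close>

definition K2_half :: "(complex \<Rightarrow> complex^'n^'n) set" where
  "K2_half = {a \<in> Linf. (\<lambda>k::int. (\<bar>of_int k\<bar> + 1) * (norm (mfourier a k))\<^sup>2) summable_on UNIV}"

definition Hinf_plus :: "(complex \<Rightarrow> complex^'n^'n) set" where
  "Hinf_plus = {a \<in> Linf. \<forall>k>0. mfourier a (- k) = 0}"

definition Hinf_minus :: "(complex \<Rightarrow> complex^'n^'n) set" where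
  "Hinf_minus = {a \<in> Linf. \<forall>k>0. mfourier a k = 0}"

definition minv :: "(complex \<Rightarrow> complex^'n^'n) \<Rightarrow> complex \<Rightarrow> complex^'n^'n" where
  "minv u z = matrix_inv (u z)"

text \<open>
  \<open>u\<close> and its inverse both lie in \<open>S\<close>.  Invertibility has to be demanded separately, because
  \<open>matrix_inv\<close> takes an unspecified value at a singular matrix.
\<close>

definition unit_in :: "(complex \<Rightarrow> complex^'n^'n) set \<Rightarrow> (complex \<Rightarrow> complex^'n^'n) \<Rightarrow> bool" where
  "unit_in S u \<longleftrightarrow> u \<in> S \<and> (AE t in circle_param. invertible (u (cis t))) \<and> minv u \<in> S"

definition right_WH ::
  "(complex \<Rightarrow> complex^'n^'n) set \<Rightarrow> (complex \<Rightarrow> complex^'n^'n) \<Rightarrow>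
   (complex \<Rightarrow> complex^'n^'n) \<Rightarrow> (complex \<Rightarrow> complex^'n^'n) \<Rightarrow> bool" where
  "right_WH E a um up \<longleftrightarrow>
     unit_in (E \<inter> Hinf_minus) um \<and> unit_in (E \<inter> Hinf_plus) up \<and>
     (AE t in circle_param. a (cis t) = um (cis t) ** up (cis t))"

definition left_WH ::
  "(complex \<Rightarrow> complex^'n^'n) set \<Rightarrow> (complex \<Rightarrow> complex^'n^'n) \<Rightarrow>
   (complex \<Rightarrow> complex^'n^'n) \<Rightarrow> (complex \<Rightarrow> complex^'n^'n) \<Rightarrow> bool" where
  "left_WH E a vp vm \<longleftrightarrow>
     unit_in (E \<inter> Hinf_plus) vp \<and> unit_in (E \<inter> Hinf_minus) vm \<and>
     (AE t in circle_param. a (cis t) = vp (cis t) ** vm (cis t))"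

definition Phi_r :: "(complex \<Rightarrow> complex^'n^'n) set \<Rightarrow> (complex \<Rightarrow> complex^'n^'n) set" where
  "Phi_r E = {a. \<exists>um up. right_WH E a um up}"

definition Phi_l :: "(complex \<Rightarrow> complex^'n^'n) set \<Rightarrow> (complex \<Rightarrow> complex^'n^'n) set" where
  "Phi_l E = {a. \<exists>vp vm. left_WH E a vp vm}"

text \<open>
  The Leibniz determinant of \<open>(A i j)\<close> with \<open>i, j\<close> ranging over a finite set \<open>F\<close>; it extends the
  library's \<open>det\<close>, whose index set is a whole type.
\<close>

definition det_on :: "'i set \<Rightarrow> ('i \<Rightarrow> 'i \<Rightarrow> complex) \<Rightarrow> complex" where
  "det_on F A = (\<Sum>\<pi> | \<pi> permutes F. of_int (sign \<pi>) * (\<Prod>i\<in>F. A i (\<pi> i)))"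

lemma det_on_UNIV: "det_on UNIV (\<lambda>i j. A $ i $ j) = det A"
  by (simp add: det_on_def det_def)

definition det_toeplitz :: "nat \<Rightarrow> (complex \<Rightarrow> complex^'n^'n) \<Rightarrow> complex" where
  "det_toeplitz n a =
     det_on ({..<n} \<times> UNIV) (\<lambda>(j, p) (k, q). mfourier a (int j - int k) $ p $ q)"

text \<open>
  Operators on \<open>\<ell>\<^sup>2(\<int>\<^sub>+, \<complex>\<^sup>N)\<close> are given by their action on sequences \<open>nat \<Rightarrow> complex^'n\<close>; only
  square summable arguments are relevant.
\<close>

definition block_op ::
  "(nat \<Rightarrow> nat \<Rightarrow> complex^'n^'n) \<Rightarrow> (nat \<Rightarrow> complex^'n) \<Rightarrow> nat \<Rightarrow> complex^'n" where
  "block_op A x j = (\<Sum>\<^sub>\<infinity>k. A j k *v x k)"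

definition hankel :: "(complex \<Rightarrow> complex^'n^'n) \<Rightarrow> (nat \<Rightarrow> complex^'n) \<Rightarrow> nat \<Rightarrow> complex^'n" where
  "hankel a = block_op (\<lambda>j k. mfourier a (int j + int k + 1))"

text \<open>The Hankel operator of the reflected function \<open>z \<mapsto> a (1/z)\<close>.\<close>

definition hankel_tilde ::
  "(complex \<Rightarrow> complex^'n^'n) \<Rightarrow> (nat \<Rightarrow> complex^'n) \<Rightarrow> nat \<Rightarrow> complex^'n" where
  "hankel_tilde a = block_op (\<lambda>j k. mfourier a (- int j - int k - 1))"

definition Qproj :: "nat \<Rightarrow> (nat \<Rightarrow> complex^'n) \<Rightarrow> nat \<Rightarrow> complex^'n" where
  "Qproj n x k = (if k \<ge> n then x k else 0)"

definition basis_vec :: "nat \<times> 'n \<Rightarrow> nat \<Rightarrow> complex^'n" where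
  "basis_vec i k = (if k = fst i then axis (snd i) 1 else 0)"

definition op_entry ::
  "((nat \<Rightarrow> complex^'n) \<Rightarrow> nat \<Rightarrow> complex^'n) \<Rightarrow> nat \<times> 'n \<Rightarrow> nat \<times> 'n \<Rightarrow> complex" where
  "op_entry K i j = K (basis_vec j) (fst i) $ snd i"

text \<open>
  The Fredholm determinant \<open>det (I - K) = (\<Sum>m. (-1)^m * tr (\<Lambda>\<^sup>m K))\<close> of a trace class operator
  \<open>K\<close>.  The trace of the exterior power \<open>\<Lambda>\<^sup>m K\<close> is evaluated in the orthonormal basis of
  \<open>\<Lambda>\<^sup>m \<ell>\<^sup>2\<close> consisting of the wedge products of \<open>m\<close> distinct standard basis vectors, where its
  diagonal entries are the \<open>m \<times> m\<close> principal minors of \<open>K\<close>.  For trace class \<open>K\<close> all the sums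
  converge absolutely.
\<close>

definition trace_ext_power ::
  "nat \<Rightarrow> ((nat \<Rightarrow> complex^'n) \<Rightarrow> nat \<Rightarrow> complex^'n) \<Rightarrow> complex" where
  "trace_ext_power m K = (\<Sum>\<^sub>\<infinity>F\<in>{F. finite F \<and> card F = m}. det_on F (op_entry K))"

definition fredholm_det_I_minus ::
  "((nat \<Rightarrow> complex^'n) \<Rightarrow> nat \<Rightarrow> complex^'n) \<Rightarrow> complex" where
  "fredholm_det_I_minus K = (\<Sum>m. (- 1) ^ m * trace_ext_power m K)"

end

theory Submission imports Defs begin

text \<open>
  For a bounded matrix function \<open>f\<close> let \<open>L(f)\<close> be its Laurent matrix, with blocks \<open>f\<^sub>j\<^sub>-\<^sub>k\<close> for \<open>j, k \<in> \<int>\<close>, let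
  \<open>P\<close> project onto the indices \<open>j \<ge> 0\<close> and \<open>P\<^sub>n\<close> onto \<open>0 \<le> j < n\<close>.  By the convolution theorem \<open>L\<close> is
  multiplicative, so the symbols of the two factorizations become invertible elements
  \<open>U = L(um)\<close>, \<open>V = L(up)\<close>, \<open>R = L(vp)\<close>, \<open>S = L(vm)\<close> of the ring of bounded matrices with
  \<open>U V = R S = L(a)\<close>; the factors \<open>V, R\<close> and their inverses are lower triangular, \<open>U, S\<close> and
  their inverses upper triangular.

  Put \<open>A = P R\<^sup>-\<^sup>1 P L(a) P S\<^sup>-\<^sup>1 P\<close>.  By triangularity
  \<open>P\<^sub>n L(a) P\<^sub>n = (P\<^sub>n R P\<^sub>n) (P\<^sub>n A P\<^sub>n) (P\<^sub>n S P\<^sub>n)\<close>, and the outer factors are block triangular Toeplitz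
  matrices, whence \<open>det T\<^sub>n(a) = G\<^sup>n det (P\<^sub>n A P\<^sub>n)\<close>.  Triangularity also collapses
  \<open>P L(b) P L(c) P A\<close> to \<open>P\<close>, while \<open>b c = I\<close> gives \<open>P L(b) P L(c) P = P - K\<close> with
  \<open>K = P L(b) (1 - P) L(c) P\<close>; read on \<open>\<int>\<^sub>+\<close> this \<open>K\<close> is the product of the two Hankel operators.  So
  \<open>(I - K) A = I\<close> on \<open>\<int>\<^sub>+\<close> (\<open>wiener_hopf_algebra\<close>), and the theorem reduces to Jacobi's identity
  \<open>det (P\<^sub>n A P\<^sub>n) det (I - K) = det (I - Q\<^sub>n K Q\<^sub>n)\<close> (\<open>fredholm_series_jacobi\<close>).

  All determinants \<open>det (I - K)\<close> are handled as series of principal minors.  Since \<open>K\<close> is a product of two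
  Hilbert-Schmidt matrices, \<open>\<bar>K\<^sub>i\<^sub>j\<bar> \<le> \<beta>\<^sub>i \<gamma>\<^sub>j\<close> with square summable \<open>\<beta>\<close>, \<open>\<gamma>\<close>, and the minor over \<open>F\<close> is at
  most \<open>\<bar>F\<bar>! \<Prod>\<^sub>i\<^sub>\<in>\<^sub>F \<beta>\<^sub>i \<gamma>\<^sub>i\<close>.  These bounds are summable over all finite \<open>F\<close>
  (\<open>summable_on_fact_prod\<close>), so the series is the limit of finite determinants and is stable under small
  changes of finitely many columns.  Jacobi's identity then follows from the multiplicativity of finite
  determinants: cutting off the infinite product \<open>(I - K) A\<close> only perturbs finitely many columns, and the
  perturbation vanishes in the limit.  As the series over the complement of a large finite set is close to
  \<open>1\<close>, the same identity shows \<open>det (I - K) \<noteq> 0\<close>, so that \<open>E\<close> is a true reciprocal.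

  The convolution theorem is Parseval's relation, that is, the completeness of the exponentials in the
  mean square.  Bounded measurable functions are limits of continuous functions of the angle \<open>t\<close>,
  these are limits of polynomials in \<open>t\<close>, and products of approximable functions are approximable; hence
  it suffices to approximate \<open>t\<close> itself, for which completeness is Euler's \<open>\<Sum> 1/k\<^sup>2 = \<pi>\<^sup>2/6\<close>.
\<close>

section \<open>Determinants over finite index sets\<close>

lemma det_on_cong:
  assumes "\<And>i j. i \<in> F \<Longrightarrow> j \<in> F \<Longrightarrow> A i j = B i j"
  shows "det_on F A = det_on F B"
proof -
  have "(\<Prod>i\<in>F. A i (\<pi> i)) = (\<Prod>i\<in>F. B i (\<pi> i))" if "\<pi> permutes F" for \<pi>
    using that by (intro prod.cong refl assms) (simp_all add: permutes_in_image)
  then show ?thesis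
    unfolding det_on_def by (intro sum.cong refl) simp
qed

lemma det_on_permute_rows:
  assumes F: "finite F" and f: "f permutes F"
  shows "det_on F (\<lambda>i. B (f i)) = of_int (sign f) * det_on F B"
proof -
  have "det_on F (\<lambda>i. B (f i)) =
      (\<Sum>\<pi> | \<pi> permutes F. of_int (sign (\<pi> \<circ> f)) * (\<Prod>i\<in>F. B (f i) ((\<pi> \<circ> f) i)))"
    unfolding det_on_def by (rule sum_permutations_compose_right[OF f])
  also have "\<dots> = (\<Sum>\<pi> | \<pi> permutes F. of_int (sign f) * (of_int (sign \<pi>) * (\<Prod>i\<in>F. B i (\<pi> i))))"
  proof (rule sum.cong[OF refl])
    fix \<pi> assume "\<pi> \<in> {\<pi>. \<pi> permutes F}"
    then have \<pi>: "\<pi> permutes F" by simp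
    have "sign (\<pi> \<circ> f) = sign \<pi> * sign f"
      using \<pi> f F by (intro sign_compose permutation_permutes[THEN iffD2]) blast+
    moreover have "(\<Prod>i\<in>F. B (f i) ((\<pi> \<circ> f) i)) = (\<Prod>i\<in>F. B i (\<pi> i))"
      using prod.permute[OF f, of "\<lambda>i. B i (\<pi> i)"] by (simp add: o_def)
    ultimately show "of_int (sign (\<pi> \<circ> f)) * (\<Prod>i\<in>F. B (f i) ((\<pi> \<circ> f) i)) =
        (of_int (sign f) * (of_int (sign \<pi>) * (\<Prod>i\<in>F. B i (\<pi> i))) :: complex)"
      by simp
  qed
  also have "\<dots> = of_int (sign f) * det_on F B"
    by (simp add: det_on_def sum_distrib_left)
  finally show ?thesis .
qed

lemma det_on_identical_rows:
  assumes F: "finite F" and ij: "i \<in> F" "j \<in> F" "i \<noteq> j" and eq: "B i = B j"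
  shows "det_on F B = 0"
proof -
  have "(\<lambda>k. B (Transposition.transpose i j k)) = B"
    by (rule ext) (simp add: Transposition.transpose_def eq)
  with det_on_permute_rows[OF F permutes_swap_id[OF ij(1,2)], of B]
  have "det_on F B = of_int (sign (Transposition.transpose i j)) * det_on F B" by (simp only:)
  then have "det_on F B = - det_on F B" using ij(3) by (simp add: sign_swap_id)
  then show ?thesis by simp
qed

text \<open>
  Expanding the product row by row turns the left side into a sum over all maps \<open>f\<close> from \<open>F\<close> to \<open>F\<close>;
  a map that is not injective contributes a determinant with two equal rows, and a permutation
  contributes its sign.
\<close>
lemma det_on_mult:
  assumes F: "finite F"
  shows "det_on F (\<lambda>i j. \<Sum>k\<in>F. A i k * B k j) = det_on F A * det_on F B"
proof -
  have "det_on F (\<lambda>i j. \<Sum>k\<in>F. A i k * B k j) =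
      (\<Sum>\<pi> | \<pi> permutes F. \<Sum>f\<in>F \<rightarrow>\<^sub>E F. (\<Prod>i\<in>F. A i (f i)) * (of_int (sign \<pi>) * (\<Prod>i\<in>F. B (f i) (\<pi> i))))"
    unfolding det_on_def
    by (intro sum.cong refl) (simp add: prod_sum_PiE F prod.distrib sum_distrib_left mult_ac)
  also have "\<dots> = (\<Sum>f\<in>F \<rightarrow>\<^sub>E F. (\<Prod>i\<in>F. A i (f i)) * det_on F (\<lambda>i. B (f i)))"
    by (subst sum.swap) (simp add: det_on_def sum_distrib_left)
  also have "\<dots> = (\<Sum>f\<in>(\<lambda>\<pi>. restrict \<pi> F) ` {\<pi>. \<pi> permutes F}. (\<Prod>i\<in>F. A i (f i)) * det_on F (\<lambda>i. B (f i)))"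
  proof (rule sum.mono_neutral_right)
    show "finite (F \<rightarrow>\<^sub>E F)" by (simp add: F finite_PiE)
    show "(\<lambda>\<pi>. restrict \<pi> F) ` {\<pi>. \<pi> permutes F} \<subseteq> F \<rightarrow>\<^sub>E F"
      by (auto simp: permutes_in_image)
    show "\<forall>f\<in>(F \<rightarrow>\<^sub>E F) - (\<lambda>\<pi>. restrict \<pi> F) ` {\<pi>. \<pi> permutes F}.
        (\<Prod>i\<in>F. A i (f i)) * det_on F (\<lambda>i. B (f i)) = 0"
    proof
      fix f assume f: "f \<in> (F \<rightarrow>\<^sub>E F) - (\<lambda>\<pi>. restrict \<pi> F) ` {\<pi>. \<pi> permutes F}"
      have "\<not> inj_on f F"
      proof
        assume inj: "inj_on f F"
        have "f ` F = F"
          using f F inj by (intro card_subset_eq) (auto simp: card_image)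
        then have "bij_betw f F F" using inj by (simp add: bij_betw_def)
        then have "(\<lambda>x. if x \<in> F then f x else x) permutes F"
          by (intro bij_imp_permutes) (auto cong: bij_betw_cong)
        moreover have "f = restrict (\<lambda>x. if x \<in> F then f x else x) F"
          using f by (auto simp: fun_eq_iff PiE_def extensional_def)
        ultimately show False using f by blast
      qed
      then obtain i j where "i \<in> F" "j \<in> F" "i \<noteq> j" "f i = f j"
        by (auto simp: inj_on_def)
      then have "det_on F (\<lambda>i. B (f i)) = 0"
        by (intro det_on_identical_rows[OF F, of i j]) auto
      then show "(\<Prod>i\<in>F. A i (f i)) * det_on F (\<lambda>i. B (f i)) = 0" by simp
    qed
  qed
  also have "\<dots> = (\<Sum>\<pi> | \<pi> permutes F. (\<Prod>i\<in>F. A i (\<pi> i)) * det_on F (\<lambda>i. B (\<pi> i)))"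
  proof (subst sum.reindex)
    show "inj_on (\<lambda>\<pi>. restrict \<pi> F) {\<pi>. \<pi> permutes F}"
    proof (rule inj_onI)
      fix \<pi> \<rho> assume "\<pi> \<in> {\<pi>. \<pi> permutes F}" "\<rho> \<in> {\<pi>. \<pi> permutes F}" and eq: "restrict \<pi> F = restrict \<rho> F"
      moreover have "\<pi> x = \<rho> x" if "x \<in> F" for x
        using fun_cong[OF eq, of x] unfolding restrict_apply'[OF that] .
      ultimately have "\<pi> x = \<rho> x" for x
        by (cases "x \<in> F") (auto simp: permutes_not_in)
      then show "\<pi> = \<rho>" by blast
    qed
    show "sum ((\<lambda>f. (\<Prod>i\<in>F. A i (f i)) * det_on F (\<lambda>i. B (f i))) \<circ> (\<lambda>\<pi>. restrict \<pi> F)) {\<pi>. \<pi> permutes F} =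
        (\<Sum>\<pi> | \<pi> permutes F. (\<Prod>i\<in>F. A i (\<pi> i)) * det_on F (\<lambda>i. B (\<pi> i)))"
      by (intro sum.cong refl) (auto intro!: arg_cong2[of _ _ _ _ "(*)"] prod.cong det_on_cong)
  qed
  also have "\<dots> = det_on F A * det_on F B"
    unfolding det_on_def[of F A] sum_distrib_right
    by (intro sum.cong refl) (simp add: det_on_permute_rows[OF F, where B = B])
  finally show ?thesis .
qed

lemma det_on_transpose:
  assumes F: "finite F"
  shows "det_on F (\<lambda>i j. A j i) = det_on F A"
proof -
  have "det_on F A = (\<Sum>\<pi> | \<pi> permutes F. of_int (sign (inv \<pi>)) * (\<Prod>i\<in>F. A i (inv \<pi> i)))"
    unfolding det_on_def by (rule sum_permutations_inverse)
  also have "\<dots> = (\<Sum>\<pi> | \<pi> permutes F. of_int (sign \<pi>) * (\<Prod>i\<in>F. A (\<pi> i) i))"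
  proof (rule sum.cong[OF refl])
    fix \<pi> assume "\<pi> \<in> {\<pi>. \<pi> permutes F}"
    then have \<pi>: "\<pi> permutes F" by simp
    have "sign (inv \<pi>) = sign \<pi>"
      using \<pi> F by (intro sign_inverse permutation_permutes[THEN iffD2]) blast
    moreover have "(\<Prod>i\<in>F. A i (inv \<pi> i)) = (\<Prod>i\<in>F. A (\<pi> i) i)"
      using prod.permute[OF \<pi>, of "\<lambda>i. A i (inv \<pi> i)"] by (simp add: o_def permutes_inverses[OF \<pi>])
    ultimately show "of_int (sign (inv \<pi>)) * (\<Prod>i\<in>F. A i (inv \<pi> i)) =
        (of_int (sign \<pi>) * (\<Prod>i\<in>F. A (\<pi> i) i) :: complex)" by simp
  qed
  finally show ?thesis by (simp add: det_on_def)
qed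

text \<open>
  Only permutations fixing \<open>i\<close> survive: any other one picks an off-diagonal entry of column \<open>i\<close>.
\<close>
lemma det_on_insert_zero_column:
  assumes F: "finite F" and i: "i \<notin> F" and zero: "\<And>j. j \<in> F \<Longrightarrow> A j i = 0"
  shows "det_on (insert i F) A = A i i * det_on F A"
proof -
  have "det_on (insert i F) A =
      (\<Sum>\<pi> | \<pi> permutes F. A i i * (of_int (sign \<pi>) * (\<Prod>j\<in>F. A j (\<pi> j))))"
    unfolding det_on_def
  proof (rule sum.mono_neutral_cong_right)
    show "finite {\<pi>. \<pi> permutes insert i F}" using F by (simp add: finite_permutations)
    show "{\<pi>. \<pi> permutes F} \<subseteq> {\<pi>. \<pi> permutes insert i F}"
      by (auto intro: permutes_subset)
    show "\<forall>\<pi>\<in>{\<pi>. \<pi> permutes insert i F} - {\<pi>. \<pi> permutes F}.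
        of_int (sign \<pi>) * (\<Prod>j\<in>insert i F. A j (\<pi> j)) = 0"
    proof
      fix \<pi> assume \<pi>: "\<pi> \<in> {\<pi>. \<pi> permutes insert i F} - {\<pi>. \<pi> permutes F}"
      then have p: "\<pi> permutes insert i F" by simp
      have "\<pi> i \<noteq> i"
        using \<pi> permutes_superset[OF p, of F] by auto
      moreover obtain j where j: "\<pi> j = i" "j \<in> insert i F"
      proof
        show "\<pi> (inv \<pi> i) = i" using permutes_inverses(1)[OF p] .
        show "inv \<pi> i \<in> insert i F" using permutes_in_image[OF permutes_inv[OF p], of i] by simp
      qed
      ultimately have "j \<in> F" by auto
      then have "(\<Prod>j\<in>insert i F. A j (\<pi> j)) = 0"
        using F j zero by (intro prod_zero bexI[of _ j]) auto
      then show "of_int (sign \<pi>) * (\<Prod>j\<in>insert i F. A j (\<pi> j)) = 0" by simp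
    qed
    show "of_int (sign \<pi>) * (\<Prod>j\<in>insert i F. A j (\<pi> j)) =
        A i i * (of_int (sign \<pi>) * (\<Prod>j\<in>F. A j (\<pi> j)))" if "\<pi> \<in> {\<pi>. \<pi> permutes F}" for \<pi>
      using that F i by (simp add: permutes_not_in)
  qed
  then show ?thesis by (simp add: det_on_def sum_distrib_left)
qed

lemma det_on_unit_columns:
  assumes "finite F" "finite G" "F \<inter> G = {}"
    and unit: "\<And>i j. i \<in> F \<union> G \<Longrightarrow> j \<in> G \<Longrightarrow> A i j = of_bool (i = j)"
  shows "det_on (F \<union> G) A = det_on F A"
  using assms(2,1,3,4)
proof (induction G rule: finite_induct)
  case (insert g G)
  have "det_on (insert g (F \<union> G)) A = A g g * det_on (F \<union> G) A"
    using insert by (intro det_on_insert_zero_column) auto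
  with insert show ?case by auto
qed simp

text \<open>
  A block matrix with blocks \<open>A, 0, C, D\<close> is the product of the matrices with blocks \<open>A, 0, 0, 1\<close> and
  \<open>1, 0, C, D\<close>, and each factor reduces to one diagonal block by removing unit columns or unit rows.
\<close>
lemma det_on_block_triangular:
  assumes F: "finite F" and G: "finite G" and FG: "F \<inter> G = {}"
    and zero: "\<And>i j. i \<in> F \<Longrightarrow> j \<in> G \<Longrightarrow> A i j = 0"
  shows "det_on (F \<union> G) A = det_on F A * det_on G A"
proof -
  \<comment> \<open>the factors with blocks \<open>A, 0, 0, 1\<close> and \<open>1, 0, C, D\<close>\<close>
  define X where "X i j = (if i \<in> F \<and> j \<in> F then A i j else of_bool (i = j))" for i j
  define Y where "Y i j = (if i \<in> F then of_bool (i = j) else A i j)" for i j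
  have "det_on (F \<union> G) A = det_on (F \<union> G) (\<lambda>i j. \<Sum>k\<in>F \<union> G. X i k * Y k j)"
  proof (rule det_on_cong)
    fix i j assume ij: "i \<in> F \<union> G" "j \<in> F \<union> G"
    show "A i j = (\<Sum>k\<in>F \<union> G. X i k * Y k j)"
    proof (cases "i \<in> F")
      case True
      have "(\<Sum>k\<in>F \<union> G. X i k * Y k j) = (\<Sum>k\<in>F \<union> G. if k = j then X i k * Y k j else 0)"
        using True FG by (intro sum.cong refl) (auto simp: X_def Y_def)
      also have "\<dots> = X i j * Y j j" using F G ij by simp
      also have "\<dots> = A i j" using True ij FG zero by (auto simp: X_def Y_def)
      finally show ?thesis by simp
    next
      case False
      have "(\<Sum>k\<in>F \<union> G. X i k * Y k j) = (\<Sum>k\<in>F \<union> G. if k = i then X i k * Y k j else 0)"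
        using False by (intro sum.cong refl) (auto simp: X_def)
      also have "\<dots> = X i i * Y i j" using F G ij by simp
      also have "\<dots> = A i j" using False by (simp add: X_def Y_def)
      finally show ?thesis by simp
    qed
  qed
  also have "\<dots> = det_on (F \<union> G) X * det_on (F \<union> G) Y"
    using F G by (intro det_on_mult) simp
  also have "det_on (F \<union> G) X = det_on F X"
    using F G FG by (intro det_on_unit_columns) (auto simp: X_def)
  also have "\<dots> = det_on F A" by (rule det_on_cong) (simp add: X_def)
  also have "det_on (F \<union> G) Y = det_on (G \<union> F) (\<lambda>i j. Y j i)"
    unfolding Un_commute[of G F] using F G by (intro det_on_transpose[symmetric]) simp
  also have "\<dots> = det_on G (\<lambda>i j. Y j i)"
    using F G FG by (intro det_on_unit_columns) (auto simp: Y_def)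
  also have "\<dots> = det_on G Y" using G by (rule det_on_transpose)
  also have "\<dots> = det_on G A" using FG by (intro det_on_cong) (auto simp: Y_def)
  finally show ?thesis .
qed

text \<open>
  After expanding the product of the entries, the diagonal deltas force the permutation to fix everything
  outside \<open>S\<close>.  This is the finite form of the Fredholm expansion.
\<close>
lemma det_on_id_minus:
  assumes F: "finite F"
  shows "det_on F (\<lambda>i j. of_bool (i = j) - K i j) = (\<Sum>S\<in>Pow F. (-1) ^ card S * det_on S K)"
proof -
  have "det_on F (\<lambda>i j. of_bool (i = j) - K i j) =
     (\<Sum>\<pi> | \<pi> permutes F. \<Sum>S\<in>Pow F. (-1) ^ card S * (of_int (sign \<pi>) * ((\<Prod>i\<in>S. K i (\<pi> i)) * (\<Prod>i\<in>F - S. of_bool (i = \<pi> i)))))"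
    unfolding det_on_def by (simp add: prod_diff_conv_sum F sum_distrib_left mult_ac)
  also have "\<dots> = (\<Sum>S\<in>Pow F. (-1) ^ card S * (\<Sum>\<pi> | \<pi> permutes F. of_int (sign \<pi>) * ((\<Prod>i\<in>S. K i (\<pi> i)) * (\<Prod>i\<in>F - S. of_bool (i = \<pi> i)))))"
    by (subst sum.swap) (simp add: sum_distrib_left)
  also have "\<dots> = (\<Sum>S\<in>Pow F. (-1) ^ card S * det_on S K)"
  proof (rule sum.cong[OF refl], rule arg_cong2[of _ _ _ _ "(*)", OF refl])
    fix S assume "S \<in> Pow F"
    then have S: "S \<subseteq> F" by simp
    show "(\<Sum>\<pi> | \<pi> permutes F. of_int (sign \<pi>) * ((\<Prod>i\<in>S. K i (\<pi> i)) * (\<Prod>i\<in>F - S. of_bool (i = \<pi> i)))) = det_on S K"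
      unfolding det_on_def
    proof (rule sum.mono_neutral_cong_right)
      show "finite {\<pi>. \<pi> permutes F}" using F by (simp add: finite_permutations)
      show "{\<pi>. \<pi> permutes S} \<subseteq> {\<pi>. \<pi> permutes F}"
        using S by (auto intro: permutes_subset)
      show "\<forall>\<pi>\<in>{\<pi>. \<pi> permutes F} - {\<pi>. \<pi> permutes S}.
          of_int (sign \<pi>) * ((\<Prod>i\<in>S. K i (\<pi> i)) * (\<Prod>i\<in>F - S. of_bool (i = \<pi> i))) = 0"
      proof
        fix \<pi> assume \<pi>: "\<pi> \<in> {\<pi>. \<pi> permutes F} - {\<pi>. \<pi> permutes S}"
        then obtain i where "i \<in> F - S" "\<pi> i \<noteq> i"
          using permutes_superset[of \<pi> F S] by auto
        then have "(\<Prod>i\<in>F - S. of_bool (i = \<pi> i)) = (0::complex)"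
          using F by (intro prod_zero bexI[of _ i]) auto
        then show "of_int (sign \<pi>) * ((\<Prod>i\<in>S. K i (\<pi> i)) * (\<Prod>i\<in>F - S. of_bool (i = \<pi> i))) = 0"
          by simp
      qed
    next
      fix \<pi> assume "\<pi> \<in> {\<pi>. \<pi> permutes S}"
      then have "(\<Prod>i\<in>F - S. of_bool (i = \<pi> i)) = (1::complex)"
        by (intro prod.neutral) (auto simp: permutes_not_in)
      then show "of_int (sign \<pi>) * ((\<Prod>i\<in>S. K i (\<pi> i)) * (\<Prod>i\<in>F - S. of_bool (i = \<pi> i))) =
          of_int (sign \<pi>) * (\<Prod>i\<in>S. K i (\<pi> i))" by simp
    qed
  qed
  finally show ?thesis .
qed

lemma det_on_reindex:
  assumes F: "finite F" and h: "inj_on h F"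
  shows "det_on (h ` F) A = det_on F (\<lambda>i j. A (h i) (h j))"
proof -
  have bij: "bij_betw h F (h ` F)" using h by (simp add: bij_betw_def)
  have "det_on F (\<lambda>i j. A (h i) (h j)) =
      (\<Sum>\<pi> | \<pi> permutes F. of_int (sign (map_permutation F h \<pi>)) *
        (\<Prod>i\<in>h ` F. A i (map_permutation F h \<pi> i)))"
    unfolding det_on_def
  proof (intro sum.cong refl arg_cong2[of _ _ _ _ "(*)"])
    fix \<pi> assume "\<pi> \<in> {\<pi>. \<pi> permutes F}"
    then have \<pi>: "\<pi> permutes F" by simp
    show "of_int (sign \<pi>) = of_int (sign (map_permutation F h \<pi>))"
      using sign_map_permutation[OF h \<pi> F] by simp
    show "(\<Prod>i\<in>F. A (h i) (h (\<pi> i))) = (\<Prod>i\<in>h ` F. A i (map_permutation F h \<pi> i))"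
      using h by (simp add: prod.reindex map_permutation_def restrict_id_def)
  qed
  also have "\<dots> = det_on (h ` F) A"
    unfolding det_on_def
  proof (rule sum.reindex_bij_betw)
    show "bij_betw (map_permutation F h) {\<pi>. \<pi> permutes F} {\<pi>. \<pi> permutes h ` F}"
      using bij_betw_permutations[OF bij]
      by (simp add: map_permutation_def[abs_def] restrict_id_def[abs_def] o_def)
  qed
  finally show ?thesis by simp
qed

text \<open>
  Estimating every permutation separately, rather than by an inequality of Hadamard's type, costs a
  factorial, but \<open>summable_on_fact_prod\<close> shows that the bound remains summable.
\<close>
lemma norm_det_on_le:
  assumes F: "finite F"
    and bound: "\<And>i j. i \<in> F \<Longrightarrow> j \<in> F \<Longrightarrow> norm (K i j) \<le> \<beta> i * \<gamma> j"
  shows "norm (det_on F K) \<le> fact (card F) * (\<Prod>i\<in>F. \<beta> i * \<gamma> i)"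
proof -
  have "norm (det_on F K) \<le> (\<Sum>\<pi> | \<pi> permutes F. \<Prod>i\<in>F. \<beta> i * \<gamma> i)"
    unfolding det_on_def
  proof (rule sum_norm_le)
    fix \<pi> assume "\<pi> \<in> {\<pi>. \<pi> permutes F}"
    then have \<pi>: "\<pi> permutes F" by simp
    have "norm (of_int (sign \<pi>) * (\<Prod>i\<in>F. K i (\<pi> i))) = (\<Prod>i\<in>F. norm (K i (\<pi> i)))"
      by (simp add: norm_mult prod_norm sign_def)
    also have "\<dots> \<le> (\<Prod>i\<in>F. \<beta> i * \<gamma> (\<pi> i))"
      using \<pi> by (intro prod_mono conjI norm_ge_zero bound) (auto simp: permutes_in_image)
    also have "\<dots> = (\<Prod>i\<in>F. \<beta> i * \<gamma> i)"
      using prod.permute[OF \<pi>, of \<gamma>] by (simp add: prod.distrib o_def)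
    finally show "norm (of_int (sign \<pi>) * (\<Prod>i\<in>F. K i (\<pi> i))) \<le> (\<Prod>i\<in>F. \<beta> i * \<gamma> i)" .
  qed
  also have "\<dots> = fact (card F) * (\<Prod>i\<in>F. \<beta> i * \<gamma> i)"
    using F by (simp add: card_permutations)
  finally show ?thesis .
qed

section \<open>Principal minors and the Fredholm series\<close>

lemma power_Suc_add_ge:
  fixes s x :: real
  assumes "0 \<le> s" "0 \<le> x"
  shows "s ^ Suc m + real (Suc m) * x * s ^ m \<le> (s + x) ^ Suc m"
proof (induction m)
  case (Suc m)
  have "s ^ Suc (Suc m) + real (Suc (Suc m)) * x * s ^ Suc m \<le> (s + x) * (s ^ Suc m + real (Suc m) * x * s ^ m)"
    using assms by (simp add: algebra_simps)
  also have "\<dots> \<le> (s + x) * (s + x) ^ Suc m"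
    using Suc.IH assms by (intro mult_left_mono) auto
  finally show ?case by simp
qed simp

lemma sum_Pow_insert:
  assumes "finite F" "a \<notin> F"
  shows "(\<Sum>S\<in>Pow (insert a F). f S) = (\<Sum>S\<in>Pow F. f S) + (\<Sum>S\<in>Pow F. f (insert a S))"
proof -
  have "(\<Sum>S\<in>Pow (insert a F). f S) = (\<Sum>S\<in>Pow F. f S) + (\<Sum>S\<in>insert a ` Pow F. f S)"
    unfolding Pow_insert using assms by (intro sum.union_disjoint) auto
  also have "(\<Sum>S\<in>insert a ` Pow F. f S) = (\<Sum>S\<in>Pow F. f (insert a S))"
    using assms by (subst sum.reindex) (auto intro!: inj_onI)
  finally show ?thesis .
qed

text \<open>
  The \<open>k\<close>-th elementary symmetric polynomial times \<open>k!\<close> is the part of the \<open>k\<close>-th power of the sum that comes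
  from tuples without repetition.
\<close>
lemma fact_mult_elementary_symmetric_le:
  fixes x :: "'i \<Rightarrow> real"
  assumes F: "finite F" and x: "\<And>i. 0 \<le> x i"
  shows "fact k * (\<Sum>S\<in>Pow F. of_bool (card S = k) * prod x S) \<le> sum x F ^ k"
  using F
proof (induction F arbitrary: k rule: finite_induct)
  case empty
  show ?case by (cases k) auto
next
  case (insert a F)
  have fin: "finite S" "a \<notin> S" if "S \<in> Pow F" for S
    using that insert.hyps finite_subset by auto
  show ?case
  proof (cases k)
    case 0
    have "(\<Sum>S\<in>Pow (insert a F). of_bool (card S = 0) * prod x S) = (\<Sum>S\<in>{{}}. \<Prod>i\<in>S. x i)"
    proof (rule sum.mono_neutral_cong_right)
      show "\<forall>S\<in>Pow (insert a F) - {{}}. of_bool (card S = 0) * prod x S = 0"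
        using insert.hyps by (auto simp: card_eq_0_iff dest: finite_subset)
    qed (use insert.hyps in auto)
    with 0 show ?thesis by simp
  next
    case (Suc m)
    let ?s = "\<Sum>i\<in>F. x i"
    let ?e = "\<lambda>k. \<Sum>S\<in>Pow F. of_bool (card S = k) * prod x S"
    have step: "(\<Sum>S\<in>Pow F. of_bool (card (insert a S) = k) * prod x (insert a S)) =
        (\<Sum>S\<in>Pow F. x a * (of_bool (card S = m) * prod x S))"
      using fin by (intro sum.cong refl) (simp add: Suc)
    have "(\<Sum>S\<in>Pow (insert a F). of_bool (card S = k) * prod x S) = ?e (Suc m) + x a * ?e m"
      unfolding sum_Pow_insert[OF insert.hyps] step unfolding Suc sum_distrib_left ..
    then have "fact k * (\<Sum>S\<in>Pow (insert a F). of_bool (card S = k) * prod x S) =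
        fact k * (?e (Suc m) + x a * ?e m)" by (simp only:)
    also have "\<dots> = fact (Suc m) * ?e (Suc m) + real (Suc m) * x a * (fact m * ?e m)"
      unfolding Suc fact_Suc of_nat_mult by (simp only: distrib_left mult_ac)
    also have "\<dots> \<le> ?s ^ Suc m + real (Suc m) * x a * ?s ^ m"
    proof (intro add_mono mult_left_mono)
      show "fact (Suc m) * ?e (Suc m) \<le> ?s ^ Suc m" by (rule insert.IH)
      show "fact m * ?e m \<le> ?s ^ m" by (rule insert.IH)
      show "0 \<le> real (Suc m) * x a" using x[of a] by simp
    qed
    also have "\<dots> \<le> (?s + x a) ^ Suc m"
      by (intro power_Suc_add_ge sum_nonneg x)
    also have "\<dots> = sum x (insert a F) ^ k"
      using insert.hyps by (simp add: Suc add.commute)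
    finally show ?thesis .
  qed
qed

lemma fact_add_le: "(fact (k + h) :: real) \<le> 2 ^ (k + h) * fact k * fact h"
proof -
  have "real ((k + h) choose k) \<le> 2 ^ (k + h)"
    using binomial_le_pow2[of "k + h" k] by (metis of_nat_le_iff of_nat_numeral of_nat_power)
  then have "real ((k + h) choose k) * (fact k * fact h) \<le> 2 ^ (k + h) * (fact k * fact h)"
    by (intro mult_right_mono) auto
  moreover have "(fact (k + h) :: real) = real ((k + h) choose k) * (fact k * fact h)"
    using binomial_fact[of k "k + h", where 'a = real] by simp
  ultimately show ?thesis by (simp add: mult_ac)
qed

text \<open>
  Since \<open>(k + h)! \<le> 2\<^sup>k\<^sup>+\<^sup>h k! h!\<close>, the sets of size \<open>k\<close> contribute at most a constant times \<open>2\<^sup>k\<close> times the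
  \<open>k\<close>-th power of the total weight, which is a geometric series once that weight is below \<open>1/2\<close>; the bound
  \<open>1/4\<close> makes its ratio \<open>1/2\<close>.
\<close>
lemma sum_fact_prod_small:
  fixes x :: "'i \<Rightarrow> real"
  assumes F: "finite F" and x: "\<And>i. 0 \<le> x i" and small: "sum x F \<le> 1 / 4"
  shows "(\<Sum>S\<in>Pow F. fact (card S + h) * prod x S) \<le> 2 ^ h * fact h * 2"
proof -
  let ?e = "\<lambda>k. \<Sum>S\<in>Pow F. of_bool (card S = k) * prod x S"
  have "(\<Sum>S\<in>Pow F. fact (card S + h) * prod x S) =
      (\<Sum>S\<in>Pow F. \<Sum>k\<le>card F. fact (k + h) * (of_bool (card S = k) * prod x S))"
  proof (rule sum.cong[OF refl])
    fix S assume "S \<in> Pow F"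
    then have "card S \<le> card F" using F by (simp add: card_mono)
    then show "fact (card S + h) * prod x S =
        (\<Sum>k\<le>card F. fact (k + h) * (of_bool (card S = k) * prod x S))"
      by (simp add: of_bool_def if_distrib[of "\<lambda>u. u * _"] if_distrib[of "\<lambda>u. _ * u"] cong: if_cong)
  qed
  also have "\<dots> = (\<Sum>k\<le>card F. fact (k + h) * ?e k)"
    by (subst sum.swap) (simp add: sum_distrib_left)
  also have "\<dots> \<le> (\<Sum>k\<le>card F. 2 ^ h * fact h * (1 / 2) ^ k)"
  proof (rule sum_mono)
    fix k
    have e: "0 \<le> ?e k" by (intro sum_nonneg mult_nonneg_nonneg prod_nonneg) (auto simp: x)
    have "fact (k + h) * ?e k \<le> (2 ^ (k + h) * fact k * fact h) * ?e k"
      by (intro mult_right_mono fact_add_le e)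
    also have "\<dots> = 2 ^ (k + h) * fact h * (fact k * ?e k)" by simp
    also have "\<dots> \<le> 2 ^ (k + h) * fact h * sum x F ^ k"
      by (intro mult_left_mono fact_mult_elementary_symmetric_le F x) auto
    also have "\<dots> \<le> 2 ^ (k + h) * fact h * (1 / 4) ^ k"
      using small x by (intro mult_left_mono power_mono sum_nonneg) auto
    also have "\<dots> = 2 ^ h * fact h * (1 / 2) ^ k"
    proof -
      have "(2::real) ^ k * (1 / 4) ^ k = (1 / 2) ^ k" by (simp flip: power_mult_distrib)
      then show ?thesis by (simp add: power_add mult_ac)
    qed
    finally show "fact (k + h) * ?e k \<le> 2 ^ h * fact h * (1 / 2) ^ k" .
  qed
  also have "\<dots> = 2 ^ h * fact h * (\<Sum>k\<le>card F. (1 / 2) ^ k)" by (simp add: sum_distrib_left)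
  also have "(\<Sum>k\<le>card F. (1 / 2 :: real) ^ k) \<le> 2"
    by (simp add: sum_gp0)
  then have "2 ^ h * fact h * (\<Sum>k\<le>card F. (1 / 2 :: real) ^ k) \<le> 2 ^ h * fact h * 2"
    by (intro mult_left_mono) auto
  finally show ?thesis .
qed

text \<open>
  Adding one index to the head \<open>H\<close> splits the sets into those without it and those with it; for the
  latter the factorial is shifted by one.  This is why the shift \<open>h\<close> is part of the induction.
\<close>
lemma sum_fact_prod_bounded:
  fixes x :: "'i \<Rightarrow> real"
  assumes H: "finite H" and x: "\<And>i. 0 \<le> x i"
    and small: "\<And>F. finite F \<Longrightarrow> F \<subseteq> T \<Longrightarrow> sum x F \<le> 1 / 4"
  shows "\<exists>C. \<forall>F. finite F \<longrightarrow> F \<subseteq> H \<union> T \<longrightarrow> (\<Sum>S\<in>Pow F. fact (card S + h) * prod x S) \<le> C"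
  using H
proof (induction H arbitrary: h rule: finite_induct)
  case empty
  show ?case using sum_fact_prod_small[OF _ x small] by auto
next
  case (insert a H)
  obtain C where C: "\<And>F. finite F \<Longrightarrow> F \<subseteq> H \<union> T \<Longrightarrow> (\<Sum>S\<in>Pow F. fact (card S + h) * prod x S) \<le> C"
    using insert.IH[of h] by blast
  obtain C' where C': "\<And>F. finite F \<Longrightarrow> F \<subseteq> H \<union> T \<Longrightarrow> (\<Sum>S\<in>Pow F. fact (card S + Suc h) * prod x S) \<le> C'"
    using insert.IH[of "Suc h"] by blast
  show ?case
  proof (intro exI[of _ "C + x a * C'"] allI impI)
    fix F assume F: "finite F" "F \<subseteq> insert a H \<union> T"
    let ?F = "F - {a}"
    have F': "finite ?F" "?F \<subseteq> H \<union> T" using F by auto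
    have "(\<Sum>S\<in>Pow F. fact (card S + h) * prod x S) \<le>
        (\<Sum>S\<in>Pow (insert a ?F). fact (card S + h) * prod x S)"
      using F by (intro sum_mono2 mult_nonneg_nonneg prod_nonneg) (auto simp: x)
    also have "\<dots> = (\<Sum>S\<in>Pow ?F. fact (card S + h) * prod x S) +
        (\<Sum>S\<in>Pow ?F. fact (card (insert a S) + h) * prod x (insert a S))"
      using F' by (intro sum_Pow_insert) auto
    also have "(\<Sum>S\<in>Pow ?F. fact (card (insert a S) + h) * prod x (insert a S)) =
        (\<Sum>S\<in>Pow ?F. x a * (fact (card S + Suc h) * prod x S))"
    proof (rule sum.cong[OF refl])
      fix S assume "S \<in> Pow ?F"
      then have "finite S" "a \<notin> S" using F'(1) by (auto intro: finite_subset)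
      then show "fact (card (insert a S) + h) * prod x (insert a S) =
          x a * (fact (card S + Suc h) * prod x S)"
        by (simp add: mult_ac)
    qed
    also have "(\<Sum>S\<in>Pow ?F. fact (card S + h) * prod x S) +
        (\<Sum>S\<in>Pow ?F. x a * (fact (card S + Suc h) * prod x S)) \<le> C + x a * C'"
      unfolding sum_distrib_left[symmetric]
      by (intro add_mono mult_left_mono C C' F' x)
    finally show "(\<Sum>S\<in>Pow F. fact (card S + h) * prod x S) \<le> C + x a * C'" .
  qed
qed

lemma summable_on_small_tail:
  fixes x :: "'i \<Rightarrow> real"
  assumes sm: "x summable_on A" and x: "\<And>i. i \<in> A \<Longrightarrow> 0 \<le> x i" and e: "0 < e"
  obtains H where "finite H" "H \<subseteq> A" "\<And>F. finite F \<Longrightarrow> F \<subseteq> A - H \<Longrightarrow> sum x F \<le> e"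
proof -
  obtain H where H: "finite H" "H \<subseteq> A" "dist (sum x H) (infsum x A) \<le> e"
    using infsum_finite_approximation[OF sm e] by blast
  have "sum x F \<le> e" if F: "finite F" "F \<subseteq> A - H" for F
  proof -
    have "sum x H + sum x F = sum x (H \<union> F)"
      using H F by (intro sum.union_disjoint[symmetric]) auto
    also have "\<dots> \<le> infsum x A"
      using H F by (intro finite_sum_le_infsum sm x) auto
    finally show ?thesis using H(3) by (simp add: dist_real_def)
  qed
  with H that show ?thesis by blast
qed

text \<open>
  The generating function \<open>\<Prod>\<^sub>i (1 + t x\<^sub>i)\<close> of the elementary symmetric functions of a summable family grows slower than every
  exponential, so its Laplace transform at \<open>1\<close>, which is the sum in question, is finite.  The proof
  replaces this argument by splitting off finitely many indices.
\<close>
lemma summable_on_fact_prod: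
  fixes x :: "'i \<Rightarrow> real"
  assumes sm: "x summable_on UNIV" and x: "\<And>i. 0 \<le> x i"
  shows "(\<lambda>F. fact (card F) * prod x F) summable_on {F. finite F}"
proof -
  obtain H where H: "finite H" "\<And>F. finite F \<Longrightarrow> F \<subseteq> UNIV - H \<Longrightarrow> sum x F \<le> 1 / 4"
    using summable_on_small_tail[OF sm x, of "1 / 4"] by auto
  obtain C where C: "\<And>F. finite F \<Longrightarrow> F \<subseteq> H \<union> (UNIV - H) \<Longrightarrow> (\<Sum>S\<in>Pow F. fact (card S + 0) * prod x S) \<le> C"
    using sum_fact_prod_bounded[OF H(1) x H(2), where h = 0] by blast
  show ?thesis
  proof (rule nonneg_bdd_above_summable_on)
    show "0 \<le> fact (card F) * prod x F" for F by (intro mult_nonneg_nonneg prod_nonneg) (auto simp: x)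
    show "bdd_above (sum (\<lambda>F. fact (card F) * prod x F) ` {X. X \<subseteq> {F. finite F} \<and> finite X})"
    proof (rule bdd_aboveI2)
      fix X :: "'i set set" assume X: "X \<in> {X. X \<subseteq> {F. finite F} \<and> finite X}"
      then have fin: "finite (\<Union>X)" by auto
      have "(\<Sum>F\<in>X. fact (card F) * prod x F) \<le> (\<Sum>F\<in>Pow (\<Union>X). fact (card F) * prod x F)"
        using fin by (intro sum_mono2 mult_nonneg_nonneg prod_nonneg) (auto simp: x)
      also have "\<dots> \<le> C" using C[OF fin] by simp
      finally show "(\<Sum>F\<in>X. fact (card F) * prod x F) \<le> C" .
    qed
  qed
qed

text \<open>
  For a trace class matrix \<open>K\<close> this is the Fredholm determinant of \<open>I\<close> minus the compression of \<open>K\<close> to \<open>S\<close>.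
  Summing over all finite sets at once, rather than over each cardinality, makes it the limit of
  finite determinants along growing index sets.
\<close>
definition fredholm_series :: "'i set \<Rightarrow> ('i \<Rightarrow> 'i \<Rightarrow> complex) \<Rightarrow> complex" where
  "fredholm_series S K = (\<Sum>\<^sub>\<infinity>F | finite F \<and> F \<subseteq> S. (-1) ^ card F * det_on F K)"

context
  fixes K :: "'i \<Rightarrow> 'i \<Rightarrow> complex" and \<beta> \<gamma> :: "'i \<Rightarrow> real"
  assumes K_le: "\<And>i j. norm (K i j) \<le> \<beta> i * \<gamma> j"
    and \<beta>_nonneg: "\<And>i. 0 \<le> \<beta> i" and \<gamma>_nonneg: "\<And>i. 0 \<le> \<gamma> i"
    and \<beta>\<gamma>_summable: "(\<lambda>i. \<beta> i * \<gamma> i) summable_on UNIV"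
begin

lemma norm_minor_summable: "(\<lambda>F. norm (det_on F K)) summable_on {F. finite F \<and> F \<subseteq> S}"
proof (rule summable_on_comparison_test)
  have "(\<lambda>F. fact (card F) * (\<Prod>i\<in>F. \<beta> i * \<gamma> i)) summable_on {F. finite F}"
    by (intro summable_on_fact_prod \<beta>\<gamma>_summable mult_nonneg_nonneg \<beta>_nonneg \<gamma>_nonneg)
  then show "(\<lambda>F. fact (card F) * (\<Prod>i\<in>F. \<beta> i * \<gamma> i)) summable_on {F. finite F \<and> F \<subseteq> S}"
    by (rule summable_on_subset) auto
qed (auto intro: norm_det_on_le K_le)

lemma minor_summable: "(\<lambda>F. (-1) ^ card F * det_on F K) summable_on {F. finite F \<and> F \<subseteq> S}"
proof (rule abs_summable_summable)
  have "norm ((-1) ^ card F * det_on F K) = norm (det_on F K)" for F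
    by (simp add: norm_mult norm_power)
  then show "(\<lambda>F. norm ((-1) ^ card F * det_on F K)) summable_on {F. finite F \<and> F \<subseteq> S}"
    using norm_minor_summable by presburger
qed

text \<open>
  The finite determinants are the partial sums of the series over the power sets of \<open>F \<inter> S\<close>, and these exhaust
  the finite subsets of \<open>S\<close>.
\<close>
lemma fredholm_series_tendsto:
  "((\<lambda>F. det_on (F \<inter> S) (\<lambda>i j. of_bool (i = j) - K i j)) \<longlongrightarrow> fredholm_series S K) (finite_sets_at_top)"
proof -
  let ?X = "{F. finite F \<and> F \<subseteq> S}"
  have "filterlim (\<lambda>F. Pow (F \<inter> S)) (finite_subsets_at_top ?X) (finite_sets_at_top)"
    unfolding filterlim_finite_subsets_at_top
  proof (intro allI impI)
    fix X assume "finite X \<and> X \<subseteq> ?X"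
    then have X: "finite X" "X \<subseteq> ?X" by auto
    show "\<forall>\<^sub>F F in finite_sets_at_top. finite (Pow (F \<inter> S)) \<and> X \<subseteq> Pow (F \<inter> S) \<and> Pow (F \<inter> S) \<subseteq> ?X"
      unfolding eventually_finite_subsets_at_top
      using X by (intro exI[of _ "\<Union>X"]) (auto intro: finite_subset)
  qed
  then have "((\<lambda>F. \<Sum>T\<in>Pow (F \<inter> S). (-1) ^ card T * det_on T K) \<longlongrightarrow> fredholm_series S K) (finite_sets_at_top)"
    unfolding fredholm_series_def
    by (rule filterlim_compose[OF infsum_tendsto[OF minor_summable]])
  then show ?thesis
  proof (rule tendsto_cong[THEN iffD1, rotated])
    show "\<forall>\<^sub>F F in finite_sets_at_top. (\<Sum>T\<in>Pow (F \<inter> S). (-1) ^ card T * det_on T K) =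
        det_on (F \<inter> S) (\<lambda>i j. of_bool (i = j) - K i j)"
      by (rule eventually_finite_subsets_at_top_weakI) (simp add: det_on_id_minus)
  qed
qed

text \<open>
  The empty minor is \<open>1\<close>, and the minors over nonempty sets avoiding a large finite set have total mass at most
  \<open>1/2\<close>.
\<close>
lemma fredholm_series_tail_nonzero:
  obtains H where "finite H" "\<forall>J. H \<subseteq> J \<longrightarrow> fredholm_series (- J) K \<noteq> 0"
proof -
  have sm: "(\<lambda>F. norm (det_on F K)) summable_on {F. finite F}"
    using norm_minor_summable[of UNIV] by simp
  obtain X where X: "finite X" "X \<subseteq> {F. finite F}"
    "\<And>Y. finite Y \<Longrightarrow> Y \<subseteq> {F. finite F} - X \<Longrightarrow> (\<Sum>F\<in>Y. norm (det_on F K)) \<le> 1 / 2"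
    by (rule summable_on_small_tail[OF sm, of "1 / 2"]) auto
  have "fredholm_series (- J) K \<noteq> 0" if J: "\<Union>X \<subseteq> J" for J
  proof -
    let ?Y = "{F. finite F \<and> F \<subseteq> - J} - {{}}"
    have eq: "{F. finite F \<and> F \<subseteq> - J} = insert {} ?Y" by auto
    have smY: "(\<lambda>F. (-1) ^ card F * det_on F K) summable_on ?Y"
      by (rule summable_on_subset[OF minor_summable[of "- J"]]) auto
    have "fredholm_series (- J) K = 1 + (\<Sum>\<^sub>\<infinity>F\<in>?Y. (-1) ^ card F * det_on F K)"
      unfolding fredholm_series_def
      by (subst eq, subst infsum_insert[OF smY]) (auto simp: det_on_def)
    moreover have "norm (\<Sum>\<^sub>\<infinity>F\<in>?Y. (-1) ^ card F * det_on F K) \<le> 1 / 2"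
    proof -
      have smn: "(\<lambda>F. norm ((-1) ^ card F * det_on F K)) summable_on ?Y"
        using summable_on_subset[OF norm_minor_summable[of "- J"], of ?Y]
        by (simp add: norm_mult norm_power subset_iff)
      have "norm (\<Sum>\<^sub>\<infinity>F\<in>?Y. (-1) ^ card F * det_on F K) \<le> (\<Sum>\<^sub>\<infinity>F\<in>?Y. norm ((-1) ^ card F * det_on F K))"
        by (rule norm_infsum_bound) (rule smn)
      also have "\<dots> \<le> 1 / 2"
      proof (rule infsum_le_finite_sums[OF smn])
        fix Y assume Y: "finite Y" "Y \<subseteq> ?Y"
        have "Y \<subseteq> {F. finite F} - X"
        proof
          fix F assume "F \<in> Y"
          then have F: "finite F" "F \<subseteq> - J" "F \<noteq> {}" using Y by auto
          then have "F \<notin> X" using J by blast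
          with F show "F \<in> {F. finite F} - X" by simp
        qed
        from X(3)[OF Y(1) this] show "(\<Sum>F\<in>Y. norm ((-1) ^ card F * det_on F K)) \<le> 1 / 2"
          by (simp add: norm_mult norm_power)
      qed
      finally show ?thesis .
    qed
    ultimately show ?thesis
      using norm_triangle_ineq2[of 1 "- (\<Sum>\<^sub>\<infinity>F\<in>?Y. (-1) ^ card F * det_on F K)"] by auto
  qed
  moreover have "finite (\<Union>X)" using X by auto
  ultimately show ?thesis using that by blast
qed

end

section \<open>Jacobi's identity for the Fredholm series\<close>

lemma infsum_complement_tendsto_0:
  fixes f :: "'i \<Rightarrow> real"
  assumes f: "f summable_on UNIV"
  shows "((\<lambda>F. infsum f (- F)) \<longlongrightarrow> 0) (finite_sets_at_top)"
proof -
  have "((\<lambda>F. infsum f UNIV - sum f F) \<longlongrightarrow> infsum f UNIV - infsum f UNIV) (finite_sets_at_top)"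
    by (intro tendsto_diff tendsto_const infsum_tendsto f)
  moreover have "infsum f UNIV - sum f F = infsum f (- F)" if "finite F" for F
  proof -
    have "infsum f (F \<union> - F) = infsum f F + infsum f (- F)"
      using f that by (intro infsum_Un_disjoint summable_on_subset[OF f]) auto
    then show ?thesis using that by simp
  qed
  ultimately show ?thesis
    by (subst tendsto_cong[OF eventually_finite_subsets_at_top_weakI, symmetric]) auto
qed

text \<open>
  If the columns in \<open>J\<close> of \<open>I - K\<close> are replaced by unit columns up to an error of relative size \<open>\<delta>\<close>, then
  in the minor expansion every set meeting \<open>J\<close> picks up a factor \<open>\<delta>\<close>, and the sets avoiding \<open>J\<close> form the
  determinant over \<open>F - J\<close>.
\<close>
lemma norm_id_minus_perturbation_le:
  fixes K :: "'i \<Rightarrow> 'i \<Rightarrow> complex"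
  assumes F: "finite F" and J: "J \<subseteq> F"
    and K_le: "\<And>i j. norm (K i j) \<le> \<beta> i * \<gamma> j"
    and nonneg: "\<And>i. 0 \<le> \<beta> i" "\<And>i. 0 \<le> \<gamma> i"
    and K': "\<And>i j. j \<notin> J \<Longrightarrow> K' i j = K i j"
    and K'_le: "\<And>i j. j \<in> J \<Longrightarrow> norm (K' i j) \<le> \<beta> i * \<delta>"
    and \<delta>: "0 \<le> \<delta>" "\<delta> \<le> 1"
    and W: "(\<Sum>S\<in>Pow F. fact (card S) * (\<Prod>i\<in>S. \<beta> i * (if i \<in> J then 1 else \<gamma> i))) \<le> W"
  shows "norm (det_on F (\<lambda>i j. of_bool (i = j) - K' i j) - det_on (F - J) (\<lambda>i j. of_bool (i = j) - K i j)) \<le> \<delta> * W"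
proof -
  let ?\<gamma> = "\<lambda>i. if i \<in> J then 1 else \<gamma> i"
  have sub: "Pow (F - J) \<subseteq> Pow F" by auto
  have "det_on F (\<lambda>i j. of_bool (i = j) - K' i j) - det_on (F - J) (\<lambda>i j. of_bool (i = j) - K i j) =
      (\<Sum>S\<in>Pow F. (-1) ^ card S * det_on S K') - (\<Sum>S\<in>Pow (F - J). (-1) ^ card S * det_on S K)"
    using F by (simp add: det_on_id_minus)
  also have "(\<Sum>S\<in>Pow (F - J). (-1) ^ card S * det_on S K) = (\<Sum>S\<in>Pow (F - J). (-1) ^ card S * det_on S K')"
    using K' by (intro sum.cong refl arg_cong2[of _ _ _ _ "(*)"] det_on_cong) auto
  also have "(\<Sum>S\<in>Pow F. (-1) ^ card S * det_on S K') - \<dots> = (\<Sum>S\<in>Pow F - Pow (F - J). (-1) ^ card S * det_on S K')"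
    using F sub by (simp add: sum_diff)
  also have "norm \<dots> \<le> (\<Sum>S\<in>Pow F - Pow (F - J). \<delta> * (fact (card S) * (\<Prod>i\<in>S. \<beta> i * ?\<gamma> i)))"
  proof (rule sum_norm_le)
    fix S assume S: "S \<in> Pow F - Pow (F - J)"
    have fin: "finite S" using S F finite_subset by blast
    obtain j where j: "j \<in> S" "j \<in> J" using S by blast
    let ?d = "\<lambda>i. if i \<in> J then \<delta> else 1"
    have "norm ((-1) ^ card S * det_on S K') = norm (det_on S K')" by (simp add: norm_mult norm_power)
    also have "\<dots> \<le> fact (card S) * (\<Prod>i\<in>S. \<beta> i * (if i \<in> J then \<delta> else \<gamma> i))"
      using fin by (rule norm_det_on_le) (simp add: K' K_le K'_le)
    also have "(\<Prod>i\<in>S. \<beta> i * (if i \<in> J then \<delta> else \<gamma> i)) = (\<Prod>i\<in>S. ?d i) * (\<Prod>i\<in>S. \<beta> i * ?\<gamma> i)"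
      by (simp flip: prod.distrib) (auto intro: prod.cong)
    also have "(\<Prod>i\<in>S. ?d i) = \<delta> * (\<Prod>i\<in>S - {j}. ?d i)"
      using fin j by (simp add: prod.remove)
    also have "(\<Prod>i\<in>S - {j}. ?d i) \<le> 1"
      using \<delta> by (intro prod_le_1) auto
    finally show "norm ((-1) ^ card S * det_on S K') \<le> \<delta> * (fact (card S) * (\<Prod>i\<in>S. \<beta> i * ?\<gamma> i))"
      using \<delta> nonneg by (simp add: mult_left_mono mult_right_mono prod_nonneg mult_ac)
  qed
  also have "\<dots> \<le> (\<Sum>S\<in>Pow F. \<delta> * (fact (card S) * (\<Prod>i\<in>S. \<beta> i * ?\<gamma> i)))"
    using F \<delta> nonneg by (intro sum_mono2 mult_nonneg_nonneg prod_nonneg) auto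
  also have "\<dots> \<le> \<delta> * W"
    unfolding sum_distrib_left[symmetric] using \<delta> W by (intro mult_left_mono) auto
  finally show ?thesis .
qed

text \<open>
  The hypothesis says \<open>(I - K) A = I\<close> on the columns in \<open>J\<close>.  For a finite \<open>F\<close> containing \<open>J\<close>, multiply the compression of
  \<open>I - K\<close> to \<open>F\<close> by the matrix that has the columns of \<open>A\<close> in \<open>J\<close> and unit columns elsewhere: the determinant of
  the second factor is that of \<open>A\<close> over \<open>J\<close>, and the product is \<open>I - K\<close> with the columns in \<open>J\<close> replaced by
  unit columns, up to the part of \<open>K A\<close> that runs through indices outside \<open>F\<close>.  That part tends to
  zero.
\<close>
theorem fredholm_series_jacobi:
  fixes K A :: "'i \<Rightarrow> 'i \<Rightarrow> complex" and \<beta> \<gamma> :: "'i \<Rightarrow> real"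
  assumes K_le: "\<And>i j. norm (K i j) \<le> \<beta> i * \<gamma> j"
    and nonneg: "\<And>i. 0 \<le> \<beta> i" "\<And>i. 0 \<le> \<gamma> i"
    and \<beta>\<gamma>_summable: "(\<lambda>i. \<beta> i * \<gamma> i) summable_on UNIV"
    and J: "finite J"
    and A_summable: "\<And>j. j \<in> J \<Longrightarrow> (\<lambda>k. \<gamma> k * norm (A k j)) summable_on UNIV"
    and A_inverse: "\<And>i j. j \<in> J \<Longrightarrow> A i j = of_bool (i = j) + (\<Sum>\<^sub>\<infinity>k. K i k * A k j)"
  shows "det_on J A * fredholm_series UNIV K = fredholm_series (- J) K"
proof -
  let ?M = "\<lambda>i j. of_bool (i = j) - K i j"
  let ?\<gamma> = "\<lambda>i. if i \<in> J then 1 else \<gamma> i"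
  \<comment> \<open>the part of \<open>K A\<close> lost by cutting off at \<open>F\<close>, and a bound for its columns in \<open>J\<close>\<close>
  define \<epsilon> where "\<epsilon> F i j = (\<Sum>\<^sub>\<infinity>k\<in>- F. K i k * A k j)" for F i j
  define \<delta> where "\<delta> F = (\<Sum>j\<in>J. \<Sum>\<^sub>\<infinity>k\<in>- F. \<gamma> k * norm (A k j))" for F
  have term_le: "norm (K i k * A k j) \<le> \<beta> i * (\<gamma> k * norm (A k j))" for i k j
    using mult_right_mono[OF K_le[of i k] norm_ge_zero[of "A k j"]] by (simp add: norm_mult mult_ac)
  have sm_right: "(\<lambda>k. \<beta> i * (\<gamma> k * norm (A k j))) summable_on X" if "j \<in> J" for i j X
    by (intro summable_on_cmult_right summable_on_subset[OF A_summable[OF that]]) auto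
  have sm_norm: "(\<lambda>k. norm (K i k * A k j)) summable_on X" if "j \<in> J" for i j X
    by (rule Infinite_Sum.abs_summable_on_comparison_test'[OF sm_right[OF that] term_le])
  have sm: "(\<lambda>k. K i k * A k j) summable_on X" if "j \<in> J" for i j X
    by (rule abs_summable_summable[OF sm_norm[OF that]])
  have \<delta>_nonneg: "0 \<le> \<delta> F" for F
    unfolding \<delta>_def by (intro sum_nonneg infsum_nonneg mult_nonneg_nonneg nonneg norm_ge_zero)
  have \<epsilon>_le: "norm (\<epsilon> F i j) \<le> \<beta> i * \<delta> F" if j: "j \<in> J" for F i j
  proof -
    have "norm (\<epsilon> F i j) \<le> (\<Sum>\<^sub>\<infinity>k\<in>- F. norm (K i k * A k j))"
      unfolding \<epsilon>_def by (rule norm_infsum_bound[OF sm_norm[OF j]])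
    also have "\<dots> \<le> (\<Sum>\<^sub>\<infinity>k\<in>- F. \<beta> i * (\<gamma> k * norm (A k j)))"
      by (rule infsum_mono[OF sm_norm[OF j] sm_right[OF j] term_le])
    also have "\<dots> = \<beta> i * (\<Sum>\<^sub>\<infinity>k\<in>- F. \<gamma> k * norm (A k j))"
      by (rule infsum_cmult_right')
    also have "(\<Sum>\<^sub>\<infinity>k\<in>- F. \<gamma> k * norm (A k j)) \<le> \<delta> F"
      unfolding \<delta>_def using j J
      by (intro member_le_sum infsum_nonneg mult_nonneg_nonneg nonneg norm_ge_zero)
    finally show ?thesis using nonneg(1)[of i] by (simp add: mult_left_mono)
  qed
  have \<delta>_tendsto: "(\<delta> \<longlongrightarrow> 0) (finite_sets_at_top)"
  proof -
    have "((\<lambda>F. \<Sum>j\<in>J. \<Sum>\<^sub>\<infinity>k\<in>- F. \<gamma> k * norm (A k j)) \<longlongrightarrow> (\<Sum>j\<in>J. 0)) (finite_sets_at_top)"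
      by (intro tendsto_sum infsum_complement_tendsto_0 A_summable)
    then show ?thesis by (simp add: \<delta>_def[abs_def])
  qed
  have w_summable: "(\<lambda>i. \<beta> i * ?\<gamma> i) summable_on UNIV"
  proof -
    have "(\<lambda>i. \<beta> i * ?\<gamma> i) summable_on (J \<union> - J)"
    proof (rule summable_on_Un_disjoint)
      have "(\<lambda>i. \<beta> i * \<gamma> i) summable_on - J" by (rule summable_on_subset[OF \<beta>\<gamma>_summable]) auto
      then show "(\<lambda>i. \<beta> i * ?\<gamma> i) summable_on - J"
        by (rule summable_on_cong[THEN iffD1, rotated]) auto
    qed (use J in auto)
    then show ?thesis by simp
  qed
  define w where "w S = fact (card S) * (\<Prod>i\<in>S. \<beta> i * ?\<gamma> i)" for S
  have w_nonneg: "0 \<le> w S" for S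
    unfolding w_def using nonneg by (intro mult_nonneg_nonneg prod_nonneg) auto
  have w: "w summable_on {S. finite S}"
    unfolding w_def using nonneg by (intro summable_on_fact_prod w_summable) auto
  have W: "(\<Sum>S\<in>Pow F. w S) \<le> infsum w {S. finite S}" if "finite F" for F
    using that w_nonneg by (intro finite_sum_le_infsum w) (auto intro: finite_subset)
  have product: "det_on F ?M * det_on J A =
      det_on F (\<lambda>i j. of_bool (i = j) - (if j \<in> J then - \<epsilon> F i j else K i j))"
    if F: "finite F" "J \<subseteq> F" for F
  proof -
    \<comment> \<open>unit columns outside \<open>J\<close> do not change the determinant\<close>
    define X where "X i j = (if j \<in> J then A i j else of_bool (i = j))" for i j
    have "det_on F X = det_on (J \<union> (F - J)) X" using F by (simp add: Un_absorb1)
    also have "\<dots> = det_on J X"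
      using F J by (intro det_on_unit_columns) (auto simp: X_def)
    also have "\<dots> = det_on J A" by (rule det_on_cong) (simp add: X_def)
    finally have "det_on F ?M * det_on J A = det_on F (\<lambda>i j. \<Sum>k\<in>F. ?M i k * X k j)"
      using F by (simp add: det_on_mult)
    also have "\<dots> = det_on F (\<lambda>i j. of_bool (i = j) - (if j \<in> J then - \<epsilon> F i j else K i j))"
    proof (rule det_on_cong)
      fix i j assume ij: "i \<in> F" "j \<in> F"
      have "(\<Sum>k\<in>F. ?M i k * X k j) = (\<Sum>k\<in>F. if k = i then X i j else 0) - (\<Sum>k\<in>F. K i k * X k j)"
        unfolding sum_subtractf[symmetric] by (intro sum.cong refl) (auto simp: algebra_simps)
      also have "\<dots> = X i j - (\<Sum>k\<in>F. K i k * X k j)" using F ij by simp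
      also have "\<dots> = of_bool (i = j) - (if j \<in> J then - \<epsilon> F i j else K i j)"
      proof (cases "j \<in> J")
        case True
        have "(\<Sum>\<^sub>\<infinity>k\<in>F \<union> - F. K i k * A k j) = (\<Sum>k\<in>F. K i k * A k j) + \<epsilon> F i j"
          unfolding \<epsilon>_def using F by (subst infsum_Un_disjoint) (auto intro: sm[OF True])
        then have "A i j = of_bool (i = j) + ((\<Sum>k\<in>F. K i k * A k j) + \<epsilon> F i j)"
          using A_inverse[OF True, of i] by simp
        then show ?thesis using True by (simp add: X_def)
      next
        case False
        have "(\<Sum>k\<in>F. K i k * X k j) = (\<Sum>k\<in>F. if k = j then K i j else 0)"
          using False by (intro sum.cong refl) (auto simp: X_def)
        then show ?thesis using False F ij by (simp add: X_def)
      qed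
      finally show "(\<Sum>k\<in>F. ?M i k * X k j) = of_bool (i = j) - (if j \<in> J then - \<epsilon> F i j else K i j)" .
    qed
    finally show ?thesis .
  qed
  have close: "norm (det_on F ?M * det_on J A - det_on (F \<inter> - J) ?M) \<le> \<delta> F * infsum w {S. finite S}"
    if F: "finite F" "J \<subseteq> F" and small: "\<delta> F \<le> 1" for F
    unfolding product[OF F] Diff_eq[symmetric]
    by (rule norm_id_minus_perturbation_le[OF F K_le nonneg])
       (use \<epsilon>_le \<delta>_nonneg small W[OF F(1)] in \<open>auto simp: w_def\<close>)
  have "((\<lambda>F. det_on F ?M * det_on J A - det_on (F \<inter> - J) ?M) \<longlongrightarrow> 0) (finite_sets_at_top)"
  proof (rule tendsto_norm_zero_cancel, rule tendsto_sandwich[of "\<lambda>_. 0"])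
    show "\<forall>\<^sub>F F in finite_sets_at_top.
        norm (det_on F ?M * det_on J A - det_on (F \<inter> - J) ?M) \<le> \<delta> F * infsum w {S. finite S}"
    proof -
      have "\<forall>\<^sub>F F in finite_sets_at_top. finite F \<and> J \<subseteq> F"
        unfolding eventually_finite_subsets_at_top using J by (intro exI[of _ J]) auto
      moreover have "\<forall>\<^sub>F F in finite_sets_at_top. \<delta> F < 1"
        using \<delta>_tendsto by (rule order_tendstoD) simp
      ultimately show ?thesis by eventually_elim (auto intro: close)
    qed
    show "((\<lambda>F. \<delta> F * infsum w {S. finite S}) \<longlongrightarrow> 0) (finite_sets_at_top)"
      by (rule tendsto_mult_left_zero[OF \<delta>_tendsto])
  qed auto
  moreover have "((\<lambda>F. det_on F ?M * det_on J A - det_on (F \<inter> - J) ?M) \<longlongrightarrow>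
      fredholm_series UNIV K * det_on J A - fredholm_series (- J) K) (finite_sets_at_top)"
    using fredholm_series_tendsto[OF K_le nonneg \<beta>\<gamma>_summable, of UNIV]
    by (intro tendsto_diff tendsto_mult tendsto_const fredholm_series_tendsto[OF K_le nonneg \<beta>\<gamma>_summable]) simp
  ultimately have "fredholm_series UNIV K * det_on J A - fredholm_series (- J) K = 0"
    by (intro tendsto_unique[OF finite_subsets_at_top_neq_bot])
  then show ?thesis by (simp add: mult.commute)
qed

text \<open>
  Rows outside \<open>S\<close> vanish, which kills every minor over a set not contained in \<open>S\<close>; the remaining
  absolutely convergent sum may be grouped by cardinality.
\<close>
lemma fredholm_det_I_minus_eq_series:
  fixes K :: "nat \<times> 'n::finite \<Rightarrow> nat \<times> 'n \<Rightarrow> complex" and \<beta> \<gamma> :: "nat \<times> 'n \<Rightarrow> real"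
  assumes K_le: "\<And>i j. norm (K i j) \<le> \<beta> i * \<gamma> j"
    and nonneg: "\<And>i. 0 \<le> \<beta> i" "\<And>i. 0 \<le> \<gamma> i"
    and \<beta>\<gamma>_summable: "(\<lambda>i. \<beta> i * \<gamma> i) summable_on UNIV"
    and entries: "\<And>i j. op_entry T i j = (if i \<in> S \<and> j \<in> S then K i j else 0)"
  shows "fredholm_det_I_minus T = fredholm_series S K"
proof -
  let ?f = "\<lambda>F. (-1) ^ card F * det_on F K"
  have zero: "det_on F (op_entry T) = (if F \<subseteq> S then det_on F K else 0)" if F: "finite F" for F
  proof (cases "F \<subseteq> S")
    case True
    then show ?thesis by (auto intro!: det_on_cong simp: entries)
  next
    case False
    then obtain i where i: "i \<in> F" "i \<notin> S" by blast
    have "(\<Prod>k\<in>F. op_entry T k (\<pi> k)) = 0" for \<pi>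
      using F i by (intro prod_zero bexI[of _ i]) (auto simp: entries)
    then show ?thesis using False by (simp add: det_on_def)
  qed
  have trace: "(-1) ^ m * trace_ext_power m T = (\<Sum>\<^sub>\<infinity>F\<in>{F. finite F \<and> F \<subseteq> S \<and> card F = m}. ?f F)" for m
  proof -
    have "(-1) ^ m * trace_ext_power m T = (\<Sum>\<^sub>\<infinity>F\<in>{F. finite F \<and> card F = m}. (-1) ^ m * det_on F (op_entry T))"
      by (simp add: trace_ext_power_def infsum_cmult_right')
    also have "\<dots> = (\<Sum>\<^sub>\<infinity>F\<in>{F. finite F \<and> F \<subseteq> S \<and> card F = m}. ?f F)"
      by (rule infsum_cong_neutral) (auto simp: zero)
    finally show ?thesis .
  qed
  have sm: "?f summable_on {F. finite F \<and> F \<subseteq> S}"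
    by (rule minor_summable[OF K_le nonneg \<beta>\<gamma>_summable])
  have bij: "bij_betw snd (SIGMA m:UNIV. {F. finite F \<and> F \<subseteq> S \<and> card F = m}) {F. finite F \<and> F \<subseteq> S}"
    by (rule bij_betwI[of _ _ _ "\<lambda>F. (card F, F)"]) auto
  have hs: "((\<lambda>(m, F). ?f F) has_sum fredholm_series S K)
      (SIGMA m:UNIV. {F. finite F \<and> F \<subseteq> S \<and> card F = m})"
    using has_sum_reindex_bij_betw[OF bij, of ?f "fredholm_series S K"] has_sum_infsum[OF sm]
    by (simp add: case_prod_unfold fredholm_series_def)
  have "((\<lambda>m. (-1) ^ m * trace_ext_power m T) has_sum fredholm_series S K) UNIV"
  proof (rule has_sum_SigmaD[OF hs])
    fix m
    have "?f summable_on {F. finite F \<and> F \<subseteq> S \<and> card F = m}"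
      by (rule summable_on_subset[OF sm]) auto
    then show "((\<lambda>F. case (m, F) of (m, F) \<Rightarrow> ?f F) has_sum (-1) ^ m * trace_ext_power m T)
        {F. finite F \<and> F \<subseteq> S \<and> card F = m}"
      unfolding trace by (simp add: has_sum_infsum)
  qed
  then show ?thesis
    unfolding fredholm_det_I_minus_def by (intro sums_unique[symmetric] has_sum_imp_sums)
qed

section \<open>The ring of bounded infinite matrices\<close>

abbreviation l2norm :: "('i \<Rightarrow> complex) \<Rightarrow> 'i set \<Rightarrow> real" where
  "l2norm x S \<equiv> L2_set (\<lambda>i. norm (x i)) S"

abbreviation square_summable :: "('i \<Rightarrow> complex) \<Rightarrow> bool" where
  "square_summable x \<equiv> (\<lambda>i. (norm (x i))\<^sup>2) summable_on UNIV"

abbreviation square_sum :: "('i \<Rightarrow> complex) \<Rightarrow> real" where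
  "square_sum x \<equiv> \<Sum>\<^sub>\<infinity>i. (norm (x i))\<^sup>2"

lemma square_summableI:
  assumes "\<And>F. finite F \<Longrightarrow> l2norm x F \<le> C"
  shows "square_summable x" "square_sum x \<le> C\<^sup>2"
proof -
  have le: "(\<Sum>i\<in>F. (norm (x i))\<^sup>2) \<le> C\<^sup>2" if "finite F" for F
  proof -
    have "(l2norm x F)\<^sup>2 \<le> C\<^sup>2" using assms[OF that] by (intro power_mono L2_set_nonneg)
    then show ?thesis by (simp add: L2_set_def sum_nonneg)
  qed
  show sm: "square_summable x"
    by (rule nonneg_bdd_above_summable_on) (auto intro: le bdd_aboveI2)
  show "square_sum x \<le> C\<^sup>2"
    by (rule infsum_le_finite_sums[OF sm]) (rule le)
qed

lemma square_summable_mult: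
  assumes "square_summable x" "square_summable y"
  shows "(\<lambda>i. x i * y i) summable_on A" "(\<lambda>i. norm (x i * y i)) summable_on A"
proof -
  have "(\<lambda>i. norm (x i * y i)) summable_on UNIV"
    by (rule Infinite_Sum.abs_summable_product)
       (use assms in \<open>simp_all only: norm_mult power2_eq_square\<close>)
  then show n: "(\<lambda>i. norm (x i * y i)) summable_on A" by (rule summable_on_subset) simp
  then show "(\<lambda>i. x i * y i) summable_on A" by (rule abs_summable_summable)
qed

lemma infsum_finite_sum:
  fixes f :: "'k \<Rightarrow> 'i \<Rightarrow> complex"
  assumes "finite S" "\<And>k. k \<in> S \<Longrightarrow> f k summable_on A"
  shows "(\<Sum>\<^sub>\<infinity>i\<in>A. \<Sum>k\<in>S. f k i) = (\<Sum>k\<in>S. \<Sum>\<^sub>\<infinity>i\<in>A. f k i)"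
proof -
  have "((\<lambda>i. \<Sum>k\<in>S. f k i) has_sum (\<Sum>k\<in>S. infsum (f k) A)) A"
    using assms by (induction S rule: finite_induct) (auto intro!: has_sum_add has_sum_infsum)
  then show ?thesis by (rule infsumI)
qed

lemma norm_infsum_mult_le:
  assumes x: "square_summable x" and y: "square_summable y"
  shows "norm (\<Sum>\<^sub>\<infinity>i. x i * y i) \<le> sqrt (square_sum x) * sqrt (square_sum y)"
proof -
  have "norm (\<Sum>\<^sub>\<infinity>i. x i * y i) \<le> (\<Sum>\<^sub>\<infinity>i. norm (x i * y i))"
    by (rule norm_infsum_bound[OF square_summable_mult(2)[OF x y]])
  also have "\<dots> \<le> sqrt (square_sum x) * sqrt (square_sum y)"
  proof (rule infsum_le_finite_sums[OF square_summable_mult(2)[OF x y]])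
    fix F :: "'a set" assume F: "finite F"
    have le: "l2norm z F \<le> sqrt (square_sum z)" if "square_summable z" for z
      unfolding L2_set_def using F by (intro real_sqrt_le_mono finite_sum_le_infsum that) auto
    have "(\<Sum>i\<in>F. norm (x i * y i)) \<le> l2norm x F * l2norm y F"
      using L2_set_mult_ineq[of "\<lambda>i. norm (x i)" "\<lambda>i. norm (y i)" F] by (simp add: norm_mult)
    also have "\<dots> \<le> sqrt (square_sum x) * sqrt (square_sum y)"
      by (intro mult_mono le x y L2_set_nonneg real_sqrt_ge_zero infsum_nonneg) auto
    finally show "(\<Sum>i\<in>F. norm (x i * y i)) \<le> \<dots>" .
  qed
  finally show ?thesis .
qed

text \<open>
  Boundedness as a bilinear form on finitely supported vectors, that is, of the operator on the
  square summable sequences.  Stated with finite sums it is visibly symmetric under transposition.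
\<close>
definition bounded_by :: "real \<Rightarrow> ('i \<Rightarrow> 'i \<Rightarrow> complex) \<Rightarrow> bool" where
  "bounded_by C M \<longleftrightarrow> 0 \<le> C \<and> (\<forall>R S x y. finite R \<longrightarrow> finite S \<longrightarrow>
     norm (\<Sum>i\<in>R. \<Sum>j\<in>S. y i * M i j * x j) \<le> C * l2norm y R * l2norm x S)"

lemma bounded_byD:
  "bounded_by C M \<Longrightarrow> finite R \<Longrightarrow> finite S \<Longrightarrow>
    norm (\<Sum>i\<in>R. \<Sum>j\<in>S. y i * M i j * x j) \<le> C * l2norm y R * l2norm x S"
  "bounded_by C M \<Longrightarrow> 0 \<le> C"
  unfolding bounded_by_def by blast+

lemma bounded_by_transpose:
  assumes "bounded_by C M"
  shows "bounded_by C (\<lambda>i j. M j i)"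
  unfolding bounded_by_def
proof (intro conjI allI impI)
  fix R S :: "'a set" and x y :: "'a \<Rightarrow> complex"
  assume "finite R" "finite S"
  then show "norm (\<Sum>i\<in>R. \<Sum>j\<in>S. y i * M j i * x j) \<le> C * l2norm y R * l2norm x S"
    using bounded_byD(1)[OF assms, of S R x y] by (subst sum.swap) (simp add: mult_ac)
qed (rule bounded_byD(2)[OF assms])

text \<open>
  Test the form with the conjugate of the image vector.
\<close>
lemma bounded_by_finite_apply:
  assumes M: "bounded_by C M" and fin: "finite R" "finite S"
  shows "l2norm (\<lambda>i. \<Sum>j\<in>S. M i j * x j) R \<le> C * l2norm x S"
proof -
  define z where "z i = (\<Sum>j\<in>S. M i j * x j)" for i
  have "(\<Sum>j\<in>S. cnj (z i) * M i j * x j) = of_real ((norm (z i))\<^sup>2)" for i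
  proof -
    have "(\<Sum>j\<in>S. cnj (z i) * M i j * x j) = cnj (z i) * z i"
      unfolding z_def[of i] sum_distrib_left by (simp only: mult.assoc)
    then show ?thesis by (simp only: complex_norm_square mult.commute)
  qed
  then have "(\<Sum>i\<in>R. \<Sum>j\<in>S. cnj (z i) * M i j * x j) = of_real (\<Sum>i\<in>R. (norm (z i))\<^sup>2)"
    by (simp only: of_real_sum)
  also have "(\<Sum>i\<in>R. (norm (z i))\<^sup>2) = (l2norm z R)\<^sup>2"
    by (simp add: L2_set_def sum_nonneg)
  finally have "norm (complex_of_real ((l2norm z R)\<^sup>2)) \<le> C * l2norm (\<lambda>i. cnj (z i)) R * l2norm x S"
    using bounded_byD(1)[OF M fin, of "\<lambda>i. cnj (z i)" x] by (simp only:)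
  then have le: "l2norm z R * l2norm z R \<le> l2norm z R * (C * l2norm x S)"
    by (simp only: norm_of_real abs_power2 complex_mod_cnj power2_eq_square abs_mult_self_eq mult_ac)
  have "l2norm z R \<le> C * l2norm x S"
  proof (cases "l2norm z R = 0")
    case True
    then show ?thesis using bounded_byD(2)[OF M] by (simp add: L2_set_nonneg)
  next
    case False
    then have "0 < l2norm z R" by (simp add: L2_set_nonneg order_less_le)
    then show ?thesis using le by (rule mult_left_le_imp_le[rotated])
  qed
  then show ?thesis by (simp add: z_def[abs_def])
qed

lemma bounded_by_columns:
  assumes M: "bounded_by C M"
  shows "square_summable (\<lambda>i. M i j)"
proof (rule square_summableI)
  fix F :: "'a set" assume "finite F"
  then show "l2norm (\<lambda>i. M i j) F \<le> C"
    using bounded_by_finite_apply[OF M, of F "{j}" "\<lambda>_. 1"] by simp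
qed

lemma bounded_by_rows:
  assumes M: "bounded_by C M"
  shows "square_summable (\<lambda>j. M i j)"
  using bounded_by_columns[OF bounded_by_transpose[OF M], of i] .

lemma bounded_by_apply:
  assumes M: "bounded_by C M" and R: "finite R" and x: "square_summable x"
  shows "l2norm (\<lambda>i. \<Sum>\<^sub>\<infinity>j\<in>A. M i j * x j) R \<le> C * sqrt (\<Sum>\<^sub>\<infinity>j\<in>A. (norm (x j))\<^sup>2)"
proof (rule tendsto_upperbound)
  show "((\<lambda>S. l2norm (\<lambda>i. \<Sum>j\<in>S. M i j * x j) R) \<longlongrightarrow> l2norm (\<lambda>i. \<Sum>\<^sub>\<infinity>j\<in>A. M i j * x j) R)
      (finite_subsets_at_top A)"
    unfolding L2_set_def
    by (intro tendsto_intros infsum_tendsto square_summable_mult(1) bounded_by_rows[OF M] x)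
  have xA: "(\<lambda>j. (norm (x j))\<^sup>2) summable_on A" by (rule summable_on_subset[OF x]) simp
  show "\<forall>\<^sub>F S in finite_subsets_at_top A.
      l2norm (\<lambda>i. \<Sum>j\<in>S. M i j * x j) R \<le> C * sqrt (\<Sum>\<^sub>\<infinity>j\<in>A. (norm (x j))\<^sup>2)"
  proof (rule eventually_finite_subsets_at_top_weakI)
    fix S assume S: "finite S" "S \<subseteq> A"
    have "l2norm (\<lambda>i. \<Sum>j\<in>S. M i j * x j) R \<le> C * l2norm x S"
      by (rule bounded_by_finite_apply[OF M R S(1)])
    also have "\<dots> \<le> C * sqrt (\<Sum>\<^sub>\<infinity>j\<in>A. (norm (x j))\<^sup>2)"
      unfolding L2_set_def using S
      by (intro mult_left_mono real_sqrt_le_mono finite_sum_le_infsum xA bounded_byD(2)[OF M]) auto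
    finally show "l2norm (\<lambda>i. \<Sum>j\<in>S. M i j * x j) R \<le> C * sqrt (\<Sum>\<^sub>\<infinity>j\<in>A. (norm (x j))\<^sup>2)" .
  qed
qed simp

text \<open>
  On finitely supported vectors the product acts as \<open>N\<close> followed by \<open>M\<close>; the intermediate vector is only square
  summable, which is why \<open>bounded_by_apply\<close> covers infinite sums.
\<close>
lemma bounded_by_mult:
  assumes M: "bounded_by C M" and N: "bounded_by D N"
  shows "bounded_by (C * D) (\<lambda>i k. \<Sum>\<^sub>\<infinity>j. M i j * N j k)"
  unfolding bounded_by_def
proof (intro conjI allI impI)
  note CD = bounded_byD(2)[OF M] bounded_byD(2)[OF N]
  show "0 \<le> C * D" using CD by simp
  fix R S :: "'a set" and x y :: "'a \<Rightarrow> complex"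
  assume R: "finite R" and S: "finite S"
  define u where "u j = (\<Sum>k\<in>S. N j k * x k)" for j
  have "l2norm u F \<le> D * l2norm x S" if "finite F" for F
    unfolding u_def by (rule bounded_by_finite_apply[OF N that S])
  note u = square_summableI[of u, OF this]
  have row: "(\<Sum>k\<in>S. (\<Sum>\<^sub>\<infinity>j. M i j * N j k) * x k) = (\<Sum>\<^sub>\<infinity>j. M i j * u j)" for i
  proof -
    have "(\<Sum>k\<in>S. (\<Sum>\<^sub>\<infinity>j. M i j * N j k) * x k) = (\<Sum>k\<in>S. \<Sum>\<^sub>\<infinity>j. M i j * N j k * x k)"
      by (simp add: infsum_cmult_left')
    also have "\<dots> = (\<Sum>\<^sub>\<infinity>j. \<Sum>k\<in>S. M i j * N j k * x k)"
      by (intro infsum_finite_sum[symmetric] S summable_on_cmult_left square_summable_mult bounded_by_rows[OF M] bounded_by_columns[OF N])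
    finally show ?thesis by (simp only: u_def sum_distrib_left mult.assoc)
  qed
  have "norm (\<Sum>i\<in>R. \<Sum>k\<in>S. y i * (\<Sum>\<^sub>\<infinity>j. M i j * N j k) * x k) = norm (\<Sum>i\<in>R. y i * (\<Sum>\<^sub>\<infinity>j. M i j * u j))"
    by (simp only: row[symmetric] sum_distrib_left mult.assoc)
  also have "\<dots> \<le> (\<Sum>i\<in>R. norm (y i) * norm (\<Sum>\<^sub>\<infinity>j. M i j * u j))"
    by (rule sum_norm_le) (simp add: norm_mult)
  also have "\<dots> \<le> l2norm y R * l2norm (\<lambda>i. \<Sum>\<^sub>\<infinity>j. M i j * u j) R"
    using L2_set_mult_ineq[of "\<lambda>i. norm (y i)" "\<lambda>i. norm (\<Sum>\<^sub>\<infinity>j. M i j * u j)" R] by simp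
  also have "\<dots> \<le> l2norm y R * (C * (D * l2norm x S))"
  proof (rule mult_left_mono[OF _ L2_set_nonneg])
    have "l2norm (\<lambda>i. \<Sum>\<^sub>\<infinity>j. M i j * u j) R \<le> C * sqrt (square_sum u)"
      by (rule bounded_by_apply[OF M R u(1)])
    also have "\<dots> \<le> C * sqrt ((D * l2norm x S)\<^sup>2)"
      using CD by (intro mult_left_mono real_sqrt_le_mono u(2)) auto
    also have "\<dots> = C * (D * l2norm x S)" using CD by (simp add: L2_set_nonneg abs_mult)
    finally show "l2norm (\<lambda>i. \<Sum>\<^sub>\<infinity>j. M i j * u j) R \<le> C * (D * l2norm x S)" .
  qed
  finally show "norm (\<Sum>i\<in>R. \<Sum>k\<in>S. y i * (\<Sum>\<^sub>\<infinity>j. M i j * N j k) * x k) \<le> C * D * l2norm y R * l2norm x S"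
    by (simp add: mult_ac)
qed

text \<open>
  Associativity of \<open>r (N p) = (r N) p\<close> for a row \<open>r\<close> and a column \<open>p\<close>.  The two iterated sums need not
  converge absolutely as a double sum; instead the error of truncating \<open>p\<close> is controlled by the
  operator bound of \<open>N\<close>.
\<close>
lemma has_sum_bilinear_form:
  assumes N: "bounded_by C N" and r: "square_summable r" and p: "square_summable p"
  shows "((\<lambda>k. (\<Sum>\<^sub>\<infinity>j. r j * N j k) * p k) has_sum (\<Sum>\<^sub>\<infinity>j. r j * (\<Sum>\<^sub>\<infinity>k. N j k * p k))) UNIV"
proof -
  define g where "g j = (\<Sum>\<^sub>\<infinity>k. N j k * p k)" for j
  define h where "h S j = (\<Sum>\<^sub>\<infinity>k\<in>- S. N j k * p k)" for S j
  define t where "t S = (\<Sum>\<^sub>\<infinity>k\<in>- S. (norm (p k))\<^sup>2)" for S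
  have C: "0 \<le> C" by (rule bounded_byD(2)[OF N])
  have t_nonneg: "0 \<le> t S" for S unfolding t_def by (intro infsum_nonneg) simp
  have "l2norm (h S) F \<le> C * sqrt (t S)" if "finite F" for F S
    unfolding h_def t_def by (rule bounded_by_apply[OF N that p])
  note h = square_summableI[of "h S" for S, OF this]
  have "l2norm g F \<le> C * sqrt (square_sum p)" if "finite F" for F
    unfolding g_def by (rule bounded_by_apply[OF N that p])
  note g = square_summableI(1)[of g, OF this]
  have partial: "(\<Sum>k\<in>S. (\<Sum>\<^sub>\<infinity>j. r j * N j k) * p k) = (\<Sum>\<^sub>\<infinity>j. r j * g j) - (\<Sum>\<^sub>\<infinity>j. r j * h S j)"
    if S: "finite S" for S
  proof -
    have split: "g j - h S j = (\<Sum>k\<in>S. N j k * p k)" for j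
    proof -
      have "(\<Sum>\<^sub>\<infinity>k\<in>S \<union> - S. N j k * p k) = (\<Sum>\<^sub>\<infinity>k\<in>S. N j k * p k) + h S j"
        unfolding h_def
        by (intro infsum_Un_disjoint square_summable_mult bounded_by_rows[OF N] p) auto
      then show ?thesis using S by (simp add: g_def)
    qed
    have "(\<Sum>k\<in>S. (\<Sum>\<^sub>\<infinity>j. r j * N j k) * p k) = (\<Sum>k\<in>S. \<Sum>\<^sub>\<infinity>j. r j * N j k * p k)"
      by (simp add: infsum_cmult_left')
    also have "\<dots> = (\<Sum>\<^sub>\<infinity>j. \<Sum>k\<in>S. r j * N j k * p k)"
      by (intro infsum_finite_sum[symmetric] S summable_on_cmult_left square_summable_mult r bounded_by_columns[OF N])
    also have "\<dots> = (\<Sum>\<^sub>\<infinity>j. r j * g j - r j * h S j)"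
      unfolding right_diff_distrib[symmetric] split by (simp only: sum_distrib_left mult.assoc)
    also have "\<dots> = (\<Sum>\<^sub>\<infinity>j. r j * g j) + (\<Sum>\<^sub>\<infinity>j. - (r j * h S j))"
      unfolding diff_conv_add_uminus
      by (intro infsum_add summable_on_uminus[THEN iffD2] square_summable_mult r g h)
    finally show ?thesis by (simp add: infsum_uminus)
  qed
  have "((\<lambda>S. (\<Sum>\<^sub>\<infinity>j. r j * h S j)) \<longlongrightarrow> 0) (finite_sets_at_top)"
  proof (rule tendsto_norm_zero_cancel, rule tendsto_sandwich[of "\<lambda>_. 0"])
    let ?c = "sqrt (square_sum r)"
    show "\<forall>\<^sub>F S in finite_sets_at_top. norm (\<Sum>\<^sub>\<infinity>j. r j * h S j) \<le> ?c * (C * sqrt (t S))"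
    proof (rule always_eventually, rule allI)
      fix S
      have "norm (\<Sum>\<^sub>\<infinity>j. r j * h S j) \<le> ?c * sqrt (square_sum (h S))"
        by (rule norm_infsum_mult_le[OF r h(1)])
      also have "\<dots> \<le> ?c * sqrt ((C * sqrt (t S))\<^sup>2)"
        by (intro mult_left_mono real_sqrt_le_mono h(2) real_sqrt_ge_zero infsum_nonneg) simp_all
      also have "\<dots> = ?c * (C * sqrt (t S))" using C t_nonneg[of S] by simp
      finally show "norm (\<Sum>\<^sub>\<infinity>j. r j * h S j) \<le> ?c * (C * sqrt (t S))" .
    qed
    have "((\<lambda>S. ?c * (C * sqrt (t S))) \<longlongrightarrow> ?c * (C * sqrt 0)) (finite_sets_at_top)"
      unfolding t_def by (intro tendsto_intros infsum_complement_tendsto_0 p)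
    then show "((\<lambda>S. ?c * (C * sqrt (t S))) \<longlongrightarrow> 0) (finite_sets_at_top)" by simp
  qed auto
  then have "((\<lambda>S. (\<Sum>\<^sub>\<infinity>j. r j * g j) - (\<Sum>\<^sub>\<infinity>j. r j * h S j)) \<longlongrightarrow> (\<Sum>\<^sub>\<infinity>j. r j * g j) - 0) (finite_sets_at_top)"
    by (intro tendsto_diff tendsto_const)
  then have "((\<lambda>S. \<Sum>k\<in>S. (\<Sum>\<^sub>\<infinity>j. r j * N j k) * p k) \<longlongrightarrow> (\<Sum>\<^sub>\<infinity>j. r j * g j)) (finite_sets_at_top)"
    by (subst tendsto_cong[OF eventually_finite_subsets_at_top_weakI]) (auto simp: partial)
  then show ?thesis by (simp add: has_sum_def g_def)
qed

lemma bounded_by_add: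
  assumes M: "bounded_by C M" and N: "bounded_by D N"
  shows "bounded_by (C + D) (\<lambda>i j. M i j + N i j)"
  unfolding bounded_by_def
proof (intro conjI allI impI)
  show "0 \<le> C + D" using bounded_byD(2)[OF M] bounded_byD(2)[OF N] by simp
  fix R S :: "'a set" and x y :: "'a \<Rightarrow> complex"
  assume fin: "finite R" "finite S"
  have "(\<Sum>i\<in>R. \<Sum>j\<in>S. y i * (M i j + N i j) * x j) =
      (\<Sum>i\<in>R. \<Sum>j\<in>S. y i * M i j * x j) + (\<Sum>i\<in>R. \<Sum>j\<in>S. y i * N i j * x j)"
    by (simp add: sum.distrib algebra_simps)
  also have "norm \<dots> \<le> C * l2norm y R * l2norm x S + D * l2norm y R * l2norm x S"
    by (rule norm_triangle_mono[OF bounded_byD(1)[OF M fin] bounded_byD(1)[OF N fin]])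
  finally show "norm (\<Sum>i\<in>R. \<Sum>j\<in>S. y i * (M i j + N i j) * x j) \<le> (C + D) * l2norm y R * l2norm x S"
    by (simp add: algebra_simps)
qed

lemma bounded_by_uminus: "bounded_by C M \<Longrightarrow> bounded_by C (\<lambda>i j. - M i j)"
  by (simp add: bounded_by_def sum_negf)

lemma bounded_by_indicator: "bounded_by 1 (\<lambda>i j. of_bool (i = j \<and> i \<in> X))"
  unfolding bounded_by_def
proof (intro conjI allI impI)
  fix R S :: "'a set" and x y :: "'a \<Rightarrow> complex"
  assume fin: "finite R" "finite S"
  have "(\<Sum>i\<in>R. \<Sum>j\<in>S. y i * of_bool (i = j \<and> i \<in> X) * x j) = (\<Sum>i\<in>R. \<Sum>j\<in>S. if i = j then of_bool (i \<in> X) * (y i * x i) else 0)"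
    by (intro sum.cong refl) auto
  also have "\<dots> = (\<Sum>i\<in>R \<inter> S. of_bool (i \<in> X) * (y i * x i))"
    using fin by (simp only: sum.delta' sum.inter_restrict)
  also have "norm \<dots> \<le> (\<Sum>i\<in>R \<inter> S. norm (y i) * norm (x i))"
    by (rule sum_norm_le) (simp add: norm_mult)
  also have "\<dots> \<le> l2norm y (R \<inter> S) * l2norm x (R \<inter> S)"
    using L2_set_mult_ineq[of "\<lambda>i. norm (y i)" "\<lambda>i. norm (x i)" "R \<inter> S"] by simp
  also have "\<dots> \<le> l2norm y R * l2norm x S"
    unfolding L2_set_def using fin by (intro mult_mono real_sqrt_le_mono sum_mono2 real_sqrt_ge_zero sum_nonneg) auto
  finally show "norm (\<Sum>i\<in>R. \<Sum>j\<in>S. y i * of_bool (i = j \<and> i \<in> X) * x j) \<le> 1 * l2norm y R * l2norm x S"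
    by simp
qed simp

text \<open>
  Bounded matrices form a ring, so that the operator identities can be proved by ring calculations with
  associativity built in.
\<close>
typedef 'i bmat = "{M :: 'i \<Rightarrow> 'i \<Rightarrow> complex. \<exists>C. bounded_by C M}"
  morphisms entry Bmat
proof
  show "(\<lambda>i j. of_bool (i = j \<and> i \<in> UNIV)) \<in> {M. \<exists>C. bounded_by C M}"
    using bounded_by_indicator by blast
qed

setup_lifting type_definition_bmat

lemma entry_bounded:
  obtains C where "bounded_by C (entry M)"
  using entry[of M] by blast

lemma entry_columns: "square_summable (\<lambda>i. entry M i j)"
  by (rule entry_bounded[of M]) (rule bounded_by_columns)

lemma entry_rows: "square_summable (\<lambda>j. entry M i j)"
  by (rule entry_bounded[of M]) (rule bounded_by_rows)

lift_definition restrictor :: "'i set \<Rightarrow> 'i bmat" is "\<lambda>X i j. of_bool (i = j \<and> i \<in> X)"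
  using bounded_by_indicator by blast

lift_definition transposed :: "'i bmat \<Rightarrow> 'i bmat" is "\<lambda>M i j. M j i"
  using bounded_by_transpose by blast

instantiation bmat :: (type) ring_1
begin

lift_definition zero_bmat :: "'a bmat" is "\<lambda>i j. 0"
  using bounded_by_indicator[of "{}"] by auto

lift_definition one_bmat :: "'a bmat" is "\<lambda>i j. of_bool (i = j)"
  using bounded_by_indicator[of UNIV] by auto

lift_definition plus_bmat :: "'a bmat \<Rightarrow> 'a bmat \<Rightarrow> 'a bmat" is "\<lambda>M N i j. M i j + N i j"
  using bounded_by_add by blast

lift_definition uminus_bmat :: "'a bmat \<Rightarrow> 'a bmat" is "\<lambda>M i j. - M i j"
  using bounded_by_uminus by blast

lift_definition minus_bmat :: "'a bmat \<Rightarrow> 'a bmat \<Rightarrow> 'a bmat" is "\<lambda>M N i j. M i j - N i j"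
proof -
  fix M N :: "'a \<Rightarrow> 'a \<Rightarrow> complex"
  assume "\<exists>C. bounded_by C M" "\<exists>C. bounded_by C N"
  then obtain C D where "bounded_by C M" "bounded_by D N" by blast
  from bounded_by_add[OF this(1) bounded_by_uminus[OF this(2)]]
  show "\<exists>C. bounded_by C (\<lambda>i j. M i j - N i j)" by auto
qed

lift_definition times_bmat :: "'a bmat \<Rightarrow> 'a bmat \<Rightarrow> 'a bmat" is "\<lambda>M N i k. \<Sum>\<^sub>\<infinity>j. M i j * N j k"
  using bounded_by_mult by blast

lemma entry_mult_summable: "(\<lambda>j. entry M i j * entry N j k) summable_on A"
  by (rule square_summable_mult(1)[OF entry_rows entry_columns])

lemma infsum_delta_left: "(\<Sum>\<^sub>\<infinity>j. of_bool (i = j) * f j) = (f i :: complex)"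
proof -
  have "(\<Sum>\<^sub>\<infinity>j. of_bool (i = j) * f j) = (\<Sum>\<^sub>\<infinity>j\<in>{i}. f j)"
    by (rule infsum_cong_neutral) auto
  then show ?thesis by simp
qed

instance
proof
  fix M N L :: "'a bmat"
  show "M * N * L = M * (N * L)"
  proof (rule entry_inject[THEN iffD1], intro ext)
    fix i l
    obtain C where C: "bounded_by C (entry N)" by (rule entry_bounded)
    show "entry (M * N * L) i l = entry (M * (N * L)) i l"
      unfolding times_bmat.rep_eq
      by (rule infsumI[OF has_sum_bilinear_form[OF C entry_rows entry_columns]])
  qed
  show "(M + N) * L = M * L + N * L"
    by (rule entry_inject[THEN iffD1], intro ext)
       (simp add: times_bmat.rep_eq plus_bmat.rep_eq distrib_right infsum_add entry_mult_summable)
  show "M * (N + L) = M * N + M * L"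
    by (rule entry_inject[THEN iffD1], intro ext)
       (simp add: times_bmat.rep_eq plus_bmat.rep_eq distrib_left infsum_add entry_mult_summable)
  show "1 * M = M"
    by (rule entry_inject[THEN iffD1], intro ext)
       (simp add: times_bmat.rep_eq one_bmat.rep_eq infsum_delta_left)
  show "M * 1 = M"
    using infsum_delta_left[of _ "\<lambda>j. entry M _ j"]
    by (intro entry_inject[THEN iffD1] ext)
       (simp add: times_bmat.rep_eq one_bmat.rep_eq mult.commute[of "entry M _ _"] eq_commute[of _ "_ :: 'a"])
  show "(0 :: 'a bmat) \<noteq> 1"
    by transfer (auto simp: fun_eq_iff)
qed (transfer; simp add: fun_eq_iff)+

end

lemma transposed_mult: "transposed (M * N) = transposed N * transposed M"
  by (rule entry_inject[THEN iffD1]) (simp add: times_bmat.rep_eq transposed.rep_eq fun_eq_iff mult.commute)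

lemma entry_restrictor_mult: "entry (restrictor X * M) i j = of_bool (i \<in> X) * entry M i j"
  using infsum_delta_left[of i "\<lambda>k. of_bool (i \<in> X) * entry M k j"]
  by (simp add: times_bmat.rep_eq restrictor.rep_eq of_bool_conj mult.assoc)

lemma entry_mult_restrictor: "entry (M * restrictor X) i j = entry M i j * of_bool (j \<in> X)"
proof -
  have "entry (M * restrictor X) i j = (\<Sum>\<^sub>\<infinity>k. of_bool (j = k) * (entry M i k * of_bool (k \<in> X)))"
    unfolding times_bmat.rep_eq restrictor.rep_eq by (intro infsum_cong) auto
  then show ?thesis by (simp only: infsum_delta_left)
qed

lemma restrictor_mult: "restrictor X * restrictor Y = restrictor (X \<inter> Y)"
  by (rule entry_inject[THEN iffD1]) (auto simp: fun_eq_iff entry_restrictor_mult restrictor.rep_eq)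

section \<open>Hilbert-Schmidt matrices\<close>

definition hilbert_schmidt :: "'i bmat \<Rightarrow> bool" where
  "hilbert_schmidt M \<longleftrightarrow> (\<lambda>(i, j). (norm (entry M i j))\<^sup>2) summable_on UNIV"

lemma hilbert_schmidt_transposed: "hilbert_schmidt (transposed M) \<longleftrightarrow> hilbert_schmidt M"
  using summable_on_swap[of "\<lambda>(i, j). (norm (entry M i j))\<^sup>2" UNIV UNIV]
  by (simp add: hilbert_schmidt_def transposed.rep_eq)

lemma hilbert_schmidt_rows:
  assumes "hilbert_schmidt M"
  shows "(\<lambda>i. \<Sum>\<^sub>\<infinity>j. (norm (entry M i j))\<^sup>2) summable_on UNIV"
  using assms summable_on_Sigma_banach[of "\<lambda>i j. (norm (entry M i j))\<^sup>2" UNIV "\<lambda>_. UNIV"]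
  by (simp add: hilbert_schmidt_def)

lemma hilbert_schmidt_columns:
  assumes "hilbert_schmidt M"
  shows "(\<lambda>j. \<Sum>\<^sub>\<infinity>i. (norm (entry M i j))\<^sup>2) summable_on UNIV"
  using hilbert_schmidt_rows[of "transposed M"] assms
  by (simp add: hilbert_schmidt_transposed transposed.rep_eq)

text \<open>
  Column by column, the norm of the image is at most the operator bound times the norm of the column.
\<close>
lemma hilbert_schmidt_mult_left:
  assumes N: "hilbert_schmidt N"
  shows "hilbert_schmidt (M * N)"
proof -
  obtain C where C: "bounded_by C (entry M)" by (rule entry_bounded)
  define t where "t k = (\<Sum>\<^sub>\<infinity>j. (norm (entry N j k))\<^sup>2)" for k
  have t: "t summable_on UNIV" unfolding t_def by (rule hilbert_schmidt_columns[OF N])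
  have t_nonneg: "0 \<le> t k" for k unfolding t_def by (intro infsum_nonneg) simp
  have column: "(\<Sum>i\<in>R. (norm (entry (M * N) i k))\<^sup>2) \<le> C\<^sup>2 * t k" if "finite R" for R k
  proof -
    have "l2norm (\<lambda>i. entry (M * N) i k) R \<le> C * sqrt (t k)"
      unfolding times_bmat.rep_eq t_def by (rule bounded_by_apply[OF C that entry_columns])
    then have "(l2norm (\<lambda>i. entry (M * N) i k) R)\<^sup>2 \<le> (C * sqrt (t k))\<^sup>2"
      by (intro power_mono L2_set_nonneg)
    then show ?thesis using t_nonneg by (simp add: L2_set_def sum_nonneg power_mult_distrib)
  qed
  show ?thesis
    unfolding hilbert_schmidt_def
  proof (rule nonneg_bdd_above_summable_on)
    show "bdd_above (sum (\<lambda>(i, k). (norm (entry (M * N) i k))\<^sup>2) ` {F. F \<subseteq> UNIV \<and> finite F})"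
    proof (rule bdd_aboveI2)
      fix F :: "('a \<times> 'a) set" assume "F \<in> {F. F \<subseteq> UNIV \<and> finite F}"
      then have F: "finite F" by simp
      have "(\<Sum>(i, k)\<in>F. (norm (entry (M * N) i k))\<^sup>2) \<le> (\<Sum>(i, k)\<in>fst ` F \<times> snd ` F. (norm (entry (M * N) i k))\<^sup>2)"
        using F by (intro sum_mono2) (auto simp: rev_image_eqI)
      also have "\<dots> = (\<Sum>k\<in>snd ` F. \<Sum>i\<in>fst ` F. (norm (entry (M * N) i k))\<^sup>2)"
        by (subst sum.swap) (simp add: sum.cartesian_product)
      also have "\<dots> \<le> (\<Sum>k\<in>snd ` F. C\<^sup>2 * t k)"
        using F by (intro sum_mono column) auto
      also have "\<dots> = C\<^sup>2 * (\<Sum>k\<in>snd ` F. t k)" by (simp add: sum_distrib_left)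
      also have "\<dots> \<le> C\<^sup>2 * infsum t UNIV"
        using F t_nonneg by (intro mult_left_mono finite_sum_le_infsum t) auto
      finally show "(\<Sum>(i, k)\<in>F. (norm (entry (M * N) i k))\<^sup>2) \<le> C\<^sup>2 * infsum t UNIV" .
    qed
  qed auto
qed

lemma hilbert_schmidt_mult_right:
  assumes "hilbert_schmidt M"
  shows "hilbert_schmidt (M * N)"
  using hilbert_schmidt_mult_left[of "transposed M" "transposed N"] assms
  by (simp add: hilbert_schmidt_transposed flip: transposed_mult)

lemma hilbert_schmidt_mult_entry_bound:
  assumes M: "hilbert_schmidt M" and N: "hilbert_schmidt N"
  obtains \<beta> \<gamma> where "\<And>i j. norm (entry (M * N) i j) \<le> \<beta> i * \<gamma> j"
    "\<And>i. 0 \<le> \<beta> i" "\<And>i. 0 \<le> \<gamma> i"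
    "(\<lambda>i. (\<beta> i)\<^sup>2) summable_on UNIV" "(\<lambda>i. (\<gamma> i)\<^sup>2) summable_on UNIV"
proof
  let ?\<beta> = "\<lambda>i. sqrt (\<Sum>\<^sub>\<infinity>j. (norm (entry M i j))\<^sup>2)"
  let ?\<gamma> = "\<lambda>j. sqrt (\<Sum>\<^sub>\<infinity>i. (norm (entry N i j))\<^sup>2)"
  show "norm (entry (M * N) i j) \<le> ?\<beta> i * ?\<gamma> j" for i j
    unfolding times_bmat.rep_eq by (rule norm_infsum_mult_le[OF entry_rows entry_columns])
  show "0 \<le> ?\<beta> i" "0 \<le> ?\<gamma> i" for i by (simp_all add: infsum_nonneg)
  show "(\<lambda>i. (?\<beta> i)\<^sup>2) summable_on UNIV" "(\<lambda>i. (?\<gamma> i)\<^sup>2) summable_on UNIV"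
    using hilbert_schmidt_rows[OF M] hilbert_schmidt_columns[OF N] by (simp_all add: infsum_nonneg)
qed

section \<open>Mean values and Fourier coefficients on the circle\<close>

definition ess_bounded :: "(real \<Rightarrow> 'b::{banach, second_countable_topology}) \<Rightarrow> bool" where
  "ess_bounded F \<longleftrightarrow> F \<in> borel_measurable circle_param \<and> (\<exists>C. AE t in circle_param. norm (F t) \<le> C)"

lemma ess_boundedE:
  assumes "ess_bounded F"
  obtains C where "0 \<le> C" "AE t in circle_param. norm (F t) \<le> C" "F \<in> borel_measurable circle_param"
proof -
  obtain C where C: "AE t in circle_param. norm (F t) \<le> C" "F \<in> borel_measurable circle_param"
    using assms by (auto simp: ess_bounded_def)
  show ?thesis
  proof (rule that[of "max 0 C"])
    show "AE t in circle_param. norm (F t) \<le> max 0 C" using C(1) by eventually_elim auto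
  qed (use C in auto)
qed

lemma ess_boundedI:
  "F \<in> borel_measurable circle_param \<Longrightarrow> (AE t in circle_param. norm (F t) \<le> C) \<Longrightarrow> ess_bounded F"
  by (auto simp: ess_bounded_def)

lemma ess_bounded_continuous:
  fixes F :: "real \<Rightarrow> 'b::euclidean_space"
  assumes "continuous_on {0..2*pi} F"
  shows "ess_bounded F"
proof -
  have "compact (F ` {0..2*pi})" using assms by (intro compact_continuous_image) auto
  then obtain C where "\<forall>x\<in>F ` {0..2*pi}. norm x \<le> C"
    using compact_imp_bounded bounded_iff by blast
  then show ?thesis
    using assms by (intro ess_boundedI[of _ C] continuous_imp_measurable_on_sets_lebesgue) auto
qed

lemma ess_bounded_add:
  assumes "ess_bounded F" "ess_bounded G"
  shows "ess_bounded (\<lambda>t. F t + G t)"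
proof -
  obtain C D where "AE t in circle_param. norm (F t) \<le> C" "F \<in> borel_measurable circle_param"
    "AE t in circle_param. norm (G t) \<le> D" "G \<in> borel_measurable circle_param"
    using assms by (auto simp: ess_bounded_def)
  moreover from this(1,3) have "AE t in circle_param. norm (F t + G t) \<le> C + D"
    by eventually_elim (rule norm_triangle_mono)
  ultimately show ?thesis by (intro ess_boundedI[of _ "C + D"] borel_measurable_add)
qed

lemma ess_bounded_mult:
  fixes F G :: "real \<Rightarrow> 'b::{banach, real_normed_algebra, second_countable_topology}"
  assumes "ess_bounded F" "ess_bounded G"
  shows "ess_bounded (\<lambda>t. F t * G t)"
proof -
  obtain C where C: "0 \<le> C" "AE t in circle_param. norm (F t) \<le> C" "F \<in> borel_measurable circle_param"
    using assms(1) by (rule ess_boundedE)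
  obtain D where D: "0 \<le> D" "AE t in circle_param. norm (G t) \<le> D" "G \<in> borel_measurable circle_param"
    using assms(2) by (rule ess_boundedE)
  from C(2) D(2) have "AE t in circle_param. norm (F t * G t) \<le> C * D"
  proof eventually_elim
    case (elim t)
    then show ?case
      using C(1) by (intro order_trans[OF norm_mult_ineq] mult_mono) auto
  qed
  with C(3) D(3) show ?thesis by (intro ess_boundedI[of _ "C * D"] borel_measurable_times)
qed

lemma ess_bounded_const: "ess_bounded (\<lambda>t. c)"
  by (intro ess_boundedI[of _ "norm c"]) auto

lemma ess_bounded_sum: "(\<And>k. k \<in> S \<Longrightarrow> ess_bounded (F k)) \<Longrightarrow> ess_bounded (\<lambda>t. \<Sum>k\<in>S. F k t)"
  by (induction S rule: infinite_finite_induct) (simp_all add: ess_bounded_add ess_bounded_const)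

lemma ess_bounded_uminus: "ess_bounded F \<Longrightarrow> ess_bounded (\<lambda>t. - F t)"
  by (auto simp: ess_bounded_def)

lemma ess_bounded_diff: "ess_bounded F \<Longrightarrow> ess_bounded G \<Longrightarrow> ess_bounded (\<lambda>t. F t - G t)"
  using ess_bounded_add[OF _ ess_bounded_uminus, of F G] by simp

lemma ess_bounded_norm: "ess_bounded F \<Longrightarrow> ess_bounded (\<lambda>t. norm (F t))"
  by (auto simp: ess_bounded_def)

lemma ess_bounded_cnj: "ess_bounded F \<Longrightarrow> ess_bounded (\<lambda>t. cnj (F t))"
  unfolding ess_bounded_def complex_mod_cnj
  by (intro conjI borel_measurable_continuous_on[of cnj]) (simp_all add: continuous_on_cnj)

lemma ess_bounded_of_real: "ess_bounded F \<Longrightarrow> ess_bounded (\<lambda>t. complex_of_real (F t))"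
  by (auto simp: ess_bounded_def)

lemma ess_bounded_norm_square: "ess_bounded F \<Longrightarrow> ess_bounded (\<lambda>t. (norm (F t))\<^sup>2)"
  unfolding power2_eq_square by (intro ess_bounded_mult ess_bounded_norm)

lemmas ess_bounded_intros =
  ess_bounded_add ess_bounded_mult ess_bounded_const ess_bounded_sum ess_bounded_uminus ess_bounded_diff
  ess_bounded_norm ess_bounded_cnj ess_bounded_of_real ess_bounded_norm_square

lemma finite_measure_circle: "finite_measure circle_param"
  by (rule finite_measure_lebesgue_on) auto

lemma ess_bounded_integrable:
  fixes F :: "real \<Rightarrow> 'b::{banach, second_countable_topology}"
  assumes "ess_bounded F"
  shows "integrable circle_param F"
  using assms by (elim ess_boundedE) (rule finite_measure.integrable_const_bound[OF finite_measure_circle])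

definition mean :: "(real \<Rightarrow> 'b::{banach, second_countable_topology}) \<Rightarrow> 'b" where
  "mean F = (1 / (2 * pi)) *\<^sub>R (LINT t|circle_param. F t)"

lemma mean_add: "ess_bounded F \<Longrightarrow> ess_bounded G \<Longrightarrow> mean (\<lambda>t. F t + G t) = mean F + mean G"
  by (simp add: mean_def ess_bounded_integrable scaleR_add_right)

lemma mean_diff: "ess_bounded F \<Longrightarrow> ess_bounded G \<Longrightarrow> mean (\<lambda>t. F t - G t) = mean F - mean G"
  by (simp add: mean_def ess_bounded_integrable scaleR_diff_right)

lemma mean_sum: "(\<And>k. k \<in> S \<Longrightarrow> ess_bounded (F k)) \<Longrightarrow> mean (\<lambda>t. \<Sum>k\<in>S. F k t) = (\<Sum>k\<in>S. mean (F k))"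
  by (simp add: mean_def ess_bounded_integrable scaleR_sum_right)

lemma mean_mult_right:
  fixes F :: "real \<Rightarrow> 'b::{banach, real_normed_field, second_countable_topology}"
  shows "mean (\<lambda>t. c * F t) = c * mean F"
  by (simp add: mean_def)

lemma mean_cong_AE:
  assumes "AE t in circle_param. F t = G t"
    "F \<in> borel_measurable circle_param" "G \<in> borel_measurable circle_param"
  shows "mean F = mean G"
  unfolding mean_def integral_cong_AE[OF assms(2,3,1)] ..

lemma mean_of_real: "mean (\<lambda>t. complex_of_real (F t)) = of_real (mean F)"
  by (simp add: mean_def scaleR_conv_of_real)

lemma mean_cnj: "mean (\<lambda>t. cnj (F t)) = cnj (mean F)"
  by (simp add: mean_def)

lemma mean_mono:
  fixes F G :: "real \<Rightarrow> real"
  assumes "ess_bounded F" "ess_bounded G" "AE t in circle_param. F t \<le> G t"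
  shows "mean F \<le> mean G"
  unfolding mean_def
  by (intro scaleR_left_mono integral_mono_AE ess_bounded_integrable assms) simp

lemma mean_nonneg: "(\<And>t. 0 \<le> F t) \<Longrightarrow> 0 \<le> (mean F :: real)"
  by (simp add: mean_def)

lemma norm_mean_le: "norm (mean F) \<le> mean (\<lambda>t. norm (F t))"
  by (simp add: mean_def divide_right_mono)

lemma mean_const: "mean (\<lambda>t. c) = (c :: 'b::{banach, second_countable_topology})"
  by (simp add: mean_def measure_restrict_space)

lemma mean_eq_antiderivative:
  fixes F :: "real \<Rightarrow> 'b::euclidean_space"
  assumes deriv: "\<And>t. (F has_vector_derivative f t) (at t)" and cont: "continuous_on {0..2*pi} f"
  shows "mean f = (1 / (2 * pi)) *\<^sub>R (F (2 * pi) - F 0)"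
proof -
  have "(f has_integral (F (2 * pi) - F 0)) {0..2*pi}"
    by (rule fundamental_theorem_of_calculus) (simp_all add: has_vector_derivative_at_within[OF deriv])
  then have "integral {0..2*pi} f = F (2 * pi) - F 0" by (rule integral_unique)
  moreover have "(LINT t|circle_param. f t) = integral {0..2*pi} f"
    by (intro lebesgue_integral_eq_integral ess_bounded_integrable ess_bounded_continuous cont) simp
  ultimately show ?thesis by (simp add: mean_def)
qed

definition wave :: "int \<Rightarrow> real \<Rightarrow> complex" where
  "wave k t = exp (\<i> * of_int k * of_real t)"

lemma wave_0 [simp]: "wave 0 t = 1"
  by (simp add: wave_def)

lemma wave_mult: "wave j t * wave k t = wave (j + k) t"
  by (simp add: wave_def exp_add[symmetric] algebra_simps)

lemma cnj_wave: "cnj (wave k t) = wave (- k) t"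
  by (simp add: wave_def exp_cnj)

lemma norm_wave [simp]: "norm (wave k t) = 1"
  by (simp add: wave_def norm_exp_eq_Re)

lemma wave_2pi: "wave k (2 * pi) = 1"
  using exp_integer_2pi[of "of_int k"] by (simp add: wave_def mult_ac)

lemma continuous_wave: "continuous_on X (wave k)"
  unfolding wave_def by (intro continuous_intros)

lemma ess_bounded_wave: "ess_bounded (wave k)"
  by (intro ess_bounded_continuous continuous_wave)

lemma wave_has_vector_derivative: "(wave k has_vector_derivative (\<i> * of_int k * wave k t)) (at t)"
  unfolding wave_def by (auto intro!: derivative_eq_intros has_vector_derivative_real_field simp: mult_ac)

lemma mean_wave: "mean (wave k) = of_bool (k = 0)"
proof (cases "k = 0")
  case True
  have "wave 0 = (\<lambda>t. 1)" by auto
  then show ?thesis using True by (simp add: mean_const)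
next
  case False
  have "((\<lambda>t. wave k t / (\<i> * of_int k)) has_vector_derivative wave k t) (at t)" for t
    using has_vector_derivative_mult_right[OF wave_has_vector_derivative, of "1 / (\<i> * of_int k)" k t] False by simp
  from mean_eq_antiderivative[OF this continuous_wave] show ?thesis
    using False wave_2pi[of k] by (simp add: wave_def[of k 0])
qed

definition fcoeff :: "(real \<Rightarrow> complex) \<Rightarrow> int \<Rightarrow> complex" where
  "fcoeff F k = mean (\<lambda>t. F t * wave (- k) t)"

definition energy :: "(real \<Rightarrow> complex) \<Rightarrow> real" where
  "energy F = mean (\<lambda>t. (norm (F t))\<^sup>2)"

lemma energy_nonneg: "0 \<le> energy F"
  unfolding energy_def by (rule mean_nonneg) simp

text \<open>
  Orthonormality of the exponentials.  The right side is smallest when the coefficients \<open>p k\<close> are the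
  Fourier coefficients, so this one identity contains Bessel's inequality and the best approximation
  property.
\<close>
lemma energy_diff_trig:
  assumes G: "ess_bounded G" and S: "finite S"
  shows "energy (\<lambda>t. G t - (\<Sum>k\<in>S. p k * wave k t)) =
    energy G + (\<Sum>k\<in>S. (norm (fcoeff G k - p k))\<^sup>2 - (norm (fcoeff G k))\<^sup>2)"
proof -
  define T where "T t = (\<Sum>k\<in>S. p k * wave k t)" for t
  have T: "ess_bounded T" unfolding T_def by (intro ess_bounded_intros ess_bounded_wave)
  have "mean (\<lambda>t. G t * cnj (T t)) = mean (\<lambda>t. \<Sum>k\<in>S. cnj (p k) * (G t * wave (- k) t))"
    by (simp add: T_def cnj_wave sum_distrib_left mult_ac)
  also have "\<dots> = (\<Sum>k\<in>S. cnj (p k) * fcoeff G k)"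
    by (simp add: mean_sum mean_mult_right fcoeff_def ess_bounded_intros G ess_bounded_wave)
  finally have GT: "mean (\<lambda>t. G t * cnj (T t)) = (\<Sum>k\<in>S. cnj (p k) * fcoeff G k)" .
  have "mean (\<lambda>t. T t * cnj (G t)) = cnj (mean (\<lambda>t. G t * cnj (T t)))"
    unfolding mean_cnj[symmetric] by (simp add: mult.commute)
  then have TG: "mean (\<lambda>t. T t * cnj (G t)) = (\<Sum>k\<in>S. p k * cnj (fcoeff G k))"
    by (simp add: GT)
  have w: "wave (k - j) t = wave k t * wave (- j) t" for k j t by (simp add: wave_mult)
  have "T t * cnj (T t) = (\<Sum>k\<in>S. p k * (\<Sum>j\<in>S. cnj (p j) * wave (k - j) t))" for t
  proof -
    have "T t * cnj (T t) = (\<Sum>k\<in>S. \<Sum>j\<in>S. (p k * wave k t) * (cnj (p j) * wave (- j) t))"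
      by (simp only: T_def cnj_sum complex_cnj_mult cnj_wave sum_product)
    then show ?thesis unfolding w sum_distrib_left by (simp only: mult_ac)
  qed
  then have "mean (\<lambda>t. T t * cnj (T t)) = mean (\<lambda>t. \<Sum>k\<in>S. p k * (\<Sum>j\<in>S. cnj (p j) * wave (k - j) t))"
    by simp
  also have "\<dots> = (\<Sum>k\<in>S. p k * (\<Sum>j\<in>S. cnj (p j) * of_bool (k = j)))"
    by (simp add: mean_sum mean_mult_right ess_bounded_intros ess_bounded_wave mean_wave)
  also have "\<dots> = (\<Sum>k\<in>S. p k * cnj (p k))"
  proof (intro sum.cong refl)
    fix k assume "k \<in> S"
    then have "(\<Sum>j\<in>S. cnj (p j) * of_bool (k = j)) = (\<Sum>j\<in>S. if j = k then cnj (p j) else 0)"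
      by (intro sum.cong) auto
    then show "p k * (\<Sum>j\<in>S. cnj (p j) * of_bool (k = j)) = p k * cnj (p k)"
      using S \<open>k \<in> S\<close> by simp
  qed
  finally have TT: "mean (\<lambda>t. T t * cnj (T t)) = (\<Sum>k\<in>S. p k * cnj (p k))" .
  have energy: "complex_of_real (energy F) = mean (\<lambda>t. F t * cnj (F t))" for F
    unfolding energy_def mean_of_real[symmetric] by (simp only: complex_norm_square)
  have "complex_of_real (energy (\<lambda>t. G t - T t)) =
      mean (\<lambda>t. (G t * cnj (G t) - G t * cnj (T t)) - (T t * cnj (G t) - T t * cnj (T t)))"
    unfolding energy by (simp add: algebra_simps)
  also have "\<dots> = complex_of_real (energy G) - mean (\<lambda>t. G t * cnj (T t)) -
      (mean (\<lambda>t. T t * cnj (G t)) - mean (\<lambda>t. T t * cnj (T t)))"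
    by (simp add: mean_diff ess_bounded_intros G T energy)
  also have "\<dots> = complex_of_real (energy G) +
      (\<Sum>k\<in>S. (fcoeff G k - p k) * cnj (fcoeff G k - p k) - fcoeff G k * cnj (fcoeff G k))"
    unfolding GT TG TT by (simp add: sum_subtractf sum.distrib algebra_simps)
  also have "\<dots> = complex_of_real (energy G + (\<Sum>k\<in>S. (norm (fcoeff G k - p k))\<^sup>2 - (norm (fcoeff G k))\<^sup>2))"
    by (simp only: of_real_add of_real_sum of_real_diff complex_norm_square)
  finally show ?thesis unfolding of_real_eq_iff T_def .
qed

lemma energy_trig:
  assumes "finite S"
  shows "energy (\<lambda>t. \<Sum>k\<in>S. p k * wave k t) = (\<Sum>k\<in>S. (norm (p k))\<^sup>2)"
proof -
  have "energy (\<lambda>t. 0 - (\<Sum>k\<in>S. p k * wave k t)) = (\<Sum>k\<in>S. (norm (p k))\<^sup>2)"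
    by (subst energy_diff_trig[OF ess_bounded_const assms]) (simp add: fcoeff_def energy_def mean_const)
  then show ?thesis by (simp add: energy_def)
qed

text \<open>
  Cauchy-Schwarz, from the nonnegativity of the quadratic polynomial \<open>s \<mapsto> mean ((s \<bar>F\<bar> - \<bar>G\<bar>)\<^sup>2)\<close>.
\<close>
lemma mean_norm_mult_le:
  assumes F: "ess_bounded F" and G: "ess_bounded G"
  shows "mean (\<lambda>t. norm (F t) * norm (G t)) \<le> sqrt (energy F) * sqrt (energy G)"
proof -
  define m where "m = mean (\<lambda>t. norm (F t) * norm (G t))"
  have m: "0 \<le> m" unfolding m_def by (rule mean_nonneg) simp
  \<comment> \<open>the discriminant of this quadratic in \<open>s\<close> is not positive\<close>
  have key: "0 \<le> s\<^sup>2 * energy F - 2 * s * m + energy G" for s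
  proof -
    have "0 \<le> mean (\<lambda>t. (s * norm (F t) - norm (G t))\<^sup>2)" by (rule mean_nonneg) simp
    also have "(\<lambda>t. (s * norm (F t) - norm (G t))\<^sup>2) =
        (\<lambda>t. (s\<^sup>2 * (norm (F t))\<^sup>2 - (2 * s) * (norm (F t) * norm (G t))) + (norm (G t))\<^sup>2)"
      by (simp add: fun_eq_iff power2_eq_square algebra_simps)
    also have "mean \<dots> = s\<^sup>2 * energy F - 2 * s * m + energy G"
      by (simp add: mean_add mean_diff mean_mult_right ess_bounded_intros F G m_def energy_def
          del: mult.assoc)
    finally show ?thesis .
  qed
  have "m\<^sup>2 \<le> energy F * energy G"
  proof (cases "energy F = 0")
    case True
    have "m = 0"
    proof (rule ccontr)
      assume "m \<noteq> 0"
      then show False using key[of "(energy G + 1) / (2 * m)"] True by (simp add: field_simps)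
    qed
    then show ?thesis using True by simp
  next
    case False
    then have pos: "0 < energy F" using energy_nonneg[of F] by simp
    have "0 \<le> (m / energy F)\<^sup>2 * energy F - 2 * (m / energy F) * m + energy G" by (rule key)
    also have "\<dots> = energy G - m\<^sup>2 / energy F" using pos by (simp add: field_simps power2_eq_square)
    finally show ?thesis using pos by (simp add: field_simps)
  qed
  then have "sqrt (m\<^sup>2) \<le> sqrt (energy F * energy G)" by (rule real_sqrt_le_mono)
  then show ?thesis using m by (simp add: m_def real_sqrt_mult)
qed

lemma energy_add_le:
  assumes "ess_bounded F" "ess_bounded G"
  shows "energy (\<lambda>t. F t + G t) \<le> 2 * energy F + 2 * energy G"
proof -
  have "energy (\<lambda>t. F t + G t) \<le> mean (\<lambda>t. 2 * (norm (F t))\<^sup>2 + 2 * (norm (G t))\<^sup>2)"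
    unfolding energy_def
  proof (rule mean_mono)
    show "AE t in circle_param. (norm (F t + G t))\<^sup>2 \<le> 2 * (norm (F t))\<^sup>2 + 2 * (norm (G t))\<^sup>2"
    proof (rule AE_I2)
      fix t
      have "(norm (F t + G t))\<^sup>2 \<le> (norm (F t) + norm (G t))\<^sup>2"
        by (intro power_mono norm_triangle_ineq norm_ge_zero)
      also have "\<dots> \<le> 2 * (norm (F t))\<^sup>2 + 2 * (norm (G t))\<^sup>2"
        using sum_squares_bound[of "norm (F t)" "norm (G t)"] by (simp add: power2_sum)
      finally show "(norm (F t + G t))\<^sup>2 \<le> 2 * (norm (F t))\<^sup>2 + 2 * (norm (G t))\<^sup>2" .
    qed
  qed (intro ess_bounded_intros assms)+
  then show ?thesis
    by (simp add: mean_add mean_mult_right ess_bounded_intros assms energy_def)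
qed

lemma energy_mult_le:
  assumes F: "ess_bounded F" and G: "ess_bounded G" and C: "AE t in circle_param. norm (F t) \<le> C"
  shows "energy (\<lambda>t. F t * G t) \<le> C\<^sup>2 * energy G"
proof -
  have "energy (\<lambda>t. F t * G t) \<le> mean (\<lambda>t. C\<^sup>2 * (norm (G t))\<^sup>2)"
    unfolding energy_def
  proof (rule mean_mono)
    from C show "AE t in circle_param. (norm (F t * G t))\<^sup>2 \<le> C\<^sup>2 * (norm (G t))\<^sup>2"
      by eventually_elim (simp add: norm_mult power_mult_distrib power_mono mult_right_mono)
  qed (intro ess_bounded_intros F G)+
  then show ?thesis by (simp add: mean_mult_right energy_def)
qed

lemma energy_le_sup:
  assumes "ess_bounded F" and "AE t in circle_param. norm (F t) \<le> C"
  shows "energy F \<le> C\<^sup>2"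
  using energy_mult_le[OF assms(1) ess_bounded_const[of 1] assms(2)] by (simp add: energy_def mean_const)

section \<open>Completeness of the exponentials and the convolution theorem\<close>

definition trig_poly :: "(real \<Rightarrow> complex) \<Rightarrow> bool" where
  "trig_poly T \<longleftrightarrow> (\<exists>S p. finite S \<and> T = (\<lambda>t. \<Sum>k\<in>S. p k * wave k t))"

lemma trig_polyI: "finite S \<Longrightarrow> trig_poly (\<lambda>t. \<Sum>k\<in>S. p k * wave k t)"
  unfolding trig_poly_def by blast

lemma trig_polyE:
  assumes "trig_poly T"
  obtains S p where "finite S" "T = (\<lambda>t. \<Sum>k\<in>S. p k * wave k t)" "\<forall>k. k \<notin> S \<longrightarrow> p k = 0"
proof -
  obtain S p where S: "finite S" "T = (\<lambda>t. \<Sum>k\<in>S. p k * wave k t)"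
    using assms unfolding trig_poly_def by blast
  show ?thesis by (rule that[of S "\<lambda>k. if k \<in> S then p k else 0"]) (use S in auto)
qed

lemma trig_poly_const: "trig_poly (\<lambda>t. c)"
  using trig_polyI[of "{0}" "\<lambda>_. c"] by simp

lemma trig_poly_ess_bounded: "trig_poly T \<Longrightarrow> ess_bounded T"
  unfolding trig_poly_def by (auto intro!: ess_bounded_intros ess_bounded_wave)

lemma trig_poly_add:
  assumes "trig_poly T" "trig_poly U"
  shows "trig_poly (\<lambda>t. T t + U t)"
proof -
  obtain S p where S: "finite S" "T = (\<lambda>t. \<Sum>k\<in>S. p k * wave k t)" "\<forall>k. k \<notin> S \<longrightarrow> p k = 0"
    using assms(1) by (rule trig_polyE)
  obtain R q where R: "finite R" "U = (\<lambda>t. \<Sum>k\<in>R. q k * wave k t)" "\<forall>k. k \<notin> R \<longrightarrow> q k = 0"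
    using assms(2) by (rule trig_polyE)
  have "T t + U t = (\<Sum>k\<in>S \<union> R. (p k + q k) * wave k t)" for t
  proof -
    have "T t = (\<Sum>k\<in>S \<union> R. p k * wave k t)"
      unfolding S(2) using S R by (intro sum.mono_neutral_left) auto
    moreover have "U t = (\<Sum>k\<in>S \<union> R. q k * wave k t)"
      unfolding R(2) using S R by (intro sum.mono_neutral_left) auto
    ultimately show ?thesis by (simp add: sum.distrib distrib_right)
  qed
  then show ?thesis using trig_polyI[of "S \<union> R" "\<lambda>k. p k + q k"] S(1) R(1) by simp
qed

lemma trig_poly_sum: "(\<And>k. k \<in> S \<Longrightarrow> trig_poly (T k)) \<Longrightarrow> trig_poly (\<lambda>t. \<Sum>k\<in>S. T k t)"
  by (induction S rule: infinite_finite_induct) (simp_all add: trig_poly_add trig_poly_const)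

lemma trig_poly_mult:
  assumes "trig_poly T" "trig_poly U"
  shows "trig_poly (\<lambda>t. T t * U t)"
proof -
  obtain S p where S: "T = (\<lambda>t. \<Sum>k\<in>S. p k * wave k t)"
    using assms(1) by (rule trig_polyE)
  obtain R q where R: "U = (\<lambda>t. \<Sum>k\<in>R. q k * wave k t)"
    using assms(2) by (rule trig_polyE)
  have "T t * U t = (\<Sum>k\<in>S. \<Sum>j\<in>R. \<Sum>i\<in>{k + j}. (p k * q j) * wave i t)" for t
    by (simp add: S R sum_product mult_ac flip: wave_mult)
  then show ?thesis by (simp only:) (intro trig_poly_sum trig_polyI finite.intros)
qed

text \<open>
  The closure of the trigonometric polynomials in the mean square, restricted to essentially bounded functions so
  that it is closed under products.
\<close>
definition trig_approximable :: "(real \<Rightarrow> complex) \<Rightarrow> bool" where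
  "trig_approximable G \<longleftrightarrow>
     ess_bounded G \<and> (\<forall>\<epsilon>>0. \<exists>T. trig_poly T \<and> energy (\<lambda>t. G t - T t) < \<epsilon>)"

lemma trig_approximableD:
  assumes "trig_approximable G" "0 < \<epsilon>"
  obtains T where "trig_poly T" "energy (\<lambda>t. G t - T t) < \<epsilon>" "ess_bounded T"
  using assms trig_poly_ess_bounded unfolding trig_approximable_def by blast

lemma trig_approximable_limit:
  assumes G: "ess_bounded G"
    and approx: "\<And>\<epsilon>. 0 < \<epsilon> \<Longrightarrow> \<exists>H. trig_approximable H \<and> energy (\<lambda>t. G t - H t) < \<epsilon>"
  shows "trig_approximable G"
  unfolding trig_approximable_def
proof (intro conjI allI impI G)
  fix \<epsilon> :: real assume "0 < \<epsilon>"
  then have e: "0 < \<epsilon> / 4" by simp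
  then obtain H where H: "trig_approximable H" "energy (\<lambda>t. G t - H t) < \<epsilon> / 4"
    using approx by blast
  obtain T where T: "trig_poly T" "energy (\<lambda>t. H t - T t) < \<epsilon> / 4" "ess_bounded T"
    using H(1) e by (rule trig_approximableD)
  have "ess_bounded H" using H(1) by (simp add: trig_approximable_def)
  then have "energy (\<lambda>t. (G t - H t) + (H t - T t)) \<le> 2 * energy (\<lambda>t. G t - H t) + 2 * energy (\<lambda>t. H t - T t)"
    by (intro energy_add_le ess_bounded_intros G T)
  then have "energy (\<lambda>t. G t - T t) < \<epsilon>" using H T by simp
  then show "\<exists>T. trig_poly T \<and> energy (\<lambda>t. G t - T t) < \<epsilon>" using T by blast
qed

lemma trig_approximable_trig_poly: "trig_poly T \<Longrightarrow> trig_approximable T"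
  unfolding trig_approximable_def
  by (auto intro!: exI[of _ T] trig_poly_ess_bounded simp: energy_def mean_const)

lemma trig_approximable_add:
  assumes F: "trig_approximable F" and G: "trig_approximable G"
  shows "trig_approximable (\<lambda>t. F t + G t)"
  unfolding trig_approximable_def
proof (intro conjI allI impI)
  have FG: "ess_bounded F" "ess_bounded G" using F G by (simp_all add: trig_approximable_def)
  then show "ess_bounded (\<lambda>t. F t + G t)" by (rule ess_bounded_add)
  fix \<epsilon> :: real assume "0 < \<epsilon>"
  then have e: "0 < \<epsilon> / 4" by simp
  obtain T where T: "trig_poly T" "energy (\<lambda>t. F t - T t) < \<epsilon> / 4" "ess_bounded T"
    using F e by (rule trig_approximableD)
  obtain U where U: "trig_poly U" "energy (\<lambda>t. G t - U t) < \<epsilon> / 4" "ess_bounded U"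
    using G e by (rule trig_approximableD)
  have "energy (\<lambda>t. (F t - T t) + (G t - U t)) \<le> 2 * energy (\<lambda>t. F t - T t) + 2 * energy (\<lambda>t. G t - U t)"
    by (intro energy_add_le ess_bounded_intros FG T U)
  moreover have "(\<lambda>t. (F t - T t) + (G t - U t)) = (\<lambda>t. (F t + G t) - (T t + U t))" by auto
  ultimately have "energy (\<lambda>t. (F t + G t) - (T t + U t)) < \<epsilon>" using T U by simp
  then show "\<exists>T. trig_poly T \<and> energy (\<lambda>t. F t + G t - T t) < \<epsilon>"
    using trig_poly_add[OF T(1) U(1)] by blast
qed

text \<open>
  Approximate \<open>G\<close> by \<open>U\<close> first, with a tolerance that allows for the bound of \<open>F\<close>, and then \<open>F\<close> by \<open>T\<close>, with a
  tolerance that allows for the bound of \<open>U\<close>: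
  \<open>F G - T U = F (G - U) + U (F - T)\<close>.
\<close>
lemma trig_approximable_mult:
  assumes F: "trig_approximable F" and G: "trig_approximable G"
  shows "trig_approximable (\<lambda>t. F t * G t)"
  unfolding trig_approximable_def
proof (intro conjI allI impI)
  have FG: "ess_bounded F" "ess_bounded G" using F G by (simp_all add: trig_approximable_def)
  then show "ess_bounded (\<lambda>t. F t * G t)" by (rule ess_bounded_mult)
  fix \<epsilon> :: real assume \<epsilon>: "0 < \<epsilon>"
  obtain C where C: "0 \<le> C" "AE t in circle_param. norm (F t) \<le> C"
    using FG(1) by (rule ess_boundedE)
  have "0 < \<epsilon> / (4 * (C\<^sup>2 + 1))" using \<epsilon> by (simp add: add_nonneg_pos)
  with G obtain U where U: "trig_poly U" "energy (\<lambda>t. G t - U t) < \<epsilon> / (4 * (C\<^sup>2 + 1))" "ess_bounded U"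
    by (rule trig_approximableD)
  obtain D where D: "0 \<le> D" "AE t in circle_param. norm (U t) \<le> D"
    using U(3) by (rule ess_boundedE)
  have "0 < \<epsilon> / (4 * (D\<^sup>2 + 1))" using \<epsilon> by (simp add: add_nonneg_pos)
  with F obtain T where T: "trig_poly T" "energy (\<lambda>t. F t - T t) < \<epsilon> / (4 * (D\<^sup>2 + 1))" "ess_bounded T"
    by (rule trig_approximableD)
  have small: "C\<^sup>2 * x < \<epsilon> / 4" if "x < \<epsilon> / (4 * (C\<^sup>2 + 1))" "0 \<le> x" for C x :: real
  proof -
    have "C\<^sup>2 * x \<le> (C\<^sup>2 + 1) * x" using that by (simp add: algebra_simps)
    also have "\<dots> < (C\<^sup>2 + 1) * (\<epsilon> / (4 * (C\<^sup>2 + 1)))"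
      using that by (intro mult_strict_left_mono) (auto simp: add_nonneg_pos)
    also have "\<dots> = \<epsilon> / 4"
    proof -
      have D: "D * (\<epsilon> / (4 * D)) = \<epsilon> / 4" if "0 < D" for D using that by simp
      show ?thesis by (rule D) (simp add: add_nonneg_pos)
    qed
    finally show ?thesis .
  qed
  have "energy (\<lambda>t. F t * (G t - U t)) \<le> C\<^sup>2 * energy (\<lambda>t. G t - U t)"
    by (intro energy_mult_le ess_bounded_intros FG U C)
  also have "\<dots> < \<epsilon> / 4" by (rule small[OF U(2) energy_nonneg])
  finally have 1: "energy (\<lambda>t. F t * (G t - U t)) < \<epsilon> / 4" .
  have "energy (\<lambda>t. U t * (F t - T t)) \<le> D\<^sup>2 * energy (\<lambda>t. F t - T t)"
    by (intro energy_mult_le ess_bounded_intros FG U D T)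
  also have "\<dots> < \<epsilon> / 4" by (rule small[OF T(2) energy_nonneg])
  finally have 2: "energy (\<lambda>t. U t * (F t - T t)) < \<epsilon> / 4" .
  have "energy (\<lambda>t. F t * (G t - U t) + U t * (F t - T t)) \<le>
      2 * energy (\<lambda>t. F t * (G t - U t)) + 2 * energy (\<lambda>t. U t * (F t - T t))"
    by (intro energy_add_le ess_bounded_intros FG T U)
  moreover have "(\<lambda>t. F t * (G t - U t) + U t * (F t - T t)) = (\<lambda>t. F t * G t - T t * U t)"
    by (simp add: fun_eq_iff algebra_simps)
  ultimately have "energy (\<lambda>t. F t * G t - T t * U t) < \<epsilon>" using 1 2 by simp
  then show "\<exists>T. trig_poly T \<and> energy (\<lambda>t. F t * G t - T t) < \<epsilon>"
    using trig_poly_mult[OF T(1) U(1)] by blast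
qed

text \<open>
  With the next two lemmas this evaluates the data of the function \<open>t\<close>: mean square \<open>4 \<pi>\<^sup>2 / 3\<close>, mean value \<open>\<pi>\<close>, and
  coefficient \<open>\<i> / k\<close> for \<open>k \<noteq> 0\<close>.
\<close>
lemma energy_parameter: "energy complex_of_real = 4 * pi\<^sup>2 / 3"
proof -
  have "mean (\<lambda>t::real. t\<^sup>2) = (1 / (2 * pi)) *\<^sub>R ((2 * pi) ^ 3 / 3 - 0 ^ 3 / 3)"
    by (rule mean_eq_antiderivative)
       (auto intro!: derivative_eq_intros continuous_intros
         simp: power2_eq_square simp flip: has_real_derivative_iff_has_vector_derivative)
  then show ?thesis by (simp add: energy_def power2_eq_square power3_eq_cube field_simps)
qed

lemma fcoeff_parameter_0: "fcoeff complex_of_real 0 = pi"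
proof -
  have "mean (\<lambda>t::real. t) = (1 / (2 * pi)) *\<^sub>R ((2 * pi)\<^sup>2 / 2 - 0\<^sup>2 / 2)"
    by (rule mean_eq_antiderivative)
       (auto intro!: derivative_eq_intros continuous_intros
         simp flip: has_real_derivative_iff_has_vector_derivative)
  then have "mean (\<lambda>t::real. t) = pi" by (simp add: power2_eq_square field_simps)
  then show ?thesis by (simp add: fcoeff_def mean_of_real)
qed

lemma fcoeff_parameter:
  assumes k: "k \<noteq> 0"
  shows "fcoeff complex_of_real k = \<i> / of_int k"
proof -
  \<comment> \<open>integration by parts, written as an explicit antiderivative\<close>
  let ?c = "- (\<i> * of_int k) :: complex"
  have c: "?c \<noteq> 0" "?c * ?c = - (of_int k)\<^sup>2" using k by (auto simp: power2_eq_square algebra_simps)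
  have "((\<lambda>t. (of_real t / ?c - 1 / (?c * ?c)) * wave (- k) t) has_vector_derivative of_real t * wave (- k) t) (at t)" for t
  proof -
    have w: "(wave (- k) has_vector_derivative ?c * wave (- k) t) (at t)"
      using wave_has_vector_derivative[of "- k" t] by simp
    have l: "((\<lambda>t. of_real t / ?c - 1 / (?c * ?c)) has_vector_derivative 1 / ?c) (at t)"
      by (auto intro!: derivative_eq_intros simp: divide_inverse)
    show ?thesis
      using has_vector_derivative_mult[OF l w] c(1) by (simp add: field_simps)
  qed
  then have "fcoeff complex_of_real k = (1 / (2 * pi)) *\<^sub>R
      ((of_real (2 * pi) / ?c - 1 / (?c * ?c)) * wave (- k) (2 * pi) - (of_real 0 / ?c - 1 / (?c * ?c)) * wave (- k) 0)"
    unfolding fcoeff_def by (rule mean_eq_antiderivative) (intro continuous_intros continuous_wave)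
  also have "\<dots> = (1 / (2 * pi)) *\<^sub>R (of_real (2 * pi) / ?c)"
    by (simp only: wave_2pi) (simp add: wave_def[of "- k" 0])
  also have "\<dots> = 1 / ?c" by (simp add: scaleR_conv_of_real)
  also have "\<dots> = \<i> / of_int k" using k by (simp add: field_simps)
  finally show ?thesis .
qed

text \<open>
  The partial sums of the Fourier series of \<open>t\<close> leave the error \<open>4 \<pi>\<^sup>2 / 3 - \<pi>\<^sup>2 - 2 \<Sum> 1 / k\<^sup>2\<close>, which tends to
  \<open>0\<close> by Euler's evaluation of \<open>\<Sum> 1 / k\<^sup>2\<close>.
\<close>
lemma trig_approximable_parameter: "trig_approximable complex_of_real"
  unfolding trig_approximable_def
proof (intro conjI allI impI)
  show eb: "ess_bounded complex_of_real"
    by (intro ess_bounded_continuous continuous_intros)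
  fix \<epsilon> :: real assume \<epsilon>: "0 < \<epsilon>"
  define s where "s m = (\<Sum>k<m. 1 / (real (Suc k))\<^sup>2)" for m
  have s: "s \<longlonglongrightarrow> pi\<^sup>2 / 6"
    using inverse_squares_sums by (simp add: sums_def s_def[abs_def] add.commute)
  then have "\<forall>\<^sub>F m in sequentially. pi\<^sup>2 / 6 - \<epsilon> / 2 < s m"
    using \<epsilon> by (intro order_tendstoD(1)) auto
  then obtain m where m: "pi\<^sup>2 / 6 - \<epsilon> / 2 < s m"
    by (auto simp: eventually_sequentially)
  let ?f = "\<lambda>k. fcoeff complex_of_real k"
  \<comment> \<open>the frequencies of absolute value at most \<open>m\<close>\<close>
  let ?S = "insert 0 ((\<lambda>k. int (Suc k)) ` {..<m} \<union> (\<lambda>k. - int (Suc k)) ` {..<m})"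
  have square: "(norm (?f k))\<^sup>2 = 1 / (of_int k)\<^sup>2" if "k \<noteq> 0" for k
    using that by (simp add: fcoeff_parameter norm_divide power_divide)
  have "(\<Sum>k\<in>?S. (norm (?f k))\<^sup>2) = (norm (?f 0))\<^sup>2 +
      ((\<Sum>k\<in>(\<lambda>k. int (Suc k)) ` {..<m}. (norm (?f k))\<^sup>2) + (\<Sum>k\<in>(\<lambda>k. - int (Suc k)) ` {..<m}. (norm (?f k))\<^sup>2))"
    by (subst sum.insert) (auto intro!: sum.union_disjoint)
  also have "(\<Sum>k\<in>(\<lambda>k. int (Suc k)) ` {..<m}. (norm (?f k))\<^sup>2) = s m"
    unfolding s_def by (subst sum.reindex) (auto intro!: inj_onI sum.cong simp: square)
  also have "(\<Sum>k\<in>(\<lambda>k. - int (Suc k)) ` {..<m}. (norm (?f k))\<^sup>2) = s m"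
  proof -
    have "(norm (?f (- int (Suc k))))\<^sup>2 = 1 / (real (Suc k))\<^sup>2" for k
      by (subst square) (simp_all del: of_nat_Suc)
    then show ?thesis
      unfolding s_def by (subst sum.reindex) (simp_all add: inj_on_def o_def del: of_nat_Suc)
  qed
  finally have "(\<Sum>k\<in>?S. (norm (?f k))\<^sup>2) = pi\<^sup>2 + (s m + s m)"
    by (simp add: fcoeff_parameter_0)
  moreover have "energy (\<lambda>t. complex_of_real t - (\<Sum>k\<in>?S. ?f k * wave k t)) =
      4 * pi\<^sup>2 / 3 - (\<Sum>k\<in>?S. (norm (?f k))\<^sup>2)"
    by (subst energy_diff_trig[OF eb]) (simp_all add: energy_parameter sum_negf)
  ultimately have "energy (\<lambda>t. complex_of_real t - (\<Sum>k\<in>?S. ?f k * wave k t)) < \<epsilon>"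
    using m by simp
  moreover have "trig_poly (\<lambda>t. \<Sum>k\<in>?S. ?f k * wave k t)" by (rule trig_polyI) simp
  ultimately show "\<exists>T. trig_poly T \<and> energy (\<lambda>t. complex_of_real t - T t) < \<epsilon>" by blast
qed

lemma trig_approximable_polynomial:
  "real_polynomial_function g \<Longrightarrow> trig_approximable (\<lambda>t. complex_of_real (g t))"
proof (induction rule: real_polynomial_function.induct)
  case (linear f)
  have "f t = t * f 1" for t using linear_scale[OF bounded_linear.linear[OF linear], of t 1] by simp
  then have "(\<lambda>t. complex_of_real (f t)) = (\<lambda>t. of_real t * of_real (f 1))"
    by (metis of_real_mult)
  then show ?case
    using trig_approximable_mult[OF trig_approximable_parameter
        trig_approximable_trig_poly[OF trig_poly_const[of "of_real (f 1)"]]] by simp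
qed (simp_all add: trig_approximable_add trig_approximable_mult trig_approximable_trig_poly trig_poly_const)

lemma trig_approximable_continuous_real:
  assumes cont: "continuous_on {0..2*pi} h"
  shows "trig_approximable (\<lambda>t. complex_of_real (h t))"
proof (rule trig_approximable_limit)
  show h: "ess_bounded (\<lambda>t. complex_of_real (h t))"
    by (intro ess_bounded_of_real ess_bounded_continuous cont)
  fix \<epsilon> :: real assume \<epsilon>: "0 < \<epsilon>"
  then have "0 < sqrt (\<epsilon> / 2)" by simp
  then obtain g where g: "real_polynomial_function g" "\<And>t. t \<in> {0..2*pi} \<Longrightarrow> \<bar>h t - g t\<bar> < sqrt (\<epsilon> / 2)"
    using Stone_Weierstrass_real_polynomial_function[OF compact_Icc cont] by blast
  let ?G = "\<lambda>t. complex_of_real (g t)"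
  have G: "trig_approximable ?G" by (rule trig_approximable_polynomial[OF g(1)])
  have "energy (\<lambda>t. complex_of_real (h t) - ?G t) \<le> (sqrt (\<epsilon> / 2))\<^sup>2"
  proof (rule energy_le_sup)
    show "ess_bounded (\<lambda>t. complex_of_real (h t) - ?G t)"
      using G by (intro ess_bounded_diff h) (simp add: trig_approximable_def)
    show "AE t in circle_param. norm (complex_of_real (h t) - ?G t) \<le> sqrt (\<epsilon> / 2)"
    proof (rule AE_I2)
      fix t assume "t \<in> space circle_param"
      then have "\<bar>h t - g t\<bar> \<le> sqrt (\<epsilon> / 2)" using g(2)[of t] by simp
      then show "norm (complex_of_real (h t) - ?G t) \<le> sqrt (\<epsilon> / 2)"
        by (simp flip: of_real_diff)
    qed
  qed
  also have "\<dots> < \<epsilon>" using \<epsilon> by simp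
  finally show "\<exists>H. trig_approximable H \<and> energy (\<lambda>t. complex_of_real (h t) - H t) < \<epsilon>"
    using G by blast
qed

lemma trig_approximable_continuous:
  assumes cont: "continuous_on {0..2*pi} (h :: real \<Rightarrow> complex)"
  shows "trig_approximable h"
proof -
  have "trig_approximable (\<lambda>t. complex_of_real (Re (h t)) + \<i> * complex_of_real (Im (h t)))"
    by (intro trig_approximable_add trig_approximable_mult trig_approximable_continuous_real
        trig_approximable_trig_poly trig_poly_const continuous_intros cont)
  then show ?thesis by (simp flip: complex_eq)
qed

text \<open>
  A Lebesgue measurable function is almost everywhere the limit of continuous functions; projecting their values
  onto a disc that contains almost all values of \<open>G\<close> keeps them continuous and makes dominated convergence applicable.
\<close>
theorem trig_approximable_ess_bounded:
  assumes G: "ess_bounded G"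
  shows "trig_approximable G"
proof (rule trig_approximable_limit[OF G])
  fix \<epsilon> :: real assume \<epsilon>: "0 < \<epsilon>"
  obtain C where C: "0 \<le> C" "AE t in circle_param. norm (G t) \<le> C" "G \<in> borel_measurable circle_param"
    using G by (rule ess_boundedE)
  have "G measurable_on {0..2*pi}"
    using C(3) by (subst measurable_on_iff_borel_measurable) auto
  then obtain N g where N: "negligible N" and g: "\<And>n. continuous_on UNIV (g n)"
    and lim: "\<And>t. t \<notin> N \<Longrightarrow> (\<lambda>n. g n t) \<longlonglongrightarrow> (if t \<in> {0..2*pi} then G t else 0)"
    unfolding measurable_on_def by blast
  define clip :: "complex \<Rightarrow> complex" where "clip = closest_point (cball 0 C)"
  have clip: "continuous_on X clip" for X
    unfolding clip_def using C(1) by (intro continuous_on_closest_point) auto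
  have clip_le: "norm (clip z) \<le> C" for z
    using closest_point_in_set[of "cball 0 C" z] C(1) by (simp add: clip_def)
  have clip_id: "clip z = z" if "norm z \<le> C" for z
    unfolding clip_def using that by (intro closest_point_self) simp
  define h where "h n t = clip (g n t)" for n t
  have h_cont: "continuous_on X (h n)" for n X
    unfolding h_def by (intro continuous_on_compose2[OF clip[of UNIV] continuous_on_subset[OF g]]) auto
  then have h: "trig_approximable (h n)" for n by (rule trig_approximable_continuous)
  then have h_bdd: "ess_bounded (h n)" for n by (simp add: trig_approximable_def)
  have "(\<lambda>n. LINT t|circle_param. (norm (G t - h n t))\<^sup>2) \<longlonglongrightarrow> (LINT t|circle_param. 0)"
  proof (rule integral_dominated_convergence[where w = "\<lambda>_. (2 * C)\<^sup>2"])
    have "AE t in lebesgue. t \<notin> N"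
      using N by (simp add: negligible_iff_null_sets AE_not_in)
    then have "AE t in circle_param. t \<notin> N" by (auto simp: AE_restrict_space_iff elim: eventually_mono)
    with C(2) show "AE t in circle_param. (\<lambda>n. (norm (G t - h n t))\<^sup>2) \<longlonglongrightarrow> 0"
    proof (rule AE_mp[OF AE_conjI], intro AE_I2 impI)
      fix t assume t: "t \<in> space circle_param" and "norm (G t) \<le> C \<and> t \<notin> N"
      then have "(\<lambda>n. g n t) \<longlonglongrightarrow> G t" using lim[of t] by simp
      then have "(\<lambda>n. h n t) \<longlonglongrightarrow> clip (G t)"
        unfolding h_def by (rule continuous_on_tendsto_compose[OF clip[of UNIV]]) auto
      then have "(\<lambda>n. (norm (G t - h n t))\<^sup>2) \<longlonglongrightarrow> (norm (G t - clip (G t)))\<^sup>2"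
        by (intro tendsto_intros)
      then show "(\<lambda>n. (norm (G t - h n t))\<^sup>2) \<longlonglongrightarrow> 0"
        using \<open>norm (G t) \<le> C \<and> t \<notin> N\<close> by (simp add: clip_id)
    qed
    show "AE t in circle_param. norm ((norm (G t - h n t))\<^sup>2) \<le> (2 * C)\<^sup>2" for n
      using C(2)
    proof eventually_elim
      case (elim t)
      have "norm (G t - h n t) \<le> norm (G t) + norm (h n t)" by (rule norm_triangle_ineq4)
      also have "\<dots> \<le> 2 * C" using elim clip_le[of "g n t"] by (simp add: h_def)
      finally have "norm (G t - h n t) \<le> 2 * C" .
      then have "(norm (G t - h n t))\<^sup>2 \<le> (2 * C)\<^sup>2" by (intro power_mono norm_ge_zero)
      then show ?case by simp
    qed
    show "(\<lambda>t. (norm (G t - h n t))\<^sup>2) \<in> borel_measurable circle_param" for n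
      using ess_bounded_norm_square[OF ess_bounded_diff[OF G h_bdd[of n]]] by (simp add: ess_bounded_def)
  qed auto
  then have "(\<lambda>n. energy (\<lambda>t. G t - h n t)) \<longlonglongrightarrow> (1 / (2 * pi)) *\<^sub>R 0"
    unfolding energy_def mean_def by (intro tendsto_scaleR tendsto_const) simp
  then have "(\<lambda>n. energy (\<lambda>t. G t - h n t)) \<longlonglongrightarrow> 0" by simp
  then have "\<forall>\<^sub>F n in sequentially. energy (\<lambda>t. G t - h n t) < \<epsilon>"
    using \<epsilon> by (rule order_tendstoD)
  then obtain n where "energy (\<lambda>t. G t - h n t) < \<epsilon>"
    by (auto simp: eventually_sequentially)
  then show "\<exists>H. trig_approximable H \<and> energy (\<lambda>t. G t - H t) < \<epsilon>" using h by blast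
qed

text \<open>
  The partial sum over \<open>S\<close> is the mean of \<open>F\<close> times the orthogonal projection of \<open>G\<close>, and by the best
  approximation property that projection is at least as close to \<open>G\<close> as any trigonometric polynomial with frequencies in
  \<open>S\<close>.
\<close>
theorem parseval_has_sum:
  assumes F: "ess_bounded F" and G: "ess_bounded G"
  shows "((\<lambda>k. fcoeff F (- k) * fcoeff G k) has_sum mean (\<lambda>t. F t * G t)) UNIV"
  unfolding has_sum_def
proof (rule tendstoI)
  fix \<epsilon> :: real assume \<epsilon>: "0 < \<epsilon>"
  \<comment> \<open>adding \<open>1\<close> makes \<open>c\<close> positive also when \<open>F\<close> vanishes\<close>
  define c where "c = sqrt (energy F) + 1"
  have c: "0 < c" "sqrt (energy F) \<le> c" by (simp_all add: c_def add_nonneg_pos energy_nonneg)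
  define \<delta> where "\<delta> = \<epsilon> / c"
  have \<delta>: "0 < \<delta>" using \<epsilon> c by (simp add: \<delta>_def)
  then have "0 < \<delta>\<^sup>2" by simp
  then obtain T where T: "trig_poly T" "energy (\<lambda>t. G t - T t) < \<delta>\<^sup>2"
    using trig_approximable_ess_bounded[OF G] by (elim trig_approximableD)
  obtain S0 p where S0: "finite S0" "T = (\<lambda>t. \<Sum>k\<in>S0. p k * wave k t)" "\<forall>k. k \<notin> S0 \<longrightarrow> p k = 0"
    using T(1) by (rule trig_polyE)
  have close: "dist (\<Sum>k\<in>S. fcoeff F (- k) * fcoeff G k) (mean (\<lambda>t. F t * G t)) < \<epsilon>"
    if S: "finite S" "S0 \<subseteq> S" for S
  proof -
    define U where "U t = (\<Sum>k\<in>S. fcoeff G k * wave k t)" for t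
    have U: "ess_bounded U" unfolding U_def by (intro ess_bounded_intros ess_bounded_wave)
    have TS: "T = (\<lambda>t. \<Sum>k\<in>S. p k * wave k t)"
      unfolding S0(2) using S S0 by (intro ext sum.mono_neutral_left) auto
    have "energy (\<lambda>t. G t - U t) = energy G - (\<Sum>k\<in>S. (norm (fcoeff G k))\<^sup>2)"
      unfolding U_def by (subst energy_diff_trig[OF G S(1)]) (simp add: sum_negf)
    also have "\<dots> \<le> energy G + (\<Sum>k\<in>S. (norm (fcoeff G k - p k))\<^sup>2 - (norm (fcoeff G k))\<^sup>2)"
      by (simp add: sum_subtractf sum_nonneg)
    also have "\<dots> = energy (\<lambda>t. G t - T t)"
      unfolding TS by (rule energy_diff_trig[OF G S(1), symmetric])
    finally have "energy (\<lambda>t. G t - U t) < \<delta>\<^sup>2" using T(2) by simp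
    then have "sqrt (energy (\<lambda>t. G t - U t)) < sqrt (\<delta>\<^sup>2)" by (rule real_sqrt_less_mono)
    then have small: "sqrt (energy (\<lambda>t. G t - U t)) < \<delta>" using \<delta> by simp
    have "mean (\<lambda>t. F t * U t) = mean (\<lambda>t. \<Sum>k\<in>S. fcoeff G k * (F t * wave k t))"
      by (simp add: U_def sum_distrib_left mult_ac)
    also have "\<dots> = (\<Sum>k\<in>S. fcoeff G k * fcoeff F (- k))"
      by (simp add: mean_sum mean_mult_right ess_bounded_intros F ess_bounded_wave fcoeff_def)
    finally have FU: "mean (\<lambda>t. F t * U t) = (\<Sum>k\<in>S. fcoeff F (- k) * fcoeff G k)"
      by (simp add: mult.commute)
    have "mean (\<lambda>t. F t * G t) - mean (\<lambda>t. F t * U t) = mean (\<lambda>t. F t * (G t - U t))"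
      by (simp add: mean_diff[symmetric] ess_bounded_intros F G U right_diff_distrib)
    also have "norm \<dots> \<le> mean (\<lambda>t. norm (F t) * norm (G t - U t))"
      using norm_mean_le[of "\<lambda>t. F t * (G t - U t)"] by (simp add: norm_mult)
    also have "\<dots> \<le> sqrt (energy F) * sqrt (energy (\<lambda>t. G t - U t))"
      by (intro mean_norm_mult_le ess_bounded_intros F G U)
    also have "\<dots> \<le> c * sqrt (energy (\<lambda>t. G t - U t))"
      using c by (intro mult_right_mono) (auto simp: energy_nonneg)
    also have "\<dots> < c * \<delta>" using small c by simp
    also have "\<dots> = \<epsilon>" using c by (simp add: \<delta>_def)
    finally show ?thesis unfolding FU by (simp add: dist_norm norm_minus_commute)
  qed
  show "\<forall>\<^sub>F S in finite_sets_at_top.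
      dist (\<Sum>k\<in>S. fcoeff F (- k) * fcoeff G k) (mean (\<lambda>t. F t * G t)) < \<epsilon>"
    unfolding eventually_finite_subsets_at_top using S0(1) close by (intro exI[of _ S0]) auto
qed

theorem fcoeff_mult_has_sum:
  assumes F: "ess_bounded F" and G: "ess_bounded G"
  shows "((\<lambda>k. fcoeff F (n - k) * fcoeff G k) has_sum fcoeff (\<lambda>t. F t * G t) n) UNIV"
proof -
  let ?F = "\<lambda>t. F t * wave (- n) t"
  have "fcoeff ?F (- k) = fcoeff F (n - k)" for k
    unfolding fcoeff_def by (simp add: mult.assoc wave_mult)
  moreover have "mean (\<lambda>t. ?F t * G t) = fcoeff (\<lambda>t. F t * G t) n"
    unfolding fcoeff_def by (simp add: mult_ac)
  ultimately show ?thesis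
    using parseval_has_sum[of ?F G] by (simp add: ess_bounded_intros F G ess_bounded_wave)
qed

section \<open>Laurent matrices\<close>

text \<open>
  Lebesgue measure is complete, so \<open>G\<close> inherits the measurability of \<open>F\<close>.
\<close>
lemma fcoeff_cong_AE:
  assumes F: "F \<in> borel_measurable circle_param" and eq: "AE t in circle_param. G t = F t"
  shows "fcoeff G k = fcoeff F k"
proof -
  obtain N where N: "N \<in> null_sets circle_param" "{t \<in> space circle_param. G t \<noteq> F t} \<subseteq> N"
    using eq unfolding eventually_ae_filter by blast
  then have "negligible N" by (auto simp: negligible_iff_null_sets null_sets_restrict_space)
  moreover have "F measurable_on {0..2*pi}"
    using F by (subst measurable_on_iff_borel_measurable) auto
  ultimately have "G measurable_on {0..2*pi}"
    using N(2) by (elim measurable_on_spike[rotated]) auto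
  then have G: "G \<in> borel_measurable circle_param"
    by (subst (asm) measurable_on_iff_borel_measurable) auto
  have w: "wave (- k) \<in> borel_measurable circle_param"
    using ess_bounded_wave by (simp add: ess_bounded_def)
  have "AE t in circle_param. G t * wave (- k) t = F t * wave (- k) t"
    using eq by eventually_elim simp
  then show ?thesis
    unfolding fcoeff_def by (rule mean_cong_AE[OF _ borel_measurable_times[OF G w] borel_measurable_times[OF F w]])
qed

lemma fourier_eq_fcoeff: "fourier f k = fcoeff (\<lambda>t. f (cis t)) k"
  by (simp add: fourier_def fcoeff_def mean_def wave_def scaleR_conv_of_real)

lemma mfourier_nth: "mfourier a k $ p $ q = fcoeff (\<lambda>t. a (cis t) $ p $ q) k"
  by (simp add: mfourier_def fourier_eq_fcoeff)

lemma Linf_entry: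
  assumes "a \<in> Linf"
  shows "ess_bounded (\<lambda>t. a (cis t) $ p $ q)"
proof -
  obtain C where C: "AE t in circle_param. norm (a (cis t)) \<le> C"
    and m: "(\<lambda>t. a (cis t)) \<in> borel_measurable circle_param"
    using assms by (auto simp: Linf_def)
  show ?thesis
  proof (rule ess_boundedI)
    show "(\<lambda>t. a (cis t) $ p $ q) \<in> borel_measurable circle_param"
      by (rule borel_measurable_continuous_on[OF _ m]) (intro continuous_intros)
    from C show "AE t in circle_param. norm (a (cis t) $ p $ q) \<le> C"
    proof eventually_elim
      case (elim t)
      have "norm (a (cis t) $ p $ q) \<le> norm (a (cis t))"
        by (rule order_trans[OF Finite_Cartesian_Product.norm_nth_le Finite_Cartesian_Product.norm_nth_le])
      with elim show ?case by simp
    qed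
  qed
qed

text \<open>
  The form of the Toeplitz matrix is the mean of \<open>F\<close> times two trigonometric polynomials whose mean squares are
  the squared norms of the two vectors.
\<close>
lemma bounded_by_toeplitz:
  assumes F: "ess_bounded F"
  obtains C where "bounded_by C (\<lambda>j k. fcoeff F (j - k))"
proof -
  obtain C where C: "0 \<le> C" "AE t in circle_param. norm (F t) \<le> C"
    using F by (rule ess_boundedE)
  have "bounded_by C (\<lambda>j k. fcoeff F (j - k))"
    unfolding bounded_by_def
  proof (intro conjI allI impI C(1))
    fix R S :: "int set" and x y :: "int \<Rightarrow> complex"
    assume R: "finite R" and S: "finite S"
    define X where "X t = (\<Sum>k\<in>S. x k * wave k t)" for t
    define Y where "Y t = (\<Sum>j\<in>uminus ` R. y (- j) * wave j t)" for t
    have X: "ess_bounded X" and Y: "ess_bounded Y"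
      unfolding X_def Y_def by (intro ess_bounded_intros ess_bounded_wave)+
    have Y': "Y t = (\<Sum>j\<in>R. y j * wave (- j) t)" for t
      unfolding Y_def by (subst sum.reindex) (simp_all add: inj_on_def)
    have eX: "energy X = (l2norm x S)\<^sup>2"
      unfolding X_def energy_trig[OF S] by (simp add: L2_set_def sum_nonneg)
    have "energy Y = (\<Sum>j\<in>uminus ` R. (norm (y (- j)))\<^sup>2)"
      unfolding Y_def by (rule energy_trig) (simp add: R)
    also have "\<dots> = (l2norm y R)\<^sup>2"
      by (subst sum.reindex) (simp_all add: inj_on_def L2_set_def sum_nonneg)
    finally have eY: "energy Y = (l2norm y R)\<^sup>2" .
    have w: "wave (- (j - k)) t = wave (- j) t * wave k t" for j k t by (simp add: wave_mult)
    have "(\<Sum>j\<in>R. \<Sum>k\<in>S. y j * fcoeff F (j - k) * x k) = (\<Sum>j\<in>R. \<Sum>k\<in>S. (y j * x k) * fcoeff F (j - k))"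
      by (simp only: mult_ac)
    also have "\<dots> = mean (\<lambda>t. \<Sum>j\<in>R. \<Sum>k\<in>S. (y j * x k) * (F t * wave (- (j - k)) t))"
      by (simp add: mean_sum mean_mult_right ess_bounded_intros F ess_bounded_wave fcoeff_def)
    also have "(\<lambda>t. \<Sum>j\<in>R. \<Sum>k\<in>S. (y j * x k) * (F t * wave (- (j - k)) t)) = (\<lambda>t. F t * (Y t * X t))"
    proof
      fix t
      have "Y t * X t = (\<Sum>j\<in>R. \<Sum>k\<in>S. (y j * wave (- j) t) * (x k * wave k t))"
        unfolding Y' X_def sum_product ..
      then show "(\<Sum>j\<in>R. \<Sum>k\<in>S. (y j * x k) * (F t * wave (- (j - k)) t)) = F t * (Y t * X t)"
        unfolding w by (simp only: sum_distrib_left mult_ac)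
    qed
    finally have "norm (\<Sum>j\<in>R. \<Sum>k\<in>S. y j * fcoeff F (j - k) * x k) \<le> mean (\<lambda>t. norm (F t * (Y t * X t)))"
      using norm_mean_le by metis
    also have "\<dots> \<le> mean (\<lambda>t. C * (norm (Y t) * norm (X t)))"
    proof (rule mean_mono)
      from C(2) show "AE t in circle_param. norm (F t * (Y t * X t)) \<le> C * (norm (Y t) * norm (X t))"
        by eventually_elim (simp add: norm_mult mult_right_mono)
    qed (intro ess_bounded_intros F X Y)+
    also have "\<dots> \<le> C * (sqrt (energy Y) * sqrt (energy X))"
      unfolding mean_mult_right by (intro mult_left_mono mean_norm_mult_le X Y C(1))
    also have "\<dots> = C * l2norm y R * l2norm x S" by (simp add: eX eY L2_set_nonneg)
    finally show "norm (\<Sum>j\<in>R. \<Sum>k\<in>S. y j * fcoeff F (j - k) * x k) \<le> C * l2norm y R * l2norm x S" .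
  qed
  then show ?thesis by (rule that)
qed

lemma bounded_by_sum:
  assumes "finite X" "\<And>x. x \<in> X \<Longrightarrow> \<exists>C. bounded_by C (M x)"
  shows "\<exists>C. bounded_by C (\<lambda>i j. \<Sum>x\<in>X. M x i j)"
  using assms
proof (induction X rule: finite_induct)
  case empty
  show ?case using bounded_by_indicator[of "{}"] by auto
next
  case (insert x X)
  then obtain C D where "bounded_by C (M x)" "bounded_by D (\<lambda>i j. \<Sum>x\<in>X. M x i j)" by blast
  from bounded_by_add[OF this] show ?case using insert.hyps by auto
qed

text \<open>
  A matrix with indices in a product with a finite type is a finite sum of such pieces.
\<close>
lemma bounded_by_single_block:
  assumes m: "bounded_by C m"
  shows "bounded_by C (\<lambda>i j. if snd i = p \<and> snd j = q then m (fst i) (fst j) else 0)"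
  unfolding bounded_by_def
proof (intro conjI allI impI)
  show "0 \<le> C" by (rule bounded_byD(2)[OF m])
  fix R S :: "('a \<times> 'b) set" and x y :: "'a \<times> 'b \<Rightarrow> complex"
  assume R: "finite R" and S: "finite S"
  have inj: "inj_on (\<lambda>j. (j, r)) X" for r :: 'b and X :: "'a set" by (simp add: inj_on_def)
  have slice: "(\<Sum>i\<in>T. if snd i = r then g i else 0) = (\<Sum>j\<in>(\<lambda>j. (j, r)) -` T. g (j, r))"
    if T: "finite T" for T :: "('a \<times> 'b) set" and r :: 'b and g :: "'a \<times> 'b \<Rightarrow> 'c::comm_monoid_add"
  proof -
    have "(\<Sum>i\<in>T. if snd i = r then g i else 0) = (\<Sum>i\<in>(\<lambda>j. (j, r)) ` ((\<lambda>j. (j, r)) -` T). g i)"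
      using T by (intro sum.mono_neutral_cong_right) auto
    also have "\<dots> = (\<Sum>j\<in>(\<lambda>j. (j, r)) -` T. g (j, r))"
      by (subst sum.reindex[OF inj]) (simp add: o_def)
    finally show ?thesis .
  qed
  have fin: "finite ((\<lambda>j. (j, r)) -` T)" if "finite T" for T :: "('a \<times> 'b) set" and r :: 'b
    using that by (intro finite_vimageI) (auto simp: inj_def)
  have norm_slice: "l2norm (\<lambda>j. z (j, r)) ((\<lambda>j. (j, r)) -` T) \<le> l2norm z T"
    if T: "finite T" for T :: "('a \<times> 'b) set" and r :: 'b and z :: "'a \<times> 'b \<Rightarrow> complex"
    unfolding L2_set_def slice[OF T, of r "\<lambda>i. (norm (z i))\<^sup>2", symmetric]
    by (intro real_sqrt_le_mono sum_mono) simp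
  have "(\<Sum>i\<in>R. \<Sum>j\<in>S. y i * (if snd i = p \<and> snd j = q then m (fst i) (fst j) else 0) * x j) =
      (\<Sum>i\<in>R. if snd i = p then (\<Sum>j\<in>S. if snd j = q then y i * m (fst i) (fst j) * x j else 0) else 0)"
    by (intro sum.cong refl) (auto intro: sum.cong)
  also have "\<dots> = (\<Sum>i\<in>(\<lambda>j. (j, p)) -` R. \<Sum>j\<in>(\<lambda>j. (j, q)) -` S. y (i, p) * m i j * x (j, q))"
    by (simp add: slice R S)
  also have "norm \<dots> \<le> C * l2norm (\<lambda>j. y (j, p)) ((\<lambda>j. (j, p)) -` R) * l2norm (\<lambda>j. x (j, q)) ((\<lambda>j. (j, q)) -` S)"
    by (intro bounded_byD(1)[OF m] fin R S)
  also have "\<dots> \<le> C * l2norm y R * l2norm x S"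
    by (intro mult_mono norm_slice R S bounded_byD(2)[OF m] mult_nonneg_nonneg L2_set_nonneg order_refl)
  finally show "norm (\<Sum>i\<in>R. \<Sum>j\<in>S. y i * (if snd i = p \<and> snd j = q then m (fst i) (fst j) else 0) * x j)
      \<le> C * l2norm y R * l2norm x S" .
qed

text \<open>
  For \<open>a \<in> Linf\<close> the matrix is bounded, so that \<open>Bmat\<close> is applied within its domain; see \<open>entry_laurent\<close>.
\<close>
definition laurent :: "(complex \<Rightarrow> complex^'n^'n) \<Rightarrow> (int \<times> 'n) bmat" where
  "laurent a = Bmat (\<lambda>i j. mfourier a (fst i - fst j) $ snd i $ snd j)"

lemma entry_laurent:
  fixes a :: "complex \<Rightarrow> complex^'n^'n"
  assumes a: "a \<in> Linf"
  shows "entry (laurent a) i j = mfourier a (fst i - fst j) $ snd i $ snd j"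
proof -
  let ?M = "\<lambda>i j. mfourier a (fst i - fst j) $ snd i $ snd j"
  let ?B = "\<lambda>(p, q) i j. if snd i = p \<and> snd j = q then fcoeff (\<lambda>t. a (cis t) $ p $ q) (fst i - fst j) else 0"
  have "\<exists>C. bounded_by C (\<lambda>i j. \<Sum>x\<in>UNIV. ?B x i j)"
  proof (rule bounded_by_sum)
    fix x :: "'n \<times> 'n"
    obtain p q where x: "x = (p, q)" by force
    obtain C where "bounded_by C (\<lambda>j k. fcoeff (\<lambda>t. a (cis t) $ p $ q) (j - k))"
      using bounded_by_toeplitz[OF Linf_entry[OF a]] .
    from bounded_by_single_block[OF this, of p q] show "\<exists>C. bounded_by C (?B x)"
      by (auto simp: x)
  qed simp
  also have "(\<lambda>i j. \<Sum>x\<in>UNIV. ?B x i j) = ?M"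
  proof (intro ext)
    fix i j :: "int \<times> 'n"
    have "(\<Sum>x\<in>UNIV. ?B x i j) = (\<Sum>x\<in>{(snd i, snd j)}. ?B x i j)"
      by (rule sum.mono_neutral_right) (auto split: if_splits)
    then show "(\<Sum>x\<in>UNIV. ?B x i j) = ?M i j" by (simp add: mfourier_nth)
  qed
  finally show ?thesis unfolding laurent_def by (subst Bmat_inverse) auto
qed

lemma infsum_UNIV_prod_finite:
  fixes f :: "'i \<times> 'n::finite \<Rightarrow> complex"
  assumes "f summable_on UNIV"
  shows "infsum f UNIV = (\<Sum>\<^sub>\<infinity>l. \<Sum>r\<in>UNIV. f (l, r))"
  using infsum_Sigma'_banach[of "\<lambda>l r. f (l, r)" UNIV "\<lambda>_. UNIV"] assms by simp

text \<open>
  The convolution theorem in matrix form: the Laurent matrix of a product of symbols is the product of the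
  Laurent matrices.
\<close>
lemma mfourier_mult:
  fixes a b c :: "complex \<Rightarrow> complex^'n^'n"
  assumes a: "a \<in> Linf" and b: "b \<in> Linf"
    and c: "AE t in circle_param. c (cis t) = a (cis t) ** b (cis t)"
  shows "mfourier c (fst i - fst j) $ snd i $ snd j = entry (laurent a * laurent b) i j"
proof -
  obtain j1 p where i: "i = (j1, p)" by force
  obtain k1 q where j: "j = (k1, q)" by force
  let ?a = "\<lambda>p r t. a (cis t) $ p $ r"
  let ?b = "\<lambda>r q t. b (cis t) $ r $ q"
  note ab = Linf_entry[OF a] Linf_entry[OF b]
  have eb: "ess_bounded (\<lambda>t. \<Sum>r\<in>UNIV. ?a p r t * ?b r q t)"
    by (intro ess_bounded_intros ab)
  have hs: "((\<lambda>l. fcoeff (?a p r) (j1 - l) * fcoeff (?b r q) (l - k1)) has_sum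
      fcoeff (\<lambda>t. ?a p r t * ?b r q t) (j1 - k1)) UNIV" for r
  proof -
    have "bij_betw (\<lambda>l. l - k1) UNIV UNIV"
      by (rule bij_betwI[of _ _ _ "\<lambda>l. l + k1"]) auto
    from has_sum_reindex_bij_betw[OF this, THEN iffD2, OF fcoeff_mult_has_sum[OF ab(1)[of p r] ab(2)[of r q], of "j1 - k1"]]
    show ?thesis by (simp add: algebra_simps)
  qed
  have "mfourier c (fst i - fst j) $ snd i $ snd j = fcoeff (\<lambda>t. \<Sum>r\<in>UNIV. ?a p r t * ?b r q t) (j1 - k1)"
    unfolding mfourier_nth i j fst_conv snd_conv
  proof (rule fcoeff_cong_AE)
    show "(\<lambda>t. \<Sum>r\<in>UNIV. ?a p r t * ?b r q t) \<in> borel_measurable circle_param"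
      using eb by (simp add: ess_bounded_def)
    from c show "AE t in circle_param. c (cis t) $ p $ q = (\<Sum>r\<in>UNIV. ?a p r t * ?b r q t)"
      by eventually_elim (simp add: matrix_matrix_mult_def)
  qed
  also have "\<dots> = (\<Sum>r\<in>UNIV. fcoeff (\<lambda>t. ?a p r t * ?b r q t) (j1 - k1))"
    unfolding fcoeff_def sum_distrib_right
    by (intro mean_sum ess_bounded_intros ab ess_bounded_wave)
  also have "\<dots> = (\<Sum>r\<in>UNIV. \<Sum>\<^sub>\<infinity>l. fcoeff (?a p r) (j1 - l) * fcoeff (?b r q) (l - k1))"
    using infsumI[OF hs] by simp
  also have "\<dots> = (\<Sum>\<^sub>\<infinity>l. \<Sum>r\<in>UNIV. fcoeff (?a p r) (j1 - l) * fcoeff (?b r q) (l - k1))"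
    using has_sum_imp_summable[OF hs] by (intro infsum_finite_sum[symmetric]) auto
  also have "\<dots> = (\<Sum>\<^sub>\<infinity>l. \<Sum>r\<in>UNIV. entry (laurent a) i (l, r) * entry (laurent b) (l, r) j)"
    by (simp add: entry_laurent a b mfourier_nth i j)
  also have "\<dots> = entry (laurent a * laurent b) i j"
    unfolding times_bmat.rep_eq by (rule infsum_UNIV_prod_finite[OF entry_mult_summable, symmetric])
  finally show ?thesis .
qed

lemma mfourier_mat_1: "mfourier (\<lambda>z. mat 1) k $ p $ q = of_bool (k = 0 \<and> p = q)"
proof -
  have "fcoeff (\<lambda>t. of_bool (p = q)) k = of_bool (p = q) * mean (wave (- k))"
    unfolding fcoeff_def mean_mult_right ..
  then show ?thesis by (auto simp: mfourier_nth mat_def mean_wave fcoeff_def)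
qed

lemma laurent_mult_eq_1:
  assumes "a \<in> Linf" "b \<in> Linf" "AE t in circle_param. a (cis t) ** b (cis t) = mat 1"
  shows "laurent a * laurent b = 1"
proof (rule entry_inject[THEN iffD1], intro ext)
  fix i j
  have "entry (laurent a * laurent b) i j = mfourier (\<lambda>z. mat 1) (fst i - fst j) $ snd i $ snd j"
    using assms by (intro mfourier_mult[symmetric]) (auto elim: eventually_mono)
  then show "entry (laurent a * laurent b) i j = entry 1 i j"
    by (auto simp: mfourier_mat_1 one_bmat.rep_eq prod_eq_iff)
qed

lemma laurent_minv:
  assumes u: "u \<in> Linf" "minv u \<in> Linf" and inv: "AE t in circle_param. invertible (u (cis t))"
  shows "laurent u * laurent (minv u) = 1" "laurent (minv u) * laurent u = 1"
proof -
  have "A ** matrix_inv A = mat 1 \<and> matrix_inv A ** A = mat 1" if "invertible A" for A :: "complex^'n^'n"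
    using that unfolding invertible_def matrix_inv_def by (rule someI_ex)
  with inv have "AE t in circle_param. u (cis t) ** minv u (cis t) = mat 1"
    "AE t in circle_param. minv u (cis t) ** u (cis t) = mat 1"
    unfolding minv_def by (auto elim: eventually_mono)
  then show "laurent u * laurent (minv u) = 1" "laurent (minv u) * laurent u = 1"
    using u by (auto intro: laurent_mult_eq_1)
qed

section \<open>Hardy spaces and the mean of a determinant\<close>

text \<open>
  With \<open>\<sigma> = 1\<close> only nonnegative frequencies occur, with \<open>\<sigma> = -1\<close> only nonpositive ones; the parameter treats both
  Hardy spaces at once.
\<close>
definition hardy :: "int \<Rightarrow> (real \<Rightarrow> complex) \<Rightarrow> bool" where
  "hardy \<sigma> F \<longleftrightarrow> ess_bounded F \<and> (\<forall>k. \<sigma> * k < 0 \<longrightarrow> fcoeff F k = 0)"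

lemma hardy_const: "hardy \<sigma> (\<lambda>t. c)" "fcoeff (\<lambda>t. c) 0 = c"
  by (auto simp: hardy_def ess_bounded_const fcoeff_def mean_mult_right mean_wave mean_const)

text \<open>
  At an index \<open>n\<close> with \<open>\<sigma> n < 0\<close> every term of the convolution vanishes, and at index \<open>0\<close> only the product of the zeroth
  coefficients remains: taking the mean is multiplicative on a Hardy space.
\<close>
lemma hardy_mult:
  assumes F: "hardy \<sigma> F" and G: "hardy \<sigma> G" and \<sigma>: "\<sigma> \<noteq> 0"
  shows "hardy \<sigma> (\<lambda>t. F t * G t)" "fcoeff (\<lambda>t. F t * G t) 0 = fcoeff F 0 * fcoeff G 0"
proof -
  have hs: "((\<lambda>k. fcoeff F (n - k) * fcoeff G k) has_sum fcoeff (\<lambda>t. F t * G t) n) UNIV" for n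
    using F G by (intro fcoeff_mult_has_sum) (simp_all add: hardy_def)
  have vanish: "fcoeff F (n - k) * fcoeff G k = 0" if "\<sigma> * n \<le> 0" "n \<noteq> 0 \<or> k \<noteq> 0" for n k
  proof (cases "\<sigma> * k < 0")
    case False
    have "\<sigma> * n < 0 \<or> 0 < \<sigma> * k"
      using that False \<sigma> by (metis linorder_neqE_linordered_idom mult_eq_0_iff not_le)
    then have "\<sigma> * (n - k) < 0" using that False by (auto simp: algebra_simps)
    then show ?thesis using F by (simp add: hardy_def)
  qed (use G in \<open>simp add: hardy_def\<close>)
  have "fcoeff (\<lambda>t. F t * G t) n = 0" if "\<sigma> * n < 0" for n
  proof -
    have "n \<noteq> 0" using that by auto
    then have "(\<lambda>k. fcoeff F (n - k) * fcoeff G k) = (\<lambda>k. 0)"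
      using vanish[of n] that by auto
    then show ?thesis using infsumI[OF hs[of n]] by simp
  qed
  then show "hardy \<sigma> (\<lambda>t. F t * G t)"
    using F G by (auto simp: hardy_def intro: ess_bounded_mult)
  have "fcoeff (\<lambda>t. F t * G t) 0 = (\<Sum>\<^sub>\<infinity>k. fcoeff F (0 - k) * fcoeff G k)"
    using infsumI[OF hs[of 0]] by simp
  also have "\<dots> = (\<Sum>\<^sub>\<infinity>k\<in>{0}. fcoeff F (0 - k) * fcoeff G k)"
    by (rule infsum_cong_neutral) (use vanish[of 0] in auto)
  finally show "fcoeff (\<lambda>t. F t * G t) 0 = fcoeff F 0 * fcoeff G 0" by simp
qed

lemma hardy_prod:
  assumes "finite X" "\<And>x. x \<in> X \<Longrightarrow> hardy \<sigma> (F x)" "\<sigma> \<noteq> 0"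
  shows "hardy \<sigma> (\<lambda>t. \<Prod>x\<in>X. F x t) \<and> fcoeff (\<lambda>t. \<Prod>x\<in>X. F x t) 0 = (\<Prod>x\<in>X. fcoeff (F x) 0)"
  using assms(1,2)
proof (induction X rule: finite_induct)
  case (insert x X)
  then show ?case
    using hardy_mult[of \<sigma> "F x" "\<lambda>t. \<Prod>x\<in>X. F x t"] \<open>\<sigma> \<noteq> 0\<close> by simp
qed (simp add: hardy_const)

text \<open>
  The determinant is a polynomial in the entries, and taking the mean is multiplicative on the Hardy space.
\<close>
lemma fourier_det_0:
  fixes v :: "complex \<Rightarrow> complex^'n^'n"
  assumes v: "\<And>p q. hardy \<sigma> (\<lambda>t. v (cis t) $ p $ q)" and \<sigma>: "\<sigma> \<noteq> 0"
  shows "fourier (\<lambda>z. det (v z)) 0 = det (mfourier v 0)"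
proof -
  have h: "hardy \<sigma> (\<lambda>t. \<Prod>p\<in>UNIV. v (cis t) $ p $ \<pi> p)"
    "fcoeff (\<lambda>t. \<Prod>p\<in>UNIV. v (cis t) $ p $ \<pi> p) 0 = (\<Prod>p\<in>UNIV. mfourier v 0 $ p $ \<pi> p)" for \<pi>
    using hardy_prod[of UNIV \<sigma> "\<lambda>p t. v (cis t) $ p $ \<pi> p"] v \<sigma> by (simp_all add: mfourier_nth)
  have "fourier (\<lambda>z. det (v z)) 0 =
      mean (\<lambda>t. \<Sum>\<pi> | \<pi> permutes UNIV. of_int (sign \<pi>) * (\<Prod>p\<in>UNIV. v (cis t) $ p $ \<pi> p))"
    by (simp add: fourier_eq_fcoeff fcoeff_def det_def)
  also have "\<dots> = (\<Sum>\<pi> | \<pi> permutes UNIV. of_int (sign \<pi>) * mean (\<lambda>t. \<Prod>p\<in>UNIV. v (cis t) $ p $ \<pi> p))"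
    using h(1) unfolding mean_mult_right[symmetric]
    by (intro mean_sum ess_bounded_intros) (simp add: hardy_def)
  also have "\<dots> = det (mfourier v 0)"
    using h(2) by (simp add: fcoeff_def det_def)
  finally show ?thesis .
qed

section \<open>The algebra of the two factorizations\<close>

text \<open>
  The purely algebraic core.  Here \<open>U V = R S\<close> is the symbol \<open>a\<close>, \<open>S V'\<close> is \<open>b\<close> and \<open>U' R\<close> is \<open>c\<close>.  From
  \<open>S V' U' R = 1\<close> one gets \<open>K = P - P S V' P U' R P\<close>, and multiplying the subtracted term by \<open>A\<close> cancels
  its factors one after the other: triangularity removes the projections between \<open>R\<close> and \<open>R'\<close>, \<open>U'\<close> and \<open>U\<close>,
  \<open>V'\<close> and \<open>V\<close>, \<open>S\<close> and \<open>S'\<close>.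
\<close>
lemma wiener_hopf_algebra:
  fixes P R R' S S' U U' V V' :: "'a::ring_1"
  defines "A \<equiv> P * R' * P * U * V * P * S' * P"
    and "K \<equiv> P * S * V' * (1 - P) * U' * R * P"
  assumes P: "P * P = P"
    and lower: "P * R' * P = R' * P" "P * V * P = V * P"
    and upper: "P * S * P = P * S" "P * S' * P = P * S'" "P * U' * P = P * U'"
    and R: "R * R' = 1" "R' * R = 1" and S: "S * S' = 1" "S' * S = 1"
    and U: "U * U' = 1" "U' * U = 1" and V: "V * V' = 1" "V' * V = 1"
    and UV: "U * V = R * S"
  shows "A = P + K * A" "P * U * V * P = P * R * P * A * P * S * P"
proof -
  have cancel: "X * (X' * x) = x" if "X * X' = 1" for X X' x :: 'a
    using that by (simp flip: mult.assoc)
  have absorb: "P * (X * (P * x)) = X * (P * x)" "P * (X * P) = X * P"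
    if "P * X * P = X * P" for X x
    using that by (simp_all flip: mult.assoc)
  have absorb': "P * (X * (P * x)) = P * (X * x)" "P * (X * P) = P * X"
    if "P * X * P = P * X" for X x
    using that by (simp_all flip: mult.assoc)
  have PP: "P * (P * x) = P * x" for x using P by (simp flip: mult.assoc)
  note simps = mult.assoc P PP absorb[OF lower(1)] absorb[OF lower(2)] absorb'[OF upper(1)]
    absorb'[OF upper(2)] absorb'[OF upper(3)] cancel[OF R(1)] cancel[OF R(2)] cancel[OF S(1)] cancel[OF S(2)]
    cancel[OF U(1)] cancel[OF U(2)] cancel[OF V(1)] cancel[OF V(2)] R S U V
  \<comment> \<open>this is \<open>b c = I\<close>\<close>
  have "S * V' * U' * R = R' * (R * S) * V' * U' * R" by (simp add: simps)
  also have "\<dots> = 1" unfolding UV[symmetric] by (simp add: simps)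
  finally have "P * (S * V' * U' * R) * P = P" by (simp add: P)
  then have K: "K = P - P * S * V' * P * U' * R * P"
    unfolding K_def by (simp add: mult.assoc left_diff_distrib right_diff_distrib)
  have inverse: "P * S * V' * P * U' * R * P * A = P" unfolding A_def by (simp add: simps)
  have "P * A = A" unfolding A_def by (simp add: simps)
  then show "A = P + K * A" unfolding K left_diff_distrib inverse by simp
  show "P * U * V * P = P * R * P * A * P * S * P" unfolding A_def by (simp add: simps)
qed

lemma one_minus_restrictor: "1 - restrictor X = restrictor (- X)"
  by transfer (auto simp: fun_eq_iff)

lemma entry_mult_restrictor_mult:
  assumes "finite X"
  shows "entry (M * restrictor X * N) i j = (\<Sum>k\<in>X. entry M i k * entry N k j)"
proof -
  have "entry (M * restrictor X * N) i j = (\<Sum>\<^sub>\<infinity>k\<in>X. entry M i k * entry N k j)"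
    unfolding times_bmat.rep_eq[of "M * restrictor X"] entry_mult_restrictor
    by (rule infsum_cong_neutral) auto
  then show ?thesis using assms by simp
qed

abbreviation nonneg_part :: "(int \<times> 'n) bmat" where
  "nonneg_part \<equiv> restrictor {i. 0 \<le> fst i}"

abbreviation section_part :: "nat \<Rightarrow> (int \<times> 'n) bmat" where
  "section_part n \<equiv> restrictor {i. 0 \<le> fst i \<and> fst i < int n}"

lemma laurent_lower:
  assumes "u \<in> Hinf_plus"
  shows "nonneg_part * laurent u * nonneg_part = laurent u * nonneg_part"
    "section_part n * laurent u * nonneg_part = section_part n * laurent u * section_part n"
proof -
  have u: "u \<in> Linf" and coeff: "\<forall>k>0. mfourier u (- k) = 0" using assms by (auto simp: Hinf_plus_def)
  have zero: "entry (laurent u) i j = 0" if "fst i < fst j" for i j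
    using that coeff[rule_format, of "fst j - fst i"] by (simp add: entry_laurent[OF u])
  show "nonneg_part * laurent u * nonneg_part = laurent u * nonneg_part"
    "section_part n * laurent u * nonneg_part = section_part n * laurent u * section_part n"
    by (rule entry_inject[THEN iffD1], force simp: fun_eq_iff entry_restrictor_mult entry_mult_restrictor intro: zero)+
qed

lemma laurent_upper:
  assumes "u \<in> Hinf_minus"
  shows "nonneg_part * laurent u * nonneg_part = nonneg_part * laurent u"
    "nonneg_part * laurent u * section_part n = section_part n * laurent u * section_part n"
proof -
  have u: "u \<in> Linf" and coeff: "\<forall>k>0. mfourier u k = 0" using assms by (auto simp: Hinf_minus_def)
  have zero: "entry (laurent u) i j = 0" if "fst j < fst i" for i j
    using that coeff[rule_format, of "fst i - fst j"] by (simp add: entry_laurent[OF u])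
  show "nonneg_part * laurent u * nonneg_part = nonneg_part * laurent u"
    "nonneg_part * laurent u * section_part n = section_part n * laurent u * section_part n"
    by (rule entry_inject[THEN iffD1], force simp: fun_eq_iff entry_restrictor_mult entry_mult_restrictor intro: zero)+
qed

section \<open>Hilbert-Schmidt corners of Laurent matrices\<close>

text \<open>
  A coefficient of index \<open>d > 0\<close> occurs in exactly \<open>d\<close> blocks of the corner with \<open>j \<ge> 0 > k\<close>, which is where
  the weight \<open>\<bar>d\<bar> + 1\<close> of the Krein algebra is needed.
\<close>
lemma hilbert_schmidt_corner:
  fixes M :: "(int \<times> 'n::finite) bmat"
  assumes sm: "(\<lambda>d. (\<bar>of_int d\<bar> + 1) * w d) summable_on UNIV" and w: "\<And>d. 0 \<le> (w d :: real)"
    and le: "\<And>i j. (norm (entry M i j))\<^sup>2 \<le> w (fst i - fst j)"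
  shows "hilbert_schmidt (nonneg_part * M * restrictor (- {i. 0 \<le> fst i}))"
proof -
  let ?N = "real CARD('n)"
  let ?X = "{(i, j). 0 \<le> fst i \<and> fst j < 0} :: ((int \<times> 'n) \<times> (int \<times> 'n)) set"
  let ?B = "\<lambda>d::int. {0..<d} \<times> (UNIV :: ('n \<times> 'n) set)"
  have "(\<lambda>x. w (fst x)) summable_on Sigma UNIV ?B"
  proof (rule summable_on_SigmaI)
    show "((\<lambda>y. w (fst (d, y))) has_sum real (card (?B d)) * w d) (?B d)" for d
      by (rule has_sum_finiteI) simp_all
    have "(\<lambda>d. ?N\<^sup>2 * ((\<bar>of_int d\<bar> + 1) * w d)) summable_on UNIV"
      by (intro summable_on_cmult_right sm)
    then show "(\<lambda>d. real (card (?B d)) * w d) summable_on UNIV"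
    proof (rule summable_on_comparison_test)
      fix d :: int
      have "real (card (?B d)) = real (nat d) * ?N\<^sup>2"
        by (simp add: card_cartesian_product power2_eq_square)
      also have "\<dots> * w d \<le> ((\<bar>of_int d\<bar> + 1) * ?N\<^sup>2) * w d"
        by (intro mult_right_mono w) auto
      finally show "real (card (?B d)) * w d \<le> ?N\<^sup>2 * ((\<bar>of_int d\<bar> + 1) * w d)" by (simp only: mult_ac)
    qed (simp add: w)
  qed (simp add: w)
  moreover have "bij_betw (\<lambda>x. (fst (fst x) - fst (snd x), fst (fst x), snd (fst x), snd (snd x))) ?X (Sigma UNIV ?B)"
    by (rule bij_betwI[of _ _ _ "\<lambda>x. ((fst (snd x), fst (snd (snd x))), (fst (snd x) - fst x, snd (snd (snd x))))"])
       auto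
  ultimately have "(\<lambda>x. w (fst (fst x) - fst (snd x))) summable_on ?X"
    using summable_on_reindex_bij_betw[of _ ?X "Sigma UNIV ?B" "\<lambda>x. w (fst x)"] by fastforce
  then have "(\<lambda>(i, j). (norm (entry M i j))\<^sup>2) summable_on ?X"
    by (rule summable_on_comparison_test) (simp_all add: case_prod_unfold le)
  moreover have "(\<lambda>(i, j). (norm (entry M i j))\<^sup>2) summable_on ?X \<longleftrightarrow>
      (\<lambda>(i, j). (norm (entry (nonneg_part * M * restrictor (- {i. 0 \<le> fst i})) i j))\<^sup>2) summable_on UNIV"
    by (rule summable_on_cong_neutral) (auto simp: entry_restrictor_mult entry_mult_restrictor not_le)
  ultimately show ?thesis by (simp add: hilbert_schmidt_def)
qed

lemma norm_mfourier_entry_le: "(norm (mfourier u k $ p $ q))\<^sup>2 \<le> (norm (mfourier u k))\<^sup>2"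
  by (intro power_mono norm_ge_zero order_trans[OF Finite_Cartesian_Product.norm_nth_le Finite_Cartesian_Product.norm_nth_le])

lemma K2_half_hilbert_schmidt:
  assumes u: "u \<in> K2_half"
  shows "hilbert_schmidt (nonneg_part * laurent u * restrictor (- {i. 0 \<le> fst i}))"
    "hilbert_schmidt (restrictor (- {i. 0 \<le> fst i}) * laurent u * nonneg_part)"
proof -
  have L: "u \<in> Linf" and sm: "(\<lambda>k::int. (\<bar>of_int k\<bar> + 1) * (norm (mfourier u k))\<^sup>2) summable_on UNIV"
    using u by (auto simp: K2_half_def)
  show "hilbert_schmidt (nonneg_part * laurent u * restrictor (- {i. 0 \<le> fst i}))"
    by (rule hilbert_schmidt_corner[OF sm]) (simp_all add: entry_laurent L norm_mfourier_entry_le)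
  have "bij (uminus :: int \<Rightarrow> int)" by (rule bij_uminus)
  from summable_on_reindex_bij_betw[OF this, THEN iffD2, OF sm]
  have sm': "(\<lambda>k::int. (\<bar>of_int k\<bar> + 1) * (norm (mfourier u (- k)))\<^sup>2) summable_on UNIV" by simp
  have T: "transposed (restrictor X) = restrictor X" for X :: "(int \<times> 'a) set"
    by transfer (auto simp: fun_eq_iff)
  have "(norm (entry (transposed (laurent u)) i j))\<^sup>2 \<le> (norm (mfourier u (- (fst i - fst j))))\<^sup>2" for i j
    by (simp add: transposed.rep_eq entry_laurent L norm_mfourier_entry_le)
  from hilbert_schmidt_corner[OF sm' _ this]
  have "hilbert_schmidt (transposed (restrictor (- {i. 0 \<le> fst i}) * laurent u * nonneg_part))"
    by (simp add: transposed_mult T mult.assoc)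
  then show "hilbert_schmidt (restrictor (- {i. 0 \<le> fst i}) * laurent u * nonneg_part)"
    by (simp add: hilbert_schmidt_transposed)
qed

section \<open>Block triangular Toeplitz determinants\<close>

text \<open>
  Split off the last block row and column.
\<close>
lemma det_on_block_toeplitz_lower:
  fixes w :: "int \<Rightarrow> complex^'n^'n"
  assumes w: "\<And>k. k < 0 \<Longrightarrow> w k = 0"
  shows "det_on ({..<n} \<times> UNIV) (\<lambda>i j. w (int (fst i) - int (fst j)) $ snd i $ snd j) = det (w 0) ^ n"
proof (induction n)
  case 0
  show ?case by (simp add: det_on_def)
next
  case (Suc n)
  let ?A = "\<lambda>i j. w (int (fst i) - int (fst j)) $ snd i $ snd j"
  have "det_on ({..<Suc n} \<times> UNIV) ?A = det_on ({..<n} \<times> UNIV \<union> Pair n ` UNIV) ?A"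
    by (rule arg_cong[where f = "\<lambda>F. det_on F ?A"]) (auto simp: less_Suc_eq)
  also have "\<dots> = det_on ({..<n} \<times> UNIV) ?A * det_on (Pair n ` UNIV) ?A"
    by (rule det_on_block_triangular) (auto simp: w)
  also have "det_on (Pair n ` UNIV) ?A = det (w 0)"
    by (subst det_on_reindex) (simp_all add: inj_on_def det_on_UNIV)
  finally show ?case by (simp add: Suc)
qed

lemma det_on_block_toeplitz_upper:
  fixes w :: "int \<Rightarrow> complex^'n^'n"
  assumes w: "\<And>k. 0 < k \<Longrightarrow> w k = 0"
  shows "det_on ({..<n} \<times> UNIV) (\<lambda>i j. w (int (fst i) - int (fst j)) $ snd i $ snd j) = det (w 0) ^ n"
proof -
  let ?w = "\<lambda>k. Finite_Cartesian_Product.transpose (w (- k))"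
  have "?w k = 0" if "k < 0" for k
    using w[of "- k"] that by (simp add: Finite_Cartesian_Product.transpose_def vec_eq_iff)
  from det_on_block_toeplitz_lower[where w = ?w and n = n, OF this]
  have "det_on ({..<n} \<times> UNIV) (\<lambda>i j. w (int (fst j) - int (fst i)) $ snd j $ snd i) = det (w 0) ^ n"
    by (simp add: Finite_Cartesian_Product.transpose_def[abs_def] det_transpose[unfolded Finite_Cartesian_Product.transpose_def])
  then show ?thesis
    using det_on_transpose[of "{..<n} \<times> UNIV" "\<lambda>i j. w (int (fst i) - int (fst j)) $ snd i $ snd j"] by simp
qed

section \<open>Entries of the Hankel operators\<close>

lemma infsum_vec_nth:
  fixes f :: "'i \<Rightarrow> complex^'n"
  assumes "\<And>p. (\<lambda>l. f l $ p) summable_on X"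
  shows "infsum f X $ p = (\<Sum>\<^sub>\<infinity>l\<in>X. f l $ p)"
proof -
  have "(f has_sum (\<chi> p. \<Sum>\<^sub>\<infinity>l\<in>X. f l $ p)) X"
    unfolding has_sum_def
    by (rule vec_tendstoI) (simp add: sum_component infsum_tendsto assms)
  then show ?thesis by (simp add: infsumI)
qed

lemma block_op_basis_vec: "block_op A (basis_vec i) j = column (snd i) (A j (fst i))"
proof -
  have "block_op A (basis_vec i) j = (\<Sum>\<^sub>\<infinity>k\<in>{fst i}. A j k *v basis_vec i k)"
    unfolding block_op_def by (rule infsum_cong_neutral) (auto simp: basis_vec_def)
  also have "\<dots> = A j (fst i) *v axis (snd i) 1" by (simp add: basis_vec_def)
  also have "\<dots> = column (snd i) (A j (fst i))"
    by (simp add: vec_eq_iff matrix_vector_mult_def column_def axis_def if_distrib[of "(*) _"] cong: if_cong)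
  finally show ?thesis .
qed

lemma op_entry_hankel:
  assumes "\<And>p. (\<lambda>l. \<Sum>r\<in>UNIV. mfourier b (int (fst i) + int l + 1) $ p $ r *
      mfourier c (- int l - int (fst j) - 1) $ r $ snd j) summable_on UNIV"
  shows "op_entry (hankel b \<circ> hankel_tilde c) i j =
    (\<Sum>\<^sub>\<infinity>l. \<Sum>r\<in>UNIV. mfourier b (int (fst i) + int l + 1) $ snd i $ r *
      mfourier c (- int l - int (fst j) - 1) $ r $ snd j)"
proof -
  have inner: "hankel_tilde c (basis_vec j) l = column (snd j) (mfourier c (- int l - int (fst j) - 1))" for l
    by (simp add: hankel_tilde_def block_op_basis_vec)
  have "op_entry (hankel b \<circ> hankel_tilde c) i j =
      (\<Sum>\<^sub>\<infinity>l. mfourier b (int (fst i) + int l + 1) *v column (snd j) (mfourier c (- int l - int (fst j) - 1))) $ snd i"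
    unfolding inner[symmetric] by (simp add: op_entry_def hankel_def block_op_def)
  also have "\<dots> = (\<Sum>\<^sub>\<infinity>l. (mfourier b (int (fst i) + int l + 1) *v column (snd j) (mfourier c (- int l - int (fst j) - 1))) $ snd i)"
    using assms by (intro infsum_vec_nth) (simp add: matrix_vector_mult_def column_def)
  finally show ?thesis by (simp add: matrix_vector_mult_def column_def)
qed

lemma op_entry_Qproj:
  "op_entry (Qproj n \<circ> hankel b \<circ> hankel_tilde c \<circ> Qproj n) i j =
    (if n \<le> fst i \<and> n \<le> fst j then op_entry (hankel b \<circ> hankel_tilde c) i j else 0)"
proof -
  have "Qproj n (basis_vec j) = (if n \<le> fst j then basis_vec j else (\<lambda>_. 0))"
    by (auto simp: Qproj_def basis_vec_def fun_eq_iff)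
  moreover have "block_op A (\<lambda>_. 0) = (\<lambda>_. 0)" for A :: "nat \<Rightarrow> nat \<Rightarrow> complex^'a^'a"
    by (simp add: block_op_def fun_eq_iff)
  ultimately show ?thesis
    by (auto simp: op_entry_def Qproj_def hankel_def hankel_tilde_def)
qed

lemma summable_on_mult_squares:
  fixes f g :: "'i \<Rightarrow> real"
  assumes "(\<lambda>i. (f i)\<^sup>2) summable_on X" "(\<lambda>i. (g i)\<^sup>2) summable_on X"
  shows "(\<lambda>i. f i * g i) summable_on X"
  by (rule abs_summable_summable, rule Infinite_Sum.abs_summable_product)
     (use assms in \<open>simp_all add: power2_eq_square\<close>)

section \<open>The determinant identity\<close>

definition to_int :: "nat \<times> 'n \<Rightarrow> int \<times> 'n" where
  "to_int i = (int (fst i), snd i)"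

lemma to_int_simps [simp]: "fst (to_int i) = int (fst i)" "snd (to_int i) = snd i"
  by (simp_all add: to_int_def)

lemma inj_to_int: "inj_on to_int X"
  by (auto simp: inj_on_def to_int_def prod_eq_iff)

lemma to_int_eq_iff: "to_int i = to_int j \<longleftrightarrow> i = j"
  by (simp add: to_int_def prod_eq_iff)

lemma to_int_image: "to_int ` ({..<n} \<times> UNIV) = {i. 0 \<le> fst i \<and> fst i < int n}"
proof
  show "{i :: int \<times> 'a. 0 \<le> fst i \<and> fst i < int n} \<subseteq> to_int ` ({..<n} \<times> UNIV)"
  proof
    fix i :: "int \<times> 'a" assume "i \<in> {i. 0 \<le> fst i \<and> fst i < int n}"
    then have "i = to_int (nat (fst i), snd i)" "nat (fst i) < n" by (auto simp: to_int_def)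
    then show "i \<in> to_int ` ({..<n} \<times> UNIV)" by (metis UNIV_I imageI lessThan_iff mem_Sigma_iff)
  qed
qed auto

lemma range_to_int: "range to_int = {i. 0 \<le> fst i}"
proof
  show "{i :: int \<times> 'a. 0 \<le> fst i} \<subseteq> range to_int"
  proof
    fix i :: "int \<times> 'a" assume "i \<in> {i. 0 \<le> fst i}"
    then have "i = to_int (nat (fst i), snd i)" by (auto simp: to_int_def)
    then show "i \<in> range to_int" by (rule range_eqI)
  qed
qed auto

text \<open>
  Between two copies of the projection onto \<open>0 \<le> j < n\<close> the infinite sums in the products are finite.
\<close>
lemma det_on_section_product:
  fixes X R A S :: "(int \<times> 'n::finite) bmat" and n :: nat
  defines "J \<equiv> {..<n} \<times> (UNIV :: 'n set)"
  assumes eq: "section_part n * X * section_part n =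
      section_part n * R * section_part n * A * section_part n * S * section_part n"
  shows "det_on J (\<lambda>i j. entry X (to_int i) (to_int j)) =
    det_on J (\<lambda>i j. entry R (to_int i) (to_int j)) * det_on J (\<lambda>i j. entry A (to_int i) (to_int j)) *
    det_on J (\<lambda>i j. entry S (to_int i) (to_int j))"
proof -
  have J: "finite J" by (simp add: J_def)
  have sum: "entry (M * section_part n * N) i j = (\<Sum>k\<in>J. entry M i (to_int k) * entry N (to_int k) j)" for M N i j
  proof -
    have "entry (M * section_part n * N) i j = (\<Sum>k\<in>to_int ` J. entry M i k * entry N k j)"
      unfolding J_def to_int_image[symmetric] by (rule entry_mult_restrictor_mult) simp
    then show ?thesis by (simp add: sum.reindex[OF inj_to_int])
  qed
  have "det_on J (\<lambda>i j. entry X (to_int i) (to_int j)) =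
      det_on J (\<lambda>i j. entry (R * section_part n * (A * section_part n * S)) (to_int i) (to_int j))"
  proof (rule det_on_cong)
    fix i j assume ij: "i \<in> J" "j \<in> J"
    have drop: "entry (section_part n * M * section_part n) (to_int i) (to_int j) = entry M (to_int i) (to_int j)" for M
      using ij by (simp add: entry_restrictor_mult entry_mult_restrictor J_def mem_Times_iff)
    have "section_part n * X * section_part n = section_part n * (R * section_part n * (A * section_part n * S)) * section_part n"
      unfolding eq by (simp only: mult.assoc)
    from arg_cong[OF this, of "\<lambda>M. entry M (to_int i) (to_int j)"]
    show "entry X (to_int i) (to_int j) = entry (R * section_part n * (A * section_part n * S)) (to_int i) (to_int j)"
      unfolding drop .
  qed
  also have "\<dots> = det_on J (\<lambda>i j. entry R (to_int i) (to_int j)) *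
      det_on J (\<lambda>i j. entry (A * section_part n * S) (to_int i) (to_int j))"
    unfolding sum[of R] by (rule det_on_mult[OF J])
  also have "det_on J (\<lambda>i j. entry (A * section_part n * S) (to_int i) (to_int j)) =
      det_on J (\<lambda>i j. entry A (to_int i) (to_int j)) * det_on J (\<lambda>i j. entry S (to_int i) (to_int j))"
    unfolding sum[of A] by (rule det_on_mult[OF J])
  finally show ?thesis by (simp only: mult.assoc)
qed

text \<open>
  The reflection \<open>l \<mapsto> -l - 1\<close> carries the negative indices, over which the product runs in the ring, to the
  index set of the inner sum of the two Hankel operators.
\<close>
lemma entry_hankel_product:
  fixes M N :: "(int \<times> 'n::finite) bmat"
  assumes M: "\<And>i j. entry M i j = mfourier b (fst i - fst j) $ snd i $ snd j"
    and N: "\<And>i j. entry N i j = mfourier c (fst i - fst j) $ snd i $ snd j"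
  shows "op_entry (hankel b \<circ> hankel_tilde c) i j =
    entry (nonneg_part * M * (1 - nonneg_part) * N * nonneg_part) (to_int i) (to_int j)"
proof -
  let ?h = "\<lambda>l :: nat \<times> 'n. (- int (fst l) - 1, snd l)"
  let ?f = "\<lambda>p l. mfourier b (int (fst i) + int (fst l) + 1) $ p $ snd l * mfourier c (- int (fst l) - int (fst j) - 1) $ snd l $ snd j"
  have h: "inj_on ?h UNIV" "range ?h = {l. fst l < 0}"
  proof -
    show "inj_on ?h UNIV" by (auto simp: inj_on_def prod_eq_iff)
    have "l \<in> range ?h" if "fst l < 0" for l :: "int \<times> 'n"
      using that by (intro range_eqI[of _ _ "(nat (- fst l - 1), snd l)"]) (simp add: prod_eq_iff)
    then show "range ?h = {l. fst l < 0}" by auto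
  qed
  have f: "entry M (int (fst i), p) (?h l) * entry N (?h l) (to_int j) = ?f p l" for p l
    unfolding M N by (simp add: algebra_simps)
  have sm: "?f p summable_on UNIV" for p
  proof -
    have "(\<lambda>l. entry M (int (fst i), p) l * entry N l (to_int j)) summable_on range ?h"
      by (rule entry_mult_summable)
    then show ?thesis unfolding summable_on_reindex[OF h(1)] o_def f .
  qed
  have sm': "(\<lambda>l. \<Sum>r\<in>UNIV. ?f p (l, r)) summable_on UNIV" for p
    using summable_on_Sigma_banach[of "\<lambda>l r. ?f p (l, r)" UNIV "\<lambda>_. UNIV"] sm[of p]
    by (simp add: case_prod_unfold)
  have "op_entry (hankel b \<circ> hankel_tilde c) i j = (\<Sum>\<^sub>\<infinity>l. \<Sum>r\<in>UNIV. ?f (snd i) (l, r))"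
    using op_entry_hankel[of b i c j] sm' by simp
  also have "\<dots> = infsum (?f (snd i)) UNIV"
    using infsum_UNIV_prod_finite[OF sm[of "snd i"]] by simp
  also have "\<dots> = (\<Sum>\<^sub>\<infinity>l\<in>range ?h. entry M (to_int i) l * entry N l (to_int j))"
    unfolding infsum_reindex[OF h(1)] o_def using f[of "snd i"] by (simp add: to_int_def)
  also have "\<dots> = (\<Sum>\<^sub>\<infinity>l. entry (M * (1 - nonneg_part)) (to_int i) l * entry N l (to_int j))"
    unfolding h(2) one_minus_restrictor
    by (rule infsum_cong_neutral) (auto simp: entry_mult_restrictor)
  also have "\<dots> = entry (M * (1 - nonneg_part) * N) (to_int i) (to_int j)"
    unfolding times_bmat.rep_eq[of "M * (1 - nonneg_part)"] ..
  also have "\<dots> = entry (nonneg_part * (M * (1 - nonneg_part) * N) * nonneg_part) (to_int i) (to_int j)"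
    by (simp add: entry_restrictor_mult entry_mult_restrictor)
  finally show ?thesis by (simp only: mult.assoc)
qed

theorem theorem1p1:
  fixes a um up vp vm b c :: "complex \<Rightarrow> complex^'n^'n"
    and G E :: complex and n :: nat
  assumes "a \<in> Phi_r K2_half \<inter> Phi_l K2_half"
    and "right_WH K2_half a um up"
    and "left_WH K2_half a vp vm"
    and "b = (\<lambda>z. vm z ** minv up z)"
    and "c = (\<lambda>z. minv um z ** vp z)"
    and "G = fourier (\<lambda>z. det (vp z)) 0 * fourier (\<lambda>z. det (vm z)) 0"
    and "E = 1 / fredholm_det_I_minus (hankel b \<circ> hankel_tilde c)"
    and "n \<ge> 1"
  shows "det_toeplitz n a =
    G ^ n * E * fredholm_det_I_minus (Qproj n \<circ> hankel b \<circ> hankel_tilde c \<circ> Qproj n)"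
proof -
  have K2_Linf: "u \<in> Linf" if "u \<in> K2_half" for u :: "complex \<Rightarrow> complex^'n^'n"
    using that by (simp add: K2_half_def)
  have um: "um \<in> K2_half" "um \<in> Hinf_minus" "minv um \<in> K2_half" "minv um \<in> Hinf_minus"
      "AE t in circle_param. invertible (um (cis t))"
    and up: "up \<in> K2_half" "up \<in> Hinf_plus" "minv up \<in> K2_half" "minv up \<in> Hinf_plus"
      "AE t in circle_param. invertible (up (cis t))"
    and a_right: "AE t in circle_param. a (cis t) = um (cis t) ** up (cis t)"
    using assms(2) by (simp_all add: right_WH_def unit_in_def)
  have vp: "vp \<in> K2_half" "vp \<in> Hinf_plus" "minv vp \<in> K2_half" "minv vp \<in> Hinf_plus"
      "AE t in circle_param. invertible (vp (cis t))"
    and vm: "vm \<in> K2_half" "vm \<in> Hinf_minus" "minv vm \<in> K2_half" "minv vm \<in> Hinf_minus"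
      "AE t in circle_param. invertible (vm (cis t))"
    and a_left: "AE t in circle_param. a (cis t) = vp (cis t) ** vm (cis t)"
    using assms(3) by (simp_all add: left_WH_def unit_in_def)
  note Linf = K2_Linf[OF um(1)] K2_Linf[OF um(3)] K2_Linf[OF up(1)] K2_Linf[OF up(3)]
    K2_Linf[OF vp(1)] K2_Linf[OF vp(3)] K2_Linf[OF vm(1)] K2_Linf[OF vm(3)]
  define U U' V V' where "U = laurent um" "U' = laurent (minv um)" "V = laurent up" "V' = laurent (minv up)"
  define R R' S S' where "R = laurent vp" "R' = laurent (minv vp)" "S = laurent vm" "S' = laurent (minv vm)"
  note laurent_defs = U_U'_V_V'_def R_R'_S_S'_def
  let ?P = "nonneg_part :: (int \<times> 'n) bmat" and ?Pn = "section_part n :: (int \<times> 'n) bmat"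
  define A where "A = ?P * R' * ?P * U * V * ?P * S' * ?P"
  define K where "K = ?P * S * V' * (1 - ?P) * U' * R * ?P"
  have entry_UV: "entry (U * V) i j = mfourier a (fst i - fst j) $ snd i $ snd j" for i j
    unfolding laurent_defs by (rule mfourier_mult[symmetric]) (use Linf a_right in auto)
  have entry_RS: "entry (R * S) i j = mfourier a (fst i - fst j) $ snd i $ snd j" for i j
    unfolding laurent_defs by (rule mfourier_mult[symmetric]) (use Linf a_left in auto)
  have UV: "U * V = R * S"
    by (rule entry_inject[THEN iffD1]) (simp add: fun_eq_iff entry_UV entry_RS)
  have PP: "?P * ?P = ?P" by (simp add: restrictor_mult)
  have PnP: "?Pn * ?P = ?Pn" "?P * ?Pn = ?Pn"
    by (auto simp: restrictor_mult intro!: arg_cong[of _ _ restrictor])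
  have lower: "?P * R' * ?P = R' * ?P" "?P * V * ?P = V * ?P"
    unfolding laurent_defs by (rule laurent_lower(1)[OF vp(4)] laurent_lower(1)[OF up(2)])+
  have upper: "?P * S * ?P = ?P * S" "?P * S' * ?P = ?P * S'" "?P * U' * ?P = ?P * U'"
    unfolding laurent_defs
    by (rule laurent_upper(1)[OF vm(2)] laurent_upper(1)[OF vm(4)] laurent_upper(1)[OF um(4)])+
  have inverse: "R * R' = 1" "R' * R = 1" "S * S' = 1" "S' * S = 1"
    "U * U' = 1" "U' * U = 1" "V * V' = 1" "V' * V = 1"
    unfolding laurent_defs by (intro laurent_minv Linf um up vp vm)+
  \<comment> \<open>the identities \<open>(P - K) A = P\<close> and \<open>P L(a) P = P R P A P S P\<close>\<close>
  have A_eq: "A = ?P + K * A" and factor: "?P * U * V * ?P = ?P * R * ?P * A * ?P * S * ?P"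
    unfolding A_def K_def
    by (rule wiener_hopf_algebra[OF PP lower upper inverse UV])+
  have corner: "?Pn * (U * V) * ?Pn = ?Pn * R * ?Pn * A * ?Pn * S * ?Pn"
  proof -
    have "?Pn * (U * V) * ?Pn = ?Pn * (?P * U * V * ?P) * ?Pn"
      by (simp add: PnP flip: mult.assoc) (simp add: PnP mult.assoc)
    also have "\<dots> = (?Pn * R * ?P) * A * (?P * S * ?Pn)"
      unfolding factor by (simp add: PnP flip: mult.assoc) (simp add: PnP mult.assoc)
    also have "?Pn * R * ?P = ?Pn * R * ?Pn" unfolding laurent_defs by (rule laurent_lower(2)[OF vp(2)])
    also have "?P * S * ?Pn = ?Pn * S * ?Pn" unfolding laurent_defs by (rule laurent_upper(2)[OF vm(2)])
    finally show ?thesis by (simp only: mult.assoc)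
  qed
  let ?J = "{..<n} \<times> (UNIV :: 'n set)"
  define k where "k i j = entry K (to_int i) (to_int j)" for i j
  define \<alpha> where "\<alpha> i j = entry A (to_int i) (to_int j)" for i j
  have det_a: "det_toeplitz n a = G ^ n * det_on ?J \<alpha>"
  proof -
    have "det_toeplitz n a = det_on ?J (\<lambda>i j. entry (U * V) (to_int i) (to_int j))"
      by (simp add: det_toeplitz_def entry_UV case_prod_unfold)
    also have "\<dots> = det_on ?J (\<lambda>i j. entry R (to_int i) (to_int j)) * det_on ?J \<alpha> * det_on ?J (\<lambda>i j. entry S (to_int i) (to_int j))"
      unfolding \<alpha>_def by (rule det_on_section_product[OF corner])
    also have "det_on ?J (\<lambda>i j. entry R (to_int i) (to_int j)) = det (mfourier vp 0) ^ n"
    proof -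
      have zero: "mfourier vp k = 0" if "k < 0" for k
        using vp(2) that by (auto simp: Hinf_plus_def dest!: spec[of _ "- k"])
      show ?thesis
        using det_on_block_toeplitz_lower[of "mfourier vp" n, OF zero]
        by (simp add: laurent_defs entry_laurent Linf)
    qed
    also have "det_on ?J (\<lambda>i j. entry S (to_int i) (to_int j)) = det (mfourier vm 0) ^ n"
    proof -
      have zero: "mfourier vm k = 0" if "0 < k" for k
        using vm(2) that by (auto simp: Hinf_minus_def)
      show ?thesis
        using det_on_block_toeplitz_upper[of "mfourier vm" n, OF zero]
        by (simp add: laurent_defs entry_laurent Linf)
    qed
    also have "det (mfourier vp 0) = fourier (\<lambda>z. det (vp z)) 0"
    proof (rule fourier_det_0[of 1, symmetric])
      show "hardy 1 (\<lambda>t. vp (cis t) $ p $ q)" for p q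
        unfolding hardy_def mfourier_nth[symmetric]
        using vp(2) Linf_entry[OF Linf(5)] by (auto simp: Hinf_plus_def dest!: spec[of _ "- _"])
    qed simp
    also have "det (mfourier vm 0) = fourier (\<lambda>z. det (vm z)) 0"
    proof (rule fourier_det_0[of "- 1", symmetric])
      show "hardy (- 1) (\<lambda>t. vm (cis t) $ p $ q)" for p q
        unfolding hardy_def mfourier_nth[symmetric]
        using vm(2) Linf_entry[OF Linf(7)] by (auto simp: Hinf_minus_def)
    qed simp
    finally show ?thesis by (simp add: assms(6) power_mult_distrib mult_ac)
  qed
  have QQ: "(1 - ?P) * (1 - ?P) = 1 - ?P" by (simp add: one_minus_restrictor restrictor_mult)
  \<comment> \<open>\<open>H(b)\<close> and the Hankel operator of \<open>c\<close> inherit the Hilbert-Schmidt property from \<open>up\<^sup>-\<^sup>1\<close> and \<open>um\<^sup>-\<^sup>1\<close>\<close>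
  have "hilbert_schmidt (?P * S * (?P * V' * (1 - ?P)))"
    unfolding laurent_defs one_minus_restrictor
    by (rule hilbert_schmidt_mult_left[OF K2_half_hilbert_schmidt(1)[OF up(3)]])
  also have "?P * S * (?P * V' * (1 - ?P)) = ?P * S * V' * (1 - ?P)"
    using laurent_upper(1)[OF vm(2)] unfolding laurent_defs by (simp flip: mult.assoc)
  finally have HS1: "hilbert_schmidt (?P * S * V' * (1 - ?P))" .
  have "hilbert_schmidt ((1 - ?P) * U' * ?P * (R * ?P))"
    unfolding laurent_defs one_minus_restrictor
    by (rule hilbert_schmidt_mult_right[OF K2_half_hilbert_schmidt(2)[OF um(3)]])
  also have "(1 - ?P) * U' * ?P * (R * ?P) = (1 - ?P) * U' * (R * ?P)"
    using laurent_lower(1)[OF vp(2)] unfolding laurent_defs by (simp add: mult.assoc)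
  finally have HS2: "hilbert_schmidt ((1 - ?P) * U' * (R * ?P))" .
  have "(?P * S * V' * (1 - ?P)) * ((1 - ?P) * U' * (R * ?P)) = ?P * S * V' * ((1 - ?P) * (1 - ?P)) * U' * R * ?P"
    by (simp only: mult.assoc)
  then have K_split: "(?P * S * V' * (1 - ?P)) * ((1 - ?P) * U' * (R * ?P)) = K" by (simp only: QQ K_def)
  obtain \<beta> \<gamma> where K_le: "\<And>i j. norm (entry K i j) \<le> \<beta> i * \<gamma> j"
    and nonneg: "\<And>i. 0 \<le> \<beta> i" "\<And>i. 0 \<le> \<gamma> i"
    and sm: "(\<lambda>i. (\<beta> i)\<^sup>2) summable_on UNIV" "(\<lambda>i. (\<gamma> i)\<^sup>2) summable_on UNIV"
    using hilbert_schmidt_mult_entry_bound[OF HS1 HS2] unfolding K_split by metis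
  have index_summable: "(\<lambda>i. f (to_int i)) summable_on UNIV" if "f summable_on UNIV" for f :: "int \<times> 'n \<Rightarrow> real"
    using summable_on_subset[OF that, of "range to_int"] summable_on_reindex[OF inj_to_int, of f UNIV] by (simp add: o_def)
  let ?\<beta> = "\<lambda>i. \<beta> (to_int i)" and ?\<gamma> = "\<lambda>i. \<gamma> (to_int i)"
  have k_le: "norm (k i j) \<le> ?\<beta> i * ?\<gamma> j" for i j unfolding k_def by (rule K_le)
  have \<beta>\<gamma>: "(\<lambda>i. ?\<beta> i * ?\<gamma> i) summable_on UNIV"
    by (intro summable_on_mult_squares index_summable[OF sm(1)] index_summable[OF sm(2)])
  have \<alpha>_summable: "(\<lambda>i. ?\<gamma> i * norm (\<alpha> i j)) summable_on UNIV" for j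
    unfolding \<alpha>_def
    by (intro summable_on_mult_squares index_summable[OF sm(2)] index_summable[OF entry_columns])
  \<comment> \<open>\<open>A = P + K A\<close>, read on the nonnegative indices\<close>
  have \<alpha>_eq: "\<alpha> i j = of_bool (i = j) + (\<Sum>\<^sub>\<infinity>l. k i l * \<alpha> l j)" for i j
  proof -
    have "K * ?P = K" unfolding K_def by (simp add: mult.assoc PP)
    then have zero: "entry K i' l = 0" if "l \<notin> range to_int" for i' l
      using that entry_mult_restrictor[of K "{i. 0 \<le> fst i}" i' l] by (simp add: range_to_int)
    have "entry (K * A) (to_int i) (to_int j) = (\<Sum>\<^sub>\<infinity>l\<in>range to_int. entry K (to_int i) l * entry A l (to_int j))"
      unfolding times_bmat.rep_eq by (rule infsum_cong_neutral) (auto simp: zero)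
    also have "\<dots> = (\<Sum>\<^sub>\<infinity>l. k i l * \<alpha> l j)"
      by (simp add: infsum_reindex[OF inj_to_int] o_def k_def \<alpha>_def)
    finally have KA: "entry (K * A) (to_int i) (to_int j) = (\<Sum>\<^sub>\<infinity>l. k i l * \<alpha> l j)" .
    have "\<alpha> i j = entry (?P + K * A) (to_int i) (to_int j)"
      unfolding \<alpha>_def using A_eq by (rule arg_cong)
    then show ?thesis by (simp add: plus_bmat.rep_eq restrictor.rep_eq to_int_eq_iff KA)
  qed
  have jacobi: "det_on ({..<m} \<times> UNIV) \<alpha> * fredholm_series UNIV k = fredholm_series (- ({..<m} \<times> UNIV)) k" for m
    by (rule fredholm_series_jacobi[OF k_le nonneg \<beta>\<gamma> _ \<alpha>_summable \<alpha>_eq]) simp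
  \<comment> \<open>Jacobi's identity over a large finite block: its right side does not vanish\<close>
  have nonzero: "fredholm_series UNIV k \<noteq> 0"
  proof -
    obtain H where H: "finite H" "\<forall>J. H \<subseteq> J \<longrightarrow> fredholm_series (- J) k \<noteq> 0"
      by (rule fredholm_series_tail_nonzero[OF k_le nonneg \<beta>\<gamma>])
    obtain m where "\<forall>i\<in>fst ` H. i < m" using H(1) finite_nat_set_iff_bounded[of "fst ` H"] by auto
    then have "H \<subseteq> {..<m} \<times> UNIV" by auto
    with H(2) have "fredholm_series (- ({..<m} \<times> UNIV)) k \<noteq> 0" by blast
    then show ?thesis using jacobi[of m] by auto
  qed
  have entries: "op_entry (hankel b \<circ> hankel_tilde c) i j = k i j" for i j
  proof -
    have "op_entry (hankel b \<circ> hankel_tilde c) i j = entry (?P * (S * V') * (1 - ?P) * (U' * R) * ?P) (to_int i) (to_int j)"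
    proof (rule entry_hankel_product)
      show "entry (S * V') i j = mfourier b (fst i - fst j) $ snd i $ snd j" for i j
        unfolding laurent_defs by (rule mfourier_mult[symmetric]) (simp_all add: Linf assms(4))
      show "entry (U' * R) i j = mfourier c (fst i - fst j) $ snd i $ snd j" for i j
        unfolding laurent_defs by (rule mfourier_mult[symmetric]) (simp_all add: Linf assms(5))
    qed
    then show ?thesis by (simp add: k_def K_def mult.assoc)
  qed
  have E: "fredholm_det_I_minus (hankel b \<circ> hankel_tilde c) = fredholm_series UNIV k"
    by (rule fredholm_det_I_minus_eq_series[OF k_le nonneg \<beta>\<gamma>]) (simp only: entries UNIV_I simp_thms if_True)
  have Q: "fredholm_det_I_minus (Qproj n \<circ> hankel b \<circ> hankel_tilde c \<circ> Qproj n) = fredholm_series (- ?J) k"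
    by (rule fredholm_det_I_minus_eq_series[OF k_le nonneg \<beta>\<gamma>])
       (auto simp only: op_entry_Qproj entries mem_Times_iff Compl_iff lessThan_iff not_less UNIV_I simp_thms)
  have "G ^ n * E * fredholm_series (- ?J) k = G ^ n * det_on ?J \<alpha>"
    unfolding assms(7) E jacobi[symmetric] using nonzero by simp
  then show ?thesis unfolding det_a Q ..
qed

end
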